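(* Let $d\ge2$ and let $G\subset\Pi_d$ be a subgroup acting transitively on $\{1,\dots,d\}$. Let $\mathcal H$ be the collection of all subgroups of $G$ which fail to act transitively on $\{1,\dots,d\}$. Let $(S_2,\alpha_2)$ be Chamanara's surface and $\Gamma=\pi_1(S_2,s_0)$. (a) Let $h\in\mathrm{Hom}(\Gamma,G)$. The translation flow on the cover $(\tilde S_h,\tilde\alpha_h)$ of $(S_2,\alpha_2)$ associated to $[h]$ is non-ergodic whenever there is an $H\in\mathcal H$ so that every accumulation point of $h\circ\phi_\beta^{-n}$ (as $n\to+\infty$) lies in $\mathrm{Hom}(\Gamma,H)$. (b) For any $H\in\mathcal H$, there exists a collection of connected covers, dense in $\mathrm{Cov}_G(S_2,\alpha_2)$, such that for each cover $[h]$ in the collection every accumulation point of the sequence $[h\circ\phi_\beta^{-n}]$ (as $n\to+\infty$) lies in $\Pi_d\backslash\mathrm{Hom}(\Gamma,H)$, but no accumulation point lies in $\Pi_d\backslash\mathrm{Hom}(\Gamma,H')$ for any proper subgroup $H'\subset H$.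
   Context: Chamanara's surface $(S_2,\alpha_2)$: take the closed unit square $[0,1]^2$ with the $1$-form $dz$. For each integer $k\ge1$ glue by translation the right-side interval $\{1\}\times[1-2^{-(k-1)},1-2^{-k}]$ to the left-side interval $\{0\}\times[2^{-k},2^{-(k-1)}]$; this is the vertical edge labeled $k$ (length $2^{-k}$). For each integer $k\ge0$ glue by translation the top interval $[1-2^{-k},1-2^{-k-1}]\times\{1\}$ to the bottom interval $[2^{-k-1},2^{-k}]\times\{0\}$; this is the horizontal edge labeled $-k$ (length $2^{-k-1}$). Discard the endpoints of all the intervals and the corners of the square. The translation flow is the horizontal unit speed rightward flow; ergodicity is with respect to Lebesgue measure. Fix a basepoint $s_0$ in the interior of the square near its southwest corner. $\Gamma=\pi_1(S_2,s_0)$ is freely generated by $\{\gamma_n:n\in\mathbb Z\}$: for $n\le0$, $\gamma_n$ moves downward from $s_0$ through the horizontal edge labeled $n$ and returns to $s_0$ without crossing other labeled edges; for $n>0$, $\gamma_n$ moves rightward from $s_0$ across the vertical edge labeled $n$ and returns likewise. Products are concatenations with the left path traversed first. The surface has an affine automorphism $\phi:S_2\to S_2$ with derivative $\mathrm{diag}(1/2,2)$: the image $[0,\tfrac12]\times[0,2]$ of the square is placed in the surface by passing its upper half through the horizontal edge labeled $0$. Let $\beta$ be a curve from $\phi^{-1}(s_0)$ to $s_0$ inside the interior of the square, and let $\phi_\beta^{-1}:\Gamma\to\Gamma$ be the automorphism $[\gamma]\mapsto[\beta^{-1}\bullet(\phi^{-1}\circ\gamma)\bullet\beta]$. Explicitly,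 $\phi_\beta^{-1}(\gamma_n)=\gamma_{n+1}\gamma_1^{-1}$ for $n<0$, $\phi_\beta^{-1}(\gamma_0)=\gamma_1$, and $\phi_\beta^{-1}(\gamma_n)=\gamma_1\gamma_{n+1}$ for $n>0$. $\phi_\beta^{-n}$ denotes the $n$-th power of $\phi_\beta^{-1}$. $\Pi_d$ is the symmetric group on $\{1,\dots,d\}$. Each $h\in\mathrm{Hom}(\Gamma,G)$ is the monodromy homomorphism of a degree $d$ unbranched (possibly disconnected) cover $(\tilde S_h,\tilde\alpha_h)$, with pulled-back $1$-form, which depends up to isomorphism only on the $\Pi_d$-conjugacy class $[h]$. $\mathrm{Hom}(\Gamma,G)$ has the topology of pointwise convergence. $\mathrm{Cov}_G(S_2,\alpha_2)$, the space of covers with monodromy in $G$ up to translation equivalence (homeomorphism which is a translation in local coordinates), is identified with $\Pi_d\backslash\mathrm{Hom}(\Gamma,G)$ ($\Pi_d$ acting by conjugation) with the quotient topology. For a subgroup $H\subset G$, $\Pi_d\backslash\mathrm{Hom}(\Gamma,H)$ denotes the image of $\mathrm{Hom}(\Gamma,H)$ in $\Pi_d\backslash\mathrm{Hom}(\Gamma,G)$. *)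

theory Defs
  imports "HOL-Analysis.Analysis" "HOL-Algebra.Sym_Groups"
begin

section \<open>Topological preliminaries\<close>

definition quotient_topology :: "'a topology \<Rightarrow> ('a \<Rightarrow> 'b) \<Rightarrow> 'b topology" where
  "quotient_topology X f =
     topology (\<lambda>U. U \<subseteq> f ` topspace X \<and> openin X {x \<in> topspace X. f x \<in> U})"

lemma openin_quotient_topology:
  "openin (quotient_topology X f) U \<longleftrightarrow>
     U \<subseteq> f ` topspace X \<and> openin X {x \<in> topspace X. f x \<in> U}"
proof -
  have inter: "openin X {x \<in> topspace X. f x \<in> S \<inter> T}"
    if "openin X {x \<in> topspace X. f x \<in> S}" "openin X {x \<in> topspace X. f x \<in> T}" for S T
  proof -
    have "{x \<in> topspace X. f x \<in> S \<inter> T} =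
          {x \<in> topspace X. f x \<in> S} \<inter> {x \<in> topspace X. f x \<in> T}"
      by auto
    with that show ?thesis by auto
  qed
  have union: "openin X {x \<in> topspace X. f x \<in> \<Union>K}"
    if "\<And>S. S \<in> K \<Longrightarrow> openin X {x \<in> topspace X. f x \<in> S}" for K
  proof -
    have "{x \<in> topspace X. f x \<in> \<Union>K} = (\<Union>S\<in>K. {x \<in> topspace X. f x \<in> S})"
      by auto
    with that show ?thesis by auto
  qed
  have "istopology (\<lambda>U. U \<subseteq> f ` topspace X \<and> openin X {x \<in> topspace X. f x \<in> U})"
    unfolding istopology_def using inter union by blast
  then show ?thesis
    by (simp add: quotient_topology_def topology_inverse')
qed

lemma quotient_map_quotient_topology: "quotient_map X (quotient_topology X f) f"
proof -
  have "{x \<in> topspace X. f x \<in> f ` topspace X} = topspace X"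
    by auto
  then have "openin (quotient_topology X f) (f ` topspace X)"
    by (simp add: openin_quotient_topology)
  then have "topspace (quotient_topology X f) = f ` topspace X"
    by (meson openin_quotient_topology openin_subset openin_topspace subset_antisym)
  then show ?thesis
    by (auto simp: quotient_map_def openin_quotient_topology)
qed

definition accumulation_point :: "'a topology \<Rightarrow> (nat \<Rightarrow> 'a) \<Rightarrow> 'a \<Rightarrow> bool" where
  "accumulation_point X s x \<longleftrightarrow>
     x \<in> topspace X \<and> (\<forall>U. openin X U \<and> x \<in> U \<longrightarrow> (\<exists>\<^sub>F n in sequentially. s n \<in> U))"

definition path_class :: "(real \<Rightarrow> 'a::topological_space) \<Rightarrow> (real \<Rightarrow> 'a) set" where
  "path_class p = {q. homotopic_paths UNIV p q}"

text \<open>In a product, the left-hand loop is traversed first.\<close>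

definition fundamental_group :: "'a::topological_space \<Rightarrow> (real \<Rightarrow> 'a) set monoid" where
  "fundamental_group a =
     \<lparr>carrier = {path_class p | p. path p \<and> pathstart p = a \<and> pathfinish p = a},
      mult = (\<lambda>A B. {r. \<exists>p\<in>A. \<exists>q\<in>B. homotopic_paths UNIV (p +++ q) r}),
      one = path_class (\<lambda>_. a)\<rparr>"


section \<open>Chamanara's surface\<close>

definition square_interior :: "(real \<times> real) set" where
  "square_interior = {0<..<1} \<times> {0<..<1}"

text \<open>
  The edge labelled \<open>n\<close> appears twice on the boundary of the square:
  a path crossing it in the positive direction (rightward for \<open>n > 0\<close>, downward for
  \<open>n \<le> 0\<close>) leaves the square through \<open>exit_edge n\<close> (right, respectively bottom, side) and
  re-enters it through \<open>entry_edge n\<close> (left, respectively top, side).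
  The intervals are open because endpoints are discarded.
\<close>

definition exit_edge :: "int \<Rightarrow> (real \<times> real) set" where
  "exit_edge n =
     (if n > 0 then {1} \<times> {1 - 2 powi (1 - n) <..< 1 - 2 powi (- n)}
      else {2 powi (n - 1) <..< 2 powi n} \<times> {0})"

definition entry_edge :: "int \<Rightarrow> (real \<times> real) set" where
  "entry_edge n =
     (if n > 0 then {0} \<times> {2 powi (- n) <..< 2 powi (1 - n)}
      else {1 - 2 powi n <..< 1 - 2 powi (n - 1)} \<times> {1})"

text \<open>The translation carrying \<open>exit_edge n\<close> onto \<open>entry_edge n\<close>.\<close>

definition edge_shift :: "int \<Rightarrow> real \<times> real" where
  "edge_shift n =
     (if n > 0 then (- 1, 2 powi (1 - n) + 2 powi (- n) - 1)
      else (1 - 2 powi n - 2 powi (n - 1), 1))"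

lemma translate_exit_edge: "(\<lambda>z. z + edge_shift n) ` exit_edge n = entry_edge n"
proof -
  have "w \<in> (\<lambda>z. z + edge_shift n) ` exit_edge n \<longleftrightarrow> w - edge_shift n \<in> exit_edge n" for w
    by (metis (no_types, lifting) add_diff_cancel_right' diff_add_cancel image_iff)
  then show ?thesis
    by (auto simp: exit_edge_def entry_edge_def edge_shift_def)
qed

definition square :: "(real \<times> real) set" where
  "square = square_interior \<union> (\<Union>n. exit_edge n) \<union> (\<Union>n. entry_edge n)"

definition edge_gluing :: "((real \<times> real) \<times> (real \<times> real)) set" where
  "edge_gluing = {(z, z + edge_shift n) | n z. z \<in> exit_edge n}"

definition chamanara_rel :: "real \<times> real \<Rightarrow> real \<times> real \<Rightarrow> bool" where
  "chamanara_rel z w \<longleftrightarrow>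
     z \<in> square \<and> w \<in> square \<and> (z, w) \<in> (edge_gluing \<union> edge_gluing\<inverse>)\<^sup>*"

quotient_type chamanara = "real \<times> real" / partial: chamanara_rel
proof (rule part_equivpI)
  have "(1/2, 1/2) \<in> square"
    by (simp add: square_def square_interior_def)
  then show "\<exists>z. chamanara_rel z z"
    by (auto simp: chamanara_rel_def)
  show "symp chamanara_rel"
  proof (rule sympI)
    fix z w
    have "sym ((edge_gluing \<union> edge_gluing\<inverse>)\<^sup>*)"
      by (simp add: sym_Un_converse sym_rtrancl)
    moreover assume "chamanara_rel z w"
    ultimately show "chamanara_rel w z"
      by (auto simp: chamanara_rel_def dest: symD)
  qed
  show "transp chamanara_rel"
    by (rule transpI) (auto simp: chamanara_rel_def)
qed

abbreviation surface_point :: "real \<times> real \<Rightarrow> chamanara" where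
  "surface_point \<equiv> abs_chamanara"

instantiation chamanara :: topological_space
begin

definition open_chamanara :: "chamanara set \<Rightarrow> bool" where
  "open_chamanara U \<longleftrightarrow> openin (top_of_set square) {z \<in> square. surface_point z \<in> U}"

instance
proof
  show "open (UNIV :: chamanara set)"
    by (simp add: open_chamanara_def)
  show "open (S \<inter> T)" if "open S" "open T" for S T :: "chamanara set"
  proof -
    have "{z \<in> square. surface_point z \<in> S \<inter> T} =
          {z \<in> square. surface_point z \<in> S} \<inter> {z \<in> square. surface_point z \<in> T}"
      by auto
    with that show ?thesis
      by (simp add: open_chamanara_def openin_Int)
  qed
  show "open (\<Union>K)" if "\<forall>S\<in>K. open S" for K :: "chamanara set set"
  proof -
    have "{z \<in> square. surface_point z \<in> \<Union>K} = (\<Union>S\<in>K. {z \<in> square. surface_point z \<in> S})"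
      by auto
    with that show ?thesis
      by (auto simp: open_chamanara_def)
  qed
qed

end

text \<open>
  The affine automorphism \<open>\<phi>\<close>: apply \<open>diag(1/2, 2)\<close>, then move the upper half of the
  image, \<open>[0,1/2] \<times> [1,2]\<close>, through the horizontal edge \<open>0\<close>, that is, by the translation
  \<open>(1/2, -1)\<close>.  The value does not depend on the chosen representative in the square.
\<close>

definition phi :: "chamanara \<Rightarrow> chamanara" where
  "phi s = (let (x, y) = rep_chamanara s in
     if y \<le> 1/2 then surface_point (x / 2, 2 * y)
     else surface_point (x / 2 + 1/2, 2 * y - 1))"


section \<open>The fundamental group\<close>

abbreviation Pi1 :: "real \<times> real \<Rightarrow> (real \<Rightarrow> chamanara) set monoid" where
  "Pi1 s0 \<equiv> fundamental_group (surface_point s0)"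

definition exit_midpoint :: "int \<Rightarrow> real \<times> real" where
  "exit_midpoint n =
     (if n > 0 then (1, 1 - 3 * 2 powi (- n) / 2) else (3 * 2 powi (n - 1) / 2, 0))"

lemma exit_midpoint_in_exit_edge: "exit_midpoint n \<in> exit_edge n"
proof -
  have "(2::real) powi (1 - n) = 2 * 2 powi (- n)"
    by (simp add: power_int_diff power_int_minus divide_inverse)
  moreover have "(2::real) powi n = 2 * 2 powi (n - 1)"
    by (simp add: power_int_diff)
  moreover have "(2::real) powi (- n) > 0" "(2::real) powi (n - 1) > 0"
    by simp_all
  ultimately show ?thesis
    by (auto simp: exit_midpoint_def exit_edge_def)
qed

text \<open>
  The generator \<open>\<gamma>\<^sub>n\<close>: straight to the middle of the exit edge \<open>n\<close>, which is the same point
  of the surface as the middle of the entry edge \<open>n\<close>, and from there straight back.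
\<close>

definition gamma :: "real \<times> real \<Rightarrow> int \<Rightarrow> (real \<Rightarrow> chamanara) set" where
  "gamma s0 n = path_class
     ((surface_point \<circ> linepath s0 (exit_midpoint n)) +++
      (surface_point \<circ> linepath (exit_midpoint n + edge_shift n) s0))"

text \<open>
  \<open>\<phi>\<^sub>\<beta>\<^sup>-\<^sup>1\<close>, for a curve \<open>\<beta>\<close> in the square from \<open>\<phi>\<^sup>-\<^sup>1(s\<^sub>0)\<close> to \<open>s\<^sub>0\<close>.
\<close>

definition phi_beta_inv ::
  "(real \<Rightarrow> real \<times> real) \<Rightarrow> (real \<Rightarrow> chamanara) set \<Rightarrow> (real \<Rightarrow> chamanara) set" where
  "phi_beta_inv \<beta> A =
     {r. \<exists>p\<in>A. homotopic_paths UNIV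
       (reversepath (surface_point \<circ> \<beta>) +++ (inv' phi \<circ> p) +++ (surface_point \<circ> \<beta>)) r}"


section \<open>Homomorphisms to permutation groups and the space of covers\<close>

definition acts_transitively :: "nat \<Rightarrow> (nat \<Rightarrow> nat) set \<Rightarrow> bool" where
  "acts_transitively d G \<longleftrightarrow> (\<forall>i\<in>{1..d}. \<forall>j\<in>{1..d}. \<exists>g\<in>G. g i = j)"

text \<open>Homomorphisms are taken to be \<open>undefined\<close> outside the carrier, so that distinct
  functions are distinct homomorphisms.\<close>

definition Hom ::
  "nat \<Rightarrow> 'g monoid \<Rightarrow> (nat \<Rightarrow> nat) set \<Rightarrow> ('g \<Rightarrow> nat \<Rightarrow> nat) set" where
  "Hom d \<Gamma> G = hom \<Gamma> (sym_group d\<lparr>carrier := G\<rparr>) \<inter> extensional (carrier \<Gamma>)"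

definition Hom_topology ::
  "nat \<Rightarrow> 'g monoid \<Rightarrow> (nat \<Rightarrow> nat) set \<Rightarrow> ('g \<Rightarrow> nat \<Rightarrow> nat) topology" where
  "Hom_topology d \<Gamma> G =
     subtopology (product_topology (\<lambda>_. discrete_topology G) (carrier \<Gamma>)) (Hom d \<Gamma> G)"

text \<open>
  The class of \<open>h\<close> under conjugation by the full symmetric group, intersected with
  \<open>Hom d \<Gamma> G\<close> (which need not be invariant under that conjugation).
\<close>

definition conj_class ::
  "nat \<Rightarrow> 'g monoid \<Rightarrow> (nat \<Rightarrow> nat) set \<Rightarrow> ('g \<Rightarrow> nat \<Rightarrow> nat) \<Rightarrow> ('g \<Rightarrow> nat \<Rightarrow> nat) set" where
  "conj_class d \<Gamma> G h =
     {h' \<in> Hom d \<Gamma> G. \<exists>\<sigma>. \<sigma> permutes {1..d} \<and> (\<forall>g\<in>carrier \<Gamma>. h' g = \<sigma> \<circ> h g \<circ> inv' \<sigma>)}"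

definition Cov_topology ::
  "nat \<Rightarrow> 'g monoid \<Rightarrow> (nat \<Rightarrow> nat) set \<Rightarrow> ('g \<Rightarrow> nat \<Rightarrow> nat) set topology" where
  "Cov_topology d \<Gamma> G = quotient_topology (Hom_topology d \<Gamma> G) (conj_class d \<Gamma> G)"

text \<open>The sequence \<open>h \<circ> \<phi>\<^sub>\<beta>\<^sup>-\<^sup>n\<close>.\<close>

definition phi_orbit ::
  "real \<times> real \<Rightarrow> (real \<Rightarrow> real \<times> real) \<Rightarrow> ((real \<Rightarrow> chamanara) set \<Rightarrow> nat \<Rightarrow> nat) \<Rightarrow> nat \<Rightarrow>
   (real \<Rightarrow> chamanara) set \<Rightarrow> nat \<Rightarrow> nat" where
  "phi_orbit s0 \<beta> h n = compose (carrier (Pi1 s0)) h (phi_beta_inv \<beta> ^^ n)"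


section \<open>The cover with a given monodromy, its area measure and its horizontal flow\<close>

text \<open>
  The cover with monodromy \<open>h\<close> consists of \<open>d\<close> copies of the square.  Crossing the edge
  \<open>n\<close> in the positive direction leads from sheet \<open>h(\<gamma>\<^sub>n)(j)\<close> to sheet \<open>j\<close>.  So the lift of a
  loop \<open>\<gamma>\<close> that ends on sheet \<open>j\<close> starts on sheet \<open>h(\<gamma>)(j)\<close>; with composition of
  permutations as the product of the symmetric group, this is what makes
  \<open>h(\<gamma>\<gamma>') = h(\<gamma>) \<circ> h(\<gamma>')\<close> agree with traversing \<open>\<gamma>\<close> first.
\<close>

type_synonym sheet_point = "(real \<times> real) \<times> nat"

definition sheets :: "nat \<Rightarrow> sheet_point set" where
  "sheets d = square \<times> {1..d}"

definition sheet_gluing ::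
  "real \<times> real \<Rightarrow> nat \<Rightarrow> ((real \<Rightarrow> chamanara) set \<Rightarrow> nat \<Rightarrow> nat) \<Rightarrow>
   (sheet_point \<times> sheet_point) set" where
  "sheet_gluing s0 d h =
     {((z, h (gamma s0 n) j), (z + edge_shift n, j)) | n z j. z \<in> exit_edge n \<and> j \<in> {1..d}}"

definition cover_point ::
  "real \<times> real \<Rightarrow> nat \<Rightarrow> ((real \<Rightarrow> chamanara) set \<Rightarrow> nat \<Rightarrow> nat) \<Rightarrow>
   sheet_point \<Rightarrow> sheet_point set" where
  "cover_point s0 d h p = (sheet_gluing s0 d h \<union> (sheet_gluing s0 d h)\<inverse>)\<^sup>* `` {p}"

definition cover_topology ::
  "real \<times> real \<Rightarrow> nat \<Rightarrow> ((real \<Rightarrow> chamanara) set \<Rightarrow> nat \<Rightarrow> nat) \<Rightarrow>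
   sheet_point set topology" where
  "cover_topology s0 d h =
     quotient_topology (prod_topology (top_of_set square) (discrete_topology {1..d}))
       (cover_point s0 d h)"

text \<open>Lebesgue measure on the cover: the sum over the sheets of planar Lebesgue measure.\<close>

definition cover_measure ::
  "real \<times> real \<Rightarrow> nat \<Rightarrow> ((real \<Rightarrow> chamanara) set \<Rightarrow> nat \<Rightarrow> nat) \<Rightarrow>
   sheet_point set measure" where
  "cover_measure s0 d h =
     measure_of (cover_point s0 d h ` sheets d)
       {A. A \<subseteq> cover_point s0 d h ` sheets d \<and>
           (\<forall>i\<in>{1..d}. {z \<in> square. cover_point s0 d h (z, i) \<in> A} \<in> sets lebesgue)}
       (\<lambda>A. \<Sum>i=1..d. emeasure lebesgue {z \<in> square. cover_point s0 d h (z, i) \<in> A})"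

text \<open>
  \<open>flows_to s0 d h t p q\<close>: the rightward unit speed flow carries \<open>p\<close> to \<open>q\<close> in time
  \<open>t \<ge> 0\<close>.  The flow is only partially defined, since trajectories which reach a
  discarded point stop there; such trajectories form a null set.
\<close>

inductive flows_to ::
  "real \<times> real \<Rightarrow> nat \<Rightarrow> ((real \<Rightarrow> chamanara) set \<Rightarrow> nat \<Rightarrow> nat) \<Rightarrow>
   real \<Rightarrow> sheet_point set \<Rightarrow> sheet_point set \<Rightarrow> bool"
  for s0 d h where
  segment: "flows_to s0 d h t (cover_point s0 d h ((x, y), i)) (cover_point s0 d h ((x + t, y), i))"
    if "i \<in> {1..d}" "t \<ge> 0" "\<And>s. s \<in> {0..t} \<Longrightarrow> (x + s, y) \<in> square"
| trans: "flows_to s0 d h (s + t) p r"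
    if "flows_to s0 d h s p q" "flows_to s0 d h t q r"

definition flow_invariant ::
  "real \<times> real \<Rightarrow> nat \<Rightarrow> ((real \<Rightarrow> chamanara) set \<Rightarrow> nat \<Rightarrow> nat) \<Rightarrow>
   sheet_point set set \<Rightarrow> bool" where
  "flow_invariant s0 d h A \<longleftrightarrow> (\<forall>t p q. flows_to s0 d h t p q \<longrightarrow> (p \<in> A \<longleftrightarrow> q \<in> A))"

definition flow_ergodic ::
  "real \<times> real \<Rightarrow> nat \<Rightarrow> ((real \<Rightarrow> chamanara) set \<Rightarrow> nat \<Rightarrow> nat) \<Rightarrow> bool" where
  "flow_ergodic s0 d h \<longleftrightarrow>
     (\<forall>A \<in> sets (cover_measure s0 d h). flow_invariant s0 d h A \<longrightarrow>
        A \<in> null_sets (cover_measure s0 d h) \<or>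
        space (cover_measure s0 d h) - A \<in> null_sets (cover_measure s0 d h))"

end

theory Submission
  imports Defs
begin

text \<open>
  A horizontal trajectory meets the vertical edges in the orbit of the dyadic odometer on its height
  \<open>y\<close>, so the flow on a cover is a skew product over the odometer whose cocycle is read off from
  \<open>h (\<gamma>\<^sub>k)\<close>, \<open>k > 0\<close>.  Put \<open>g\<^sub>n = h (\<phi>\<^sub>\<beta>\<^sup>-\<^sup>n \<gamma>\<^sub>1)\<close>.  The formulas for \<open>\<phi>\<^sub>\<beta>\<^sup>-\<^sup>1\<close> give
  \<open>g\<^sub>n = a\<^sub>n h (\<gamma>\<^sub>n\<^sub>+\<^sub>1)\<close> with \<open>a\<^sub>n = g\<^sub>n\<^sub>-\<^sub>1 \<cdots> g\<^sub>0\<close>, so that the product of the \<open>g\<^sub>i\<close> over the nonzero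
  binary digits of \<open>y\<close> transports the sheets back to the base of the odometer tower.

  Under the hypothesis of (a), compactness yields \<open>g\<^sub>n \<in> H\<close> for \<open>n \<ge> N\<close>; hence the points which the first
  \<open>N\<close> digits transport into a fixed \<open>H\<close>-orbit of sheets form an invariant set of intermediate measure.

  For (b), the \<open>\<gamma>\<^sub>n\<close> are free generators, so \<open>(g\<^sub>n)\<close> and the values \<open>h (\<gamma>\<^sub>-\<^sub>m)\<close>, \<open>m \<ge> 0\<close>, may be chosen
  arbitrarily. After finitely many prescribed values, let \<open>g\<^sub>n\<close> run cyclically through \<open>H\<close> and let the
  \<open>h (\<gamma>\<^sub>-\<^sub>m)\<close> exhaust \<open>G\<close>.  Homomorphisms are constructed as holonomies of locally multiplicative
  functions on the surface.
\<close>

section \<open>Homotopy classes of paths\<close>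

text \<open>Freeness of \<Gamma> enters only through the two halves of its universal property: the
  \<open>\<gamma>\<^sub>n\<close> generate, and homomorphisms with arbitrary values on them exist.
  For the second half no normal form of words is needed: a labelling of the edges is spread out to a
  cocycle that is trivial away from them. The difficulty is that an edge point has two planar
  representatives and that the square, lacking the discarded points, is not convex. Paths are
  therefore cut into pieces in convex planar regions, where loops are trivial; every generator
  arises from switching the representative at an edge. In (a) finitely many digits suffice because
  later digits act by elements of \<open>H\<close>, which preserve its orbits. In (b) the cycle has
  bounded length: an accumulation point tests finitely many elements of \<Gamma> at a time, and
  these must already exhibit all of \<open>H\<close>, up to a conjugation that varies with
  \<open>n\<close>. Finiteness of the symmetric group makes one conjugator serve all finite
  tests.\<close>

lemma homotopic_paths_compose_path:
  fixes p :: "real \<Rightarrow> 'a::topological_space"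
  assumes "path p" "path f" "path g" "path_image f \<subseteq> {0..1}" "path_image g \<subseteq> {0..1}"
    "pathstart f = pathstart g" "pathfinish f = pathfinish g"
  shows "homotopic_paths UNIV (p \<circ> f) (p \<circ> g)"
proof (rule homotopic_paths_continuous_image)
  have "closed_segment (f t) (g t) \<subseteq> {0..1}" if "t \<in> {0..1}" for t
  proof (rule closed_segment_subset)
    show "f t \<in> {0..1}" "g t \<in> {0..1}"
      using assms(4,5) that unfolding path_image_def by blast+
  qed simp
  then show "homotopic_paths {0..1} f g"
    using assms by (intro homotopic_paths_linear) auto
  show "continuous_on {0..1} p"
    using assms(1) by (simp add: path_def)
qed auto

text \<open>The side condition matters: the class of a discontinuous map is empty, so two such maps
  have equal classes without being homotopic.\<close>

lemma path_class_eq_iff: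
  assumes "path p"
  shows "path_class p = path_class q \<longleftrightarrow> homotopic_paths UNIV p q"
proof
  assume "path_class p = path_class q"
  with assms have "p \<in> path_class q"
    by (metis CollectI homotopic_paths_refl path_class_def subset_UNIV)
  then show "homotopic_paths UNIV p q"
    by (simp add: path_class_def homotopic_paths_sym)
next
  assume pq: "homotopic_paths UNIV p q"
  have "homotopic_paths UNIV p r \<longleftrightarrow> homotopic_paths UNIV q r" for r
    using homotopic_paths_trans[OF pq] homotopic_paths_trans[OF homotopic_paths_sym[OF pq]] by blast
  then show "path_class p = path_class q"
    by (simp add: path_class_def)
qed

lemma path_class_eqI: "homotopic_paths UNIV p q \<Longrightarrow> path_class p = path_class q"
  by (simp add: path_class_eq_iff homotopic_paths_imp_path)

lemma path_class_cong:
  assumes "path p" "\<And>t. t \<in> {0..1} \<Longrightarrow> p t = q t"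
  shows "path_class p = path_class q"
  by (rule path_class_eqI, rule homotopic_paths_eq) (use assms in auto)

lemma path_class_join_cong:
  assumes "path_class p = path_class p'" "path_class q = path_class q'"
    "path p" "path q" "pathfinish p = pathstart q"
  shows "path_class (p +++ q) = path_class (p' +++ q')"
proof (rule path_class_eqI, rule homotopic_paths_join)
  show "homotopic_paths UNIV p p'" "homotopic_paths UNIV q q'"
    by (rule path_class_eq_iff[THEN iffD1]; fact)+
qed fact

lemma path_class_assoc:
  assumes "path p" "path q" "path r" "pathfinish p = pathstart q" "pathfinish q = pathstart r"
  shows "path_class ((p +++ q) +++ r) = path_class (p +++ (q +++ r))"
  using assms by (metis homotopic_paths_assoc path_class_eqI subset_UNIV)

lemma path_constant: "path (\<lambda>_. a)"
  by (simp add: path_def)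

lemma pathstart_const: "pathstart (\<lambda>_. a) = a" and pathfinish_const: "pathfinish (\<lambda>_. a) = a"
  by (simp_all add: pathstart_def pathfinish_def)

text \<open>The group laws are changes of parameter: each concatenation is \<open>p\<close> after a
  broken line in \<open>{0..1}\<close>. Broken lines with the same ends are homotopic by convexity
  of the interval, whatever the target space of \<open>p\<close>.\<close>

lemma join_const_eq_compose:
  fixes p :: "real \<Rightarrow> 'a::topological_space"
  shows "p +++ (\<lambda>_. pathfinish p) = p \<circ> (linepath 0 1 +++ linepath 1 1)"
    and "(\<lambda>_. pathstart p) +++ p = p \<circ> (linepath 0 0 +++ linepath 0 1)"
    and "reversepath p +++ p = p \<circ> (linepath 1 0 +++ linepath 0 1)"
  by (auto simp: fun_eq_iff joinpaths_def linepath_def pathfinish_def pathstart_def reversepath_def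
      intro!: arg_cong[of _ _ p])

lemma path_class_rid:
  assumes "path p" "pathfinish p = a"
  shows "path_class (p +++ (\<lambda>_. a)) = path_class p"
proof -
  have "homotopic_paths UNIV (p \<circ> (linepath 0 1 +++ linepath 1 1)) (p \<circ> linepath 0 1)"
    using assms by (intro homotopic_paths_compose_path) (auto simp: path_image_join closed_segment_eq_real_ivl)
  moreover have "p \<circ> linepath 0 1 = p"
    by (auto simp: fun_eq_iff linepath_def)
  ultimately show ?thesis
    using assms join_const_eq_compose(1)[of p] by (metis path_class_eqI)
qed

lemma path_class_lid:
  assumes "path p" "pathstart p = a"
  shows "path_class ((\<lambda>_. a) +++ p) = path_class p"
proof -
  have "homotopic_paths UNIV (p \<circ> (linepath 0 0 +++ linepath 0 1)) (p \<circ> linepath 0 1)"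
    using assms by (intro homotopic_paths_compose_path) (auto simp: path_image_join closed_segment_eq_real_ivl)
  moreover have "p \<circ> linepath 0 1 = p"
    by (auto simp: fun_eq_iff linepath_def)
  ultimately show ?thesis
    using assms join_const_eq_compose(2)[of p] by (metis path_class_eqI)
qed

lemma path_class_linv:
  assumes "path p" "pathfinish p = a"
  shows "path_class (reversepath p +++ p) = path_class (\<lambda>_. a)"
proof -
  have "homotopic_paths UNIV (p \<circ> (linepath 1 0 +++ linepath 0 1)) (p \<circ> linepath 1 1)"
    using assms by (intro homotopic_paths_compose_path) (auto simp: path_image_join closed_segment_eq_real_ivl)
  moreover have "p \<circ> linepath 1 1 = (\<lambda>_. a)"
    using assms by (auto simp: fun_eq_iff linepath_def pathfinish_def)
  ultimately show ?thesis
    using assms join_const_eq_compose(3)[of p] by (metis path_class_eqI)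
qed

lemma path_class_subpath_join:
  fixes p :: "real \<Rightarrow> 'a::topological_space"
  assumes "path p" "a \<in> {0..1}" "b \<in> {0..1}" "c \<in> {0..1}"
  shows "path_class ((p \<circ> linepath a b) +++ (p \<circ> linepath b c)) = path_class (p \<circ> linepath a c)"
proof -
  have "(p \<circ> linepath a b) +++ (p \<circ> linepath b c) = p \<circ> (linepath a b +++ linepath b c)"
    by (auto simp: fun_eq_iff joinpaths_def)
  moreover have "homotopic_paths UNIV (p \<circ> (linepath a b +++ linepath b c)) (p \<circ> linepath a c)"
  proof (intro homotopic_paths_compose_path)
    have "closed_segment u v \<subseteq> {0..1}" if "u \<in> {0..1}" "v \<in> {0..1}" for u v :: real
      using that by (intro closed_segment_subset) auto
    then show "path_image (linepath a b +++ linepath b c) \<subseteq> {0..1}" "path_image (linepath a c) \<subseteq> {0..1}"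
      using assms by (auto simp: path_image_join closed_segment_eq_real_ivl)
  qed (use assms in auto)
  ultimately show ?thesis
    by (metis path_class_eqI)
qed

lemma path_subpath_compose:
  fixes p :: "real \<Rightarrow> 'a::topological_space"
  assumes "path p" "a \<in> {0..1}" "b \<in> {0..1}"
  shows "path (p \<circ> linepath a b)"
proof -
  have "closed_segment a b \<subseteq> {0..1}"
    using assms by (intro closed_segment_subset) auto
  then have "continuous_on (path_image (linepath a b)) p"
    using assms(1) by (auto simp: path_def intro: continuous_on_subset)
  then show ?thesis
    by (intro path_continuous_image) auto
qed

text \<open>The product ranges over all pairs of representatives; compatibility of concatenation
  with homotopy collapses it to a single class.\<close>

lemma mult_path_class:
  assumes "path p" "path q" "pathfinish p = pathstart q"
  shows "path_class p \<otimes>\<^bsub>fundamental_group a\<^esub> path_class q = path_class (p +++ q)"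
proof -
  have "(\<exists>p'\<in>path_class p. \<exists>q'\<in>path_class q. homotopic_paths UNIV (p' +++ q') r)
      \<longleftrightarrow> homotopic_paths UNIV (p +++ q) r" for r
  proof
    assume "\<exists>p'\<in>path_class p. \<exists>q'\<in>path_class q. homotopic_paths UNIV (p' +++ q') r"
    then obtain p' q' where "homotopic_paths UNIV p p'" "homotopic_paths UNIV q q'"
      and r: "homotopic_paths UNIV (p' +++ q') r"
      by (auto simp: path_class_def)
    then have "homotopic_paths UNIV (p +++ q) (p' +++ q')"
      using assms by (intro homotopic_paths_join)
    then show "homotopic_paths UNIV (p +++ q) r"
      using r by (rule homotopic_paths_trans)
  next
    assume "homotopic_paths UNIV (p +++ q) r"
    then show "\<exists>p'\<in>path_class p. \<exists>q'\<in>path_class q. homotopic_paths UNIV (p' +++ q') r"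
      using assms by (intro bexI[of _ p] bexI[of _ q]) (simp_all add: path_class_def)
  qed
  then show ?thesis
    by (simp add: fundamental_group_def path_class_def)
qed

lemma path_class_in_fundamental_group:
  assumes "path p" "pathstart p = a" "pathfinish p = a"
  shows "path_class p \<in> carrier (fundamental_group a)"
  using assms by (auto simp: fundamental_group_def)

lemma fundamental_groupE:
  assumes "A \<in> carrier (fundamental_group a)"
  obtains p where "path p" "pathstart p = a" "pathfinish p = a" "A = path_class p"
  using assms by (auto simp: fundamental_group_def)

lemma one_fundamental_group: "\<one>\<^bsub>fundamental_group a\<^esub> = path_class (\<lambda>_. a)"
  by (simp add: fundamental_group_def)

lemma group_fundamental_group: "group (fundamental_group a)"
proof (rule groupI)
  let ?G = "fundamental_group a"
  show "\<one>\<^bsub>?G\<^esub> \<in> carrier ?G"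
    unfolding one_fundamental_group
    by (intro path_class_in_fundamental_group path_constant pathstart_const pathfinish_const)
  fix A assume "A \<in> carrier ?G"
  then obtain p where p: "path p" "pathstart p = a" "pathfinish p = a" "A = path_class p"
    by (rule fundamental_groupE)
  show "\<one>\<^bsub>?G\<^esub> \<otimes>\<^bsub>?G\<^esub> A = A"
    using p by (simp add: one_fundamental_group mult_path_class path_constant pathfinish_const path_class_lid)
  show "\<exists>B\<in>carrier ?G. B \<otimes>\<^bsub>?G\<^esub> A = \<one>\<^bsub>?G\<^esub>"
    using p path_class_in_fundamental_group[of "reversepath p" a]
    by (intro bexI[of _ "path_class (reversepath p)"])
      (simp_all add: mult_path_class path_class_linv one_fundamental_group)
  fix B assume "B \<in> carrier ?G"
  then obtain q where q: "path q" "pathstart q = a" "pathfinish q = a" "B = path_class q"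
    by (rule fundamental_groupE)
  show "A \<otimes>\<^bsub>?G\<^esub> B \<in> carrier ?G"
    using p q by (simp add: mult_path_class path_class_in_fundamental_group)
  fix C assume "C \<in> carrier ?G"
  then obtain r where r: "path r" "pathstart r = a" "pathfinish r = a" "C = path_class r"
    by (rule fundamental_groupE)
  show "A \<otimes>\<^bsub>?G\<^esub> B \<otimes>\<^bsub>?G\<^esub> C = A \<otimes>\<^bsub>?G\<^esub> (B \<otimes>\<^bsub>?G\<^esub> C)"
    using p q r by (simp add: mult_path_class path_class_assoc)
qed

lemma inv_path_class:
  assumes "path p" "pathstart p = a" "pathfinish p = a"
  shows "inv\<^bsub>fundamental_group a\<^esub> (path_class p) = path_class (reversepath p)"
  using assms path_class_in_fundamental_group[of "reversepath p" a]
  by (intro group.inv_equality group_fundamental_group)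
    (simp_all add: mult_path_class path_class_linv one_fundamental_group path_class_in_fundamental_group)

section \<open>Loops obtained by tethering open paths to the base point\<close>

definition tethered where "tethered a p b = path_class (a +++ (p +++ reversepath b))"

text \<open>The return along \<open>b\<close> that ends the first loop cancels the departure along
  \<open>b\<close> that starts the second. Open paths thus multiply like loops once each division
  point has a fixed tether.\<close>

lemma tethered_mult:
  assumes "path a" "path b" "path c" "path p" "path q"
    "pathfinish a = pathstart p" "pathfinish p = pathfinish b" "pathfinish b = pathstart q"
    "pathfinish q = pathfinish c" "pathstart b = pathstart c"
  shows "tethered a p b \<otimes>\<^bsub>fundamental_group s\<^esub> tethered b q c = tethered a (p +++ q) c"
proof -
  have c: "path_class (reversepath b +++ (b +++ (q +++ reversepath c))) = path_class (q +++ reversepath c)"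
  proof -
    have "path_class (reversepath b +++ (b +++ (q +++ reversepath c)))
       = path_class ((reversepath b +++ b) +++ (q +++ reversepath c))"
      using assms by (simp add: path_class_assoc)
    also have "\<dots> = path_class ((\<lambda>_. pathfinish b) +++ (q +++ reversepath c))"
      by (rule path_class_join_cong[OF path_class_linv refl]) (use assms in auto)
    also have "\<dots> = path_class (q +++ reversepath c)"
      using assms by (intro path_class_lid) auto
    finally show ?thesis .
  qed
  have "tethered a p b \<otimes>\<^bsub>fundamental_group s\<^esub> tethered b q c
      = path_class ((a +++ (p +++ reversepath b)) +++ (b +++ (q +++ reversepath c)))"
    unfolding tethered_def using assms by (intro mult_path_class) auto
  also have "\<dots> = path_class (a +++ ((p +++ reversepath b) +++ (b +++ (q +++ reversepath c))))"
    using assms by (intro path_class_assoc) auto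
  also have "\<dots> = path_class (a +++ (p +++ (q +++ reversepath c)))"
  proof (rule path_class_join_cong[OF refl])
    have "path_class ((p +++ reversepath b) +++ (b +++ (q +++ reversepath c)))
       = path_class (p +++ (reversepath b +++ (b +++ (q +++ reversepath c))))"
      using assms by (intro path_class_assoc) auto
    also have "\<dots> = path_class (p +++ (q +++ reversepath c))"
      by (rule path_class_join_cong[OF refl c]) (use assms in auto)
    finally show "path_class ((p +++ reversepath b) +++ (b +++ (q +++ reversepath c)))
       = path_class (p +++ (q +++ reversepath c))" .
  qed (use assms in auto)
  also have "\<dots> = tethered a (p +++ q) c"
    unfolding tethered_def using assms
    by (intro path_class_join_cong[OF refl path_class_assoc[symmetric]]) auto
  finally show ?thesis .
qed

lemma tethered_cong:
  assumes "path_class p = path_class q" "path a" "path b" "path p"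
    "pathfinish a = pathstart p" "pathfinish p = pathfinish b"
  shows "tethered a p b = tethered a q b"
  unfolding tethered_def
  by (rule path_class_join_cong[OF refl path_class_join_cong[OF assms(1) refl]]) (use assms in auto)

lemma tethered_reverse:
  assumes "path a" "path b" "path p" "pathstart a = s" "pathstart b = s"
    "pathfinish a = pathstart p" "pathfinish p = pathfinish b"
  shows "tethered b (reversepath p) a = inv\<^bsub>fundamental_group s\<^esub> (tethered a p b)"
proof -
  have "inv\<^bsub>fundamental_group s\<^esub> (tethered a p b) = path_class ((b +++ reversepath p) +++ reversepath a)"
    unfolding tethered_def using assms
    by (subst inv_path_class) (auto simp: reversepath_joinpaths)
  also have "\<dots> = tethered b (reversepath p) a"
    unfolding tethered_def using assms by (intro path_class_assoc) auto
  finally show ?thesis ..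
qed

section \<open>Holonomy of locally multiplicative functions\<close>

context group
begin

lemma cancel_inv_left: "x \<in> carrier G \<Longrightarrow> y \<in> carrier G \<Longrightarrow> inv x \<otimes> (x \<otimes> y) = y"
  by (simp flip: m_assoc)

lemma cancel_inv_right: "x \<in> carrier G \<Longrightarrow> y \<in> carrier G \<Longrightarrow> x \<otimes> (inv x \<otimes> y) = y"
  by (simp flip: m_assoc)

end

text \<open>Transition data of a flat bundle. Multiplicativity is required only inside a single
  member of the cover; its failure around loops that leave every member is what the holonomy
  records.\<close>

locale local_cocycle = group Gr for Gr :: "'g monoid" (structure) +
  fixes \<U> :: "'a::topological_space set set" and c :: "'a \<Rightarrow> 'a \<Rightarrow> 'g"
  assumes open_cover: "\<And>M. M \<in> \<U> \<Longrightarrow> open M" and covers: "\<Union>\<U> = UNIV"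
    and c_closed [simp]: "\<And>x y. c x y \<in> carrier Gr"
    and c_mult: "\<And>M x y z. M \<in> \<U> \<Longrightarrow> x \<in> M \<Longrightarrow> y \<in> M \<Longrightarrow> z \<in> M \<Longrightarrow> c x y \<otimes> c y z = c x z"
begin

lemma coverE:
  obtains M where "M \<in> \<U>" "x \<in> M"
  using covers by (metis UNIV_I UnionE)

lemma c_refl [simp]: "c x x = \<one>"
proof -
  obtain M where M: "M \<in> \<U>" "x \<in> M"
    by (rule coverE)
  have "c x x \<otimes> c x x = c x x"
    using M by (intro c_mult[of M])
  then show ?thesis
    using l_cancel_one[of "c x x" "c x x"] by simp
qed

text \<open>A parallel section along \<open>F\<close>, whose values at nearby parameters are
  compared through \<open>c\<close>. The arbitrary domain \<open>K\<close> lets one notion serve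
  both paths and homotopies.\<close>

definition develops :: "'b::topological_space set \<Rightarrow> ('b \<Rightarrow> 'a) \<Rightarrow> ('b \<Rightarrow> 'g) \<Rightarrow> bool" where
  "develops K F \<theta> \<longleftrightarrow> \<theta> \<in> K \<rightarrow> carrier Gr \<and>
     (\<forall>a\<in>K. \<exists>N. open N \<and> a \<in> N \<and> (\<forall>b\<in>N \<inter> K. \<theta> b = \<theta> a \<otimes> c (F a) (F b)))"

lemma developsE:
  assumes "develops K F \<theta>" "a \<in> K"
  obtains N where "open N" "a \<in> N" "\<And>b. b \<in> N \<Longrightarrow> b \<in> K \<Longrightarrow> \<theta> b = \<theta> a \<otimes> c (F a) (F b)"
proof -
  obtain N where "open N \<and> a \<in> N \<and> (\<forall>b\<in>N \<inter> K. \<theta> b = \<theta> a \<otimes> c (F a) (F b))"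
    using assms unfolding develops_def by meson
  then show ?thesis
    by (intro that[of N]) auto
qed

lemma develops_closed: "develops K F \<theta> \<Longrightarrow> a \<in> K \<Longrightarrow> \<theta> a \<in> carrier Gr"
  by (auto simp: develops_def)

text \<open>Near each point both developments change by the same right factor, so
  \<open>\<theta>' x \<otimes> inv (\<theta> x)\<close> is locally constant.\<close>

lemma develops_unique:
  assumes "develops K F \<theta>" "develops K F \<theta>'" "connected K" "a \<in> K" "b \<in> K"
  shows "\<theta>' a \<otimes> inv (\<theta> a) = \<theta>' b \<otimes> inv (\<theta> b)"
proof -
  have "(\<lambda>x. \<theta>' x \<otimes> inv (\<theta> x)) constant_on K"
  proof (rule locally_constant_imp_constant[OF assms(3)])
    fix a assume a: "a \<in> K"
    obtain N where N: "open N" "a \<in> N" "\<And>b. b \<in> N \<Longrightarrow> b \<in> K \<Longrightarrow> \<theta> b = \<theta> a \<otimes> c (F a) (F b)"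
      by (rule developsE[OF assms(1) a]) blast
    obtain N' where N': "open N'" "a \<in> N'" "\<And>b. b \<in> N' \<Longrightarrow> b \<in> K \<Longrightarrow> \<theta>' b = \<theta>' a \<otimes> c (F a) (F b)"
      by (rule developsE[OF assms(2) a]) blast
    have const: "\<theta>' x \<otimes> inv (\<theta> x) = \<theta>' a \<otimes> inv (\<theta> a)" if "x \<in> K \<inter> (N \<inter> N')" for x
    proof -
      have [simp]: "\<theta> a \<in> carrier Gr" "\<theta>' a \<in> carrier Gr"
        using assms a by (auto simp: develops_closed)
      have "\<theta>' x \<otimes> inv (\<theta> x) = \<theta>' a \<otimes> c (F a) (F x) \<otimes> (inv (c (F a) (F x)) \<otimes> inv (\<theta> a))"
        using that N(3)[of x] N'(3)[of x] by (simp add: inv_mult_group)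
      also have "\<dots> = \<theta>' a \<otimes> inv (\<theta> a)"
        by (simp add: m_assoc cancel_inv_right)
      finally show ?thesis .
    qed
    have "openin (top_of_set K) (K \<inter> (N \<inter> N'))" "a \<in> K \<inter> (N \<inter> N')"
      using N(1,2) N'(1,2) a by auto
    then show "\<exists>T. openin (top_of_set K) T \<and> a \<in> T \<and>
        (\<forall>x\<in>T. \<theta>' x \<otimes> inv (\<theta> x) = \<theta>' a \<otimes> inv (\<theta> a))"
      using const by (intro exI[of _ "K \<inter> (N \<inter> N')"] conjI ballI)
  qed
  then show ?thesis
    using assms unfolding constant_on_def by metis
qed

lemma develops_left_mult:
  assumes "develops K F \<theta>" "g \<in> carrier Gr"
  shows "develops K F (\<lambda>a. g \<otimes> \<theta> a)"
  unfolding develops_def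
proof (intro conjI ballI)
  show "(\<lambda>a. g \<otimes> \<theta> a) \<in> K \<rightarrow> carrier Gr"
    using assms by (auto simp: develops_closed)
  fix a assume a: "a \<in> K"
  obtain N where N: "open N" "a \<in> N" "\<And>b. b \<in> N \<Longrightarrow> b \<in> K \<Longrightarrow> \<theta> b = \<theta> a \<otimes> c (F a) (F b)"
    by (rule developsE[OF assms(1) a]) blast
  have "g \<otimes> \<theta> b = g \<otimes> \<theta> a \<otimes> c (F a) (F b)" if "b \<in> N \<inter> K" for b
    using that N(3)[of b] assms a by (simp add: develops_closed m_assoc)
  with N(1,2) show "\<exists>N. open N \<and> a \<in> N \<and> (\<forall>b\<in>N \<inter> K. g \<otimes> \<theta> b = g \<otimes> \<theta> a \<otimes> c (F a) (F b))"
    by blast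
qed

lemma develops_pullback:
  assumes "develops K F \<theta>" "continuous_on K' q" "q ` K' \<subseteq> K" "\<And>x. x \<in> K' \<Longrightarrow> F' x = F (q x)"
  shows "develops K' F' (\<lambda>x. \<theta> (q x))"
  unfolding develops_def
proof (intro conjI ballI)
  show "(\<lambda>x. \<theta> (q x)) \<in> K' \<rightarrow> carrier Gr"
    using assms by (auto simp: develops_closed)
  fix a assume a: "a \<in> K'"
  then have "q a \<in> K"
    using assms by blast
  then obtain N where N: "open N" "q a \<in> N"
      "\<And>b. b \<in> N \<Longrightarrow> b \<in> K \<Longrightarrow> \<theta> b = \<theta> (q a) \<otimes> c (F (q a)) (F b)"
    by (rule developsE[OF assms(1)]) blast
  obtain A where A: "open A" "A \<inter> K' = q -` N \<inter> K'"
    using assms(2) N(1) unfolding continuous_on_open_invariant by blast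
  then show "\<exists>N. open N \<and> a \<in> N \<and> (\<forall>b\<in>N \<inter> K'. \<theta> (q b) = \<theta> (q a) \<otimes> c (F' a) (F' b))"
  proof (intro exI[of _ A] conjI ballI)
    show "a \<in> A"
      using A(2) N(2) a by auto
    fix b assume b: "b \<in> A \<inter> K'"
    then have "q b \<in> N" "q b \<in> K"
      using A(2) assms(3) by auto
    then show "\<theta> (q b) = \<theta> (q a) \<otimes> c (F' a) (F' b)"
      using N(3)[of "q b"] a b assms(4) by simp
  qed (use A in simp)
qed

lemma develops_subset:
  assumes "develops K F \<theta>" "K' \<subseteq> K"
  shows "develops K' F \<theta>"
  using develops_pullback[OF assms(1), of K' "\<lambda>x. x" F] assms(2) by simp

lemma develops_local:
  assumes "M \<in> \<U>" "F ` K \<subseteq> M" "K \<noteq> {}"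
  shows "\<exists>\<theta>. develops K F \<theta>"
proof -
  obtain a0 where a0: "a0 \<in> K"
    using assms by blast
  have "develops K F (\<lambda>b. c (F a0) (F b))"
    unfolding develops_def
    using assms a0 by (auto intro!: exI[of _ UNIV] c_mult[symmetric])
  then show ?thesis
    by (intro exI)
qed

text \<open>By uniqueness the two developments differ on the connected overlap by one left factor;
  correcting by it makes them agree there. Closedness gives every point outside a piece a
  neighbourhood missing that piece, so the local condition concerns only the pieces that contain the
  point.\<close>

lemma develops_Un:
  assumes "develops K1 F \<theta>1" "develops K2 F \<theta>2" "closed K1" "closed K2"
    "connected (K1 \<inter> K2)" "K1 \<inter> K2 \<noteq> {}"
  shows "\<exists>\<theta>. develops (K1 \<union> K2) F \<theta>"
proof -
  obtain e where e: "e \<in> K1" "e \<in> K2"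
    using assms by blast
  define g where "g = \<theta>1 e \<otimes> inv (\<theta>2 e)"
  have g: "g \<in> carrier Gr"
    using assms e by (auto simp: g_def develops_closed)
  define \<theta>2' where "\<theta>2' a = g \<otimes> \<theta>2 a" for a
  have d2: "develops K2 F \<theta>2'"
    unfolding \<theta>2'_def using assms g by (intro develops_left_mult)
  have agree: "\<theta>1 a = \<theta>2' a" if "a \<in> K1 \<inter> K2" for a
  proof -
    have "develops (K1 \<inter> K2) F \<theta>1" "develops (K1 \<inter> K2) F \<theta>2"
      using assms(1,2) by (auto intro: develops_subset)
    then have "\<theta>1 a \<otimes> inv (\<theta>2 a) = g"
      using develops_unique[of "K1 \<inter> K2" F \<theta>2 \<theta>1 a e] assms that e by (simp add: g_def)
    moreover have "\<theta>1 a \<in> carrier Gr" "\<theta>2 a \<in> carrier Gr"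
      using that assms by (auto simp: develops_closed)
    ultimately show ?thesis
      unfolding \<theta>2'_def by (auto simp: m_assoc)
  qed
  define \<theta> where "\<theta> a = (if a \<in> K1 then \<theta>1 a else \<theta>2' a)" for a
  have t1: "\<theta> a = \<theta>1 a" if "a \<in> K1" for a using that by (simp add: \<theta>_def)
  have t2: "\<theta> a = \<theta>2' a" if "a \<in> K2" for a using that agree by (auto simp: \<theta>_def)
  have nbhd: "\<exists>N. open N \<and> a \<in> N \<and> (\<forall>b\<in>N \<inter> K. \<theta> b = \<theta> a \<otimes> c (F a) (F b))"
    if "a \<in> K1 \<union> K2" and K: "(K = K1 \<and> \<theta>' = \<theta>1) \<or> (K = K2 \<and> \<theta>' = \<theta>2')" for a K \<theta>'
  proof (cases "a \<in> K")
    case True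
    have "develops K F \<theta>'" using K assms(1) d2 by auto
    then obtain N where N: "open N" "a \<in> N" "\<And>b. b \<in> N \<Longrightarrow> b \<in> K \<Longrightarrow> \<theta>' b = \<theta>' a \<otimes> c (F a) (F b)"
      using True by (rule developsE) blast
    have "\<theta> b = \<theta>' b" if "b \<in> K" for b using K t1 t2 that by auto
    then have "\<theta> b = \<theta> a \<otimes> c (F a) (F b)" if "b \<in> N \<inter> K" for b
      using True that N(3)[of b] by (metis IntE)
    with N(1,2) show ?thesis
      by blast
  next
    case False
    moreover have "open (- K)" using K assms by auto
    ultimately show ?thesis by (intro exI[of _ "- K"]) auto
  qed
  have "develops (K1 \<union> K2) F \<theta>"
    unfolding develops_def
  proof (intro conjI ballI)
    show "\<theta> \<in> K1 \<union> K2 \<rightarrow> carrier Gr"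
      using develops_closed[OF assms(1)] develops_closed[OF d2] by (auto simp: \<theta>_def)
    fix a assume a: "a \<in> K1 \<union> K2"
    obtain N1 where N1: "open N1" "a \<in> N1" "\<forall>b\<in>N1 \<inter> K1. \<theta> b = \<theta> a \<otimes> c (F a) (F b)"
      using nbhd[OF a, of K1 \<theta>1] by auto
    obtain N2 where N2: "open N2" "a \<in> N2" "\<forall>b\<in>N2 \<inter> K2. \<theta> b = \<theta> a \<otimes> c (F a) (F b)"
      using nbhd[OF a, of K2 \<theta>2'] by auto
    show "\<exists>N. open N \<and> a \<in> N \<and> (\<forall>b\<in>N \<inter> (K1 \<union> K2). \<theta> b = \<theta> a \<otimes> c (F a) (F b))"
      using N1 N2 by (intro exI[of _ "N1 \<inter> N2"]) auto
  qed
  then show ?thesis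
    by (intro exI)
qed

text \<open>Two applications of bisection, first along a horizontal slice and then across the slices.\<close>

lemma develops_unit_square:
  fixes F :: "real \<times> real \<Rightarrow> 'a"
  assumes F: "continuous_on ({0..1} \<times> {0..1}) F"
  shows "\<exists>\<theta>. develops ({0..1} \<times> {0..1}) F \<theta>"
proof -
  have local: "\<exists>e>0. \<forall>a b u v. a \<le> s \<and> s \<le> b \<and> b - a < e \<and> 0 \<le> a \<and> b \<le> 1 \<and>
      u \<le> t \<and> t \<le> v \<and> v - u < e \<and> 0 \<le> u \<and> v \<le> 1 \<longrightarrow> (\<exists>\<theta>. develops ({a..b} \<times> {u..v}) F \<theta>)"
    if st: "0 \<le> s" "s \<le> 1" "0 \<le> t" "t \<le> 1" for s t
  proof -
    obtain M where M: "M \<in> \<U>" "F (s, t) \<in> M"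
      by (rule coverE)
    obtain A where A: "open A" "A \<inter> ({0..1} \<times> {0..1}) = F -` M \<inter> ({0..1} \<times> {0..1})"
      using F open_cover[OF M(1)] unfolding continuous_on_open_invariant by blast
    have "(s, t) \<in> A"
      using A M st by auto
    then obtain A1 A2 where A12: "open A1" "open A2" "s \<in> A1" "t \<in> A2" "A1 \<times> A2 \<subseteq> A"
      using A(1) by (metis mem_Sigma_iff open_prod_elim)
    obtain e1 where e1: "e1 > 0" "ball s e1 \<subseteq> A1"
      using A12 open_contains_ball by blast
    obtain e2 where e2: "e2 > 0" "ball t e2 \<subseteq> A2"
      using A12 open_contains_ball by blast
    show ?thesis
    proof (intro exI[of _ "min e1 e2"] conjI allI impI)
      fix a b u v
      assume H: "a \<le> s \<and> s \<le> b \<and> b - a < min e1 e2 \<and> 0 \<le> a \<and> b \<le> 1 \<and>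
        u \<le> t \<and> t \<le> v \<and> v - u < min e1 e2 \<and> 0 \<le> u \<and> v \<le> 1"
      have "{a..b} \<subseteq> ball s e1" "{u..v} \<subseteq> ball t e2"
        using H by (auto simp: dist_real_def)
      then have "{a..b} \<times> {u..v} \<subseteq> A"
        using e1 e2 A12 by blast
      moreover have "{a..b} \<times> {u..v} \<subseteq> {0..1} \<times> {0..1}"
        using H by auto
      ultimately have "{a..b} \<times> {u..v} \<subseteq> F -` M"
        using A(2) by blast
      then have "F ` ({a..b} \<times> {u..v}) \<subseteq> M"
        by blast
      moreover have "(s, t) \<in> {a..b} \<times> {u..v}"
        using H by auto
      ultimately show "\<exists>\<theta>. develops ({a..b} \<times> {u..v}) F \<theta>"
        using M develops_local[of M F "{a..b} \<times> {u..v}"] by blast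
    qed (use e1 e2 in auto)
  qed
  have glue: "\<exists>\<theta>. develops K F \<theta>"
    if "\<exists>\<theta>. develops K1 F \<theta>" "\<exists>\<theta>. develops K2 F \<theta>" "K = K1 \<union> K2" "compact K1" "compact K2"
      "convex (K1 \<inter> K2)" "K1 \<inter> K2 \<noteq> {}" for K K1 K2
    using that develops_Un[of K1 F _ K2] by (auto simp: compact_imp_closed convex_connected)
  \<comment> \<open>The height \<open>t\<close> stays fixed and the thickness \<open>e\<close> of
    the strip may depend on the interval: joining two intervals takes the minimum of the
    thicknesses, and the strips overlap in a vertical segment, which is connected.\<close>
  define P where "P t a b \<longleftrightarrow> (0 \<le> a \<longrightarrow> b \<le> 1 \<longrightarrow> a \<le> b \<longrightarrow> (\<exists>e>0. \<forall>u v. u \<le> t \<and> t \<le> v \<and> v - u < e \<and> 0 \<le> u \<and> v \<le> 1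
      \<longrightarrow> (\<exists>\<theta>. develops ({a..b} \<times> {u..v}) F \<theta>)))" for t a b
  have slice: "P t 0 1" if t: "0 \<le> t" "t \<le> 1" for t
  proof (rule Bolzano)
    fix a b c assume H: "P t a b" "P t b c" "a \<le> b" "b \<le> c"
    show "P t a c"
      unfolding P_def
    proof (intro impI)
      assume "0 \<le> a" "c \<le> 1" "a \<le> c"
      then obtain e1 where e1: "e1 > 0"
        "\<And>u v. u \<le> t \<and> t \<le> v \<and> v - u < e1 \<and> 0 \<le> u \<and> v \<le> 1 \<longrightarrow> (\<exists>\<theta>. develops ({a..b} \<times> {u..v}) F \<theta>)"
        using H unfolding P_def by (meson order_trans)
      obtain e2 where e2: "e2 > 0"
        "\<And>u v. u \<le> t \<and> t \<le> v \<and> v - u < e2 \<and> 0 \<le> u \<and> v \<le> 1 \<longrightarrow> (\<exists>\<theta>. develops ({b..c} \<times> {u..v}) F \<theta>)"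
        using H \<open>0 \<le> a\<close> \<open>c \<le> 1\<close> unfolding P_def by (meson order_trans)
      show "\<exists>e>0. \<forall>u v. u \<le> t \<and> t \<le> v \<and> v - u < e \<and> 0 \<le> u \<and> v \<le> 1
          \<longrightarrow> (\<exists>\<theta>. develops ({a..c} \<times> {u..v}) F \<theta>)"
      proof (intro exI[of _ "min e1 e2"] conjI allI impI)
        fix u v assume uv: "u \<le> t \<and> t \<le> v \<and> v - u < min e1 e2 \<and> 0 \<le> u \<and> v \<le> 1"
        show "\<exists>\<theta>. develops ({a..c} \<times> {u..v}) F \<theta>"
        proof (rule glue)
          show "\<exists>\<theta>. develops ({a..b} \<times> {u..v}) F \<theta>" "\<exists>\<theta>. develops ({b..c} \<times> {u..v}) F \<theta>"
            using uv e1 e2 by auto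
          have eq: "({a..b} \<times> {u..v}) \<inter> ({b..c} \<times> {u..v}) = {b} \<times> {u..v}"
            using H by auto
          show "convex (({a..b} \<times> {u..v}) \<inter> ({b..c} \<times> {u..v}))"
            unfolding eq by (intro convex_Times) simp_all
          show "({a..b} \<times> {u..v}) \<inter> ({b..c} \<times> {u..v}) \<noteq> {}"
            unfolding eq using uv by simp
        qed (use H in \<open>auto intro: compact_Times\<close>)
      qed (use e1 e2 in auto)
    qed
  next
    fix s :: real assume "0 \<le> s" "s \<le> 1"
    then show "\<exists>d>0. \<forall>a b. a \<le> s \<and> s \<le> b \<and> b - a < d \<longrightarrow> P t a b"
      unfolding P_def using local[of s t] t by blast
  qed simp
  define Q where "Q u v \<longleftrightarrow> (0 \<le> u \<longrightarrow> v \<le> 1 \<longrightarrow> u \<le> v \<longrightarrow> (\<exists>\<theta>. develops ({0..1} \<times> {u..v}) F \<theta>))" for u v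
  have "Q 0 1"
  proof (rule Bolzano)
    fix u v w assume H: "Q u v" "Q v w" "u \<le> v" "v \<le> w"
    show "Q u w"
      unfolding Q_def
    proof (intro impI)
      assume "0 \<le> u" "w \<le> 1" "u \<le> w"
      show "\<exists>\<theta>. develops ({0..1} \<times> {u..w}) F \<theta>"
      proof (rule glue)
        show "\<exists>\<theta>. develops ({0..1} \<times> {u..v}) F \<theta>" "\<exists>\<theta>. develops ({0..1} \<times> {v..w}) F \<theta>"
          using H \<open>0 \<le> u\<close> \<open>w \<le> 1\<close> by (auto simp: Q_def)
        have eq: "({0..1::real} \<times> {u..v}) \<inter> ({0..1} \<times> {v..w}) = {0..1} \<times> {v}"
          using H by auto
        show "convex (({0..1::real} \<times> {u..v}) \<inter> ({0..1} \<times> {v..w}))"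
          unfolding eq by (intro convex_Times) simp_all
        show "({0..1::real} \<times> {u..v}) \<inter> ({0..1} \<times> {v..w}) \<noteq> {}"
          unfolding eq by simp
      qed (use H in \<open>auto intro: compact_Times\<close>)
    qed
  next
    fix t :: real assume "0 \<le> t" "t \<le> 1"
    then show "\<exists>d>0. \<forall>u v. u \<le> t \<and> t \<le> v \<and> v - u < d \<longrightarrow> Q u v"
      using slice[of t] unfolding P_def Q_def by auto
  qed simp
  then show ?thesis
    by (simp add: Q_def)
qed

lemma develops_path:
  assumes "path p"
  shows "\<exists>\<theta>. develops {0..1} p \<theta>"
proof -
  have "continuous_on ({0..1::real} \<times> {0..1}) (p \<circ> snd)"
    using assms unfolding path_def
    by (intro continuous_on_compose continuous_on_snd continuous_on_id)
      (auto intro: continuous_on_subset)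
  from develops_unit_square[OF this] obtain \<theta>
    where "develops ({0..1::real} \<times> {0..1}) (p \<circ> snd) \<theta>" ..
  then have "develops {0..1} p (\<lambda>t. \<theta> (0, t))"
    by (rule develops_pullback) (auto intro!: continuous_intros)
  then show ?thesis
    by (intro exI)
qed

section \<open>Holonomy of paths and its homotopy invariance\<close>

definition holonomy :: "(real \<Rightarrow> 'a) \<Rightarrow> 'g" where
  "holonomy p = (let \<theta> = (SOME \<theta>. develops {0..1} p \<theta>) in inv (\<theta> 0) \<otimes> \<theta> 1)"

text \<open>Two developments along a path differ by a constant left factor, which cancels in
  \<open>inv (\<theta> 0) \<otimes> \<theta> 1\<close>; the choice in the definition is therefore
  immaterial.\<close>

lemma holonomy_eq:
  assumes "develops {0..1} p \<theta>"
  shows "holonomy p = inv (\<theta> 0) \<otimes> \<theta> 1"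
proof -
  define \<theta>' where "\<theta>' = (SOME \<theta>. develops {0..1} p \<theta>)"
  have d: "develops {0..1} p \<theta>'"
    unfolding \<theta>'_def using someI[of "develops {0..1} p" \<theta>] assms by simp
  have [simp]: "\<theta> 0 \<in> carrier Gr" "\<theta> 1 \<in> carrier Gr" "\<theta>' 0 \<in> carrier Gr" "\<theta>' 1 \<in> carrier Gr"
    using assms d by (auto simp: develops_closed)
  have "\<theta>' 0 \<otimes> inv (\<theta> 0) = \<theta>' 1 \<otimes> inv (\<theta> 1)"
    using develops_unique[OF assms d] by auto
  then have "inv (\<theta>' 0) \<otimes> (\<theta>' 0 \<otimes> inv (\<theta> 0)) \<otimes> \<theta> 1 = inv (\<theta>' 0) \<otimes> (\<theta>' 1 \<otimes> inv (\<theta> 1)) \<otimes> \<theta> 1"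
    by simp
  then have "inv (\<theta> 0) \<otimes> \<theta> 1 = inv (\<theta>' 0) \<otimes> \<theta>' 1"
    by (simp add: m_assoc cancel_inv_left)
  then show ?thesis
    by (simp add: holonomy_def \<theta>'_def[symmetric] Let_def)
qed

lemma holonomy_closed:
  assumes "path p" shows "holonomy p \<in> carrier Gr"
proof -
  obtain \<theta> where "develops {0..1} p \<theta>"
    using develops_path[OF assms] ..
  then show ?thesis
    by (simp add: holonomy_eq develops_closed)
qed

lemma holonomy_join:
  assumes "path p" "path q" "pathfinish p = pathstart q"
  shows "holonomy (p +++ q) = holonomy p \<otimes> holonomy q"
proof -
  obtain \<theta> where \<theta>: "develops {0..1} (p +++ q) \<theta>"
    using develops_path[OF path_join_imp[OF assms]] ..
  have p: "develops {0..1} p (\<lambda>t. \<theta> (t / 2))"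
    by (rule develops_pullback[OF \<theta>]) (auto simp: joinpaths_def intro!: continuous_intros)
  have q: "develops {0..1} q (\<lambda>t. \<theta> ((t + 1) / 2))"
    using assms(3)
    by (intro develops_pullback[OF \<theta>])
      (auto simp: joinpaths_def pathfinish_def pathstart_def add_divide_distrib intro!: continuous_intros)
  have [simp]: "\<theta> 0 \<in> carrier Gr" "\<theta> 1 \<in> carrier Gr" "\<theta> (1/2) \<in> carrier Gr"
    using \<theta> by (auto simp: develops_closed)
  have "holonomy p \<otimes> holonomy q = inv (\<theta> 0) \<otimes> \<theta> (1/2) \<otimes> (inv (\<theta> (1/2)) \<otimes> \<theta> 1)"
    using holonomy_eq[OF p] holonomy_eq[OF q] by simp
  also have "\<dots> = inv (\<theta> 0) \<otimes> \<theta> 1"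
    by (simp add: m_assoc cancel_inv_right)
  finally show ?thesis
    using holonomy_eq[OF \<theta>] by simp
qed

text \<open>Since \<open>c x x = \<one>\<close>, the constant \<open>\<one>\<close> is also a
  development, and uniqueness compares \<open>\<theta>\<close> with it.\<close>

lemma develops_const:
  assumes "develops {0..1::real} F \<theta>" "\<And>t. t \<in> {0..1} \<Longrightarrow> F t = x"
  shows "\<theta> 0 = \<theta> 1"
proof -
  have "develops {0..1} F (\<lambda>_. \<one>)"
    unfolding develops_def using assms(2) by (auto intro!: exI[of _ UNIV])
  then have "\<one> \<otimes> inv (\<theta> 0) = \<one> \<otimes> inv (\<theta> 1)"
    using develops_unique[OF assms(1), of "\<lambda>_. \<one>" 0 1] by auto
  moreover have "\<theta> 0 \<in> carrier Gr" "\<theta> 1 \<in> carrier Gr"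
    using assms(1) by (auto simp: develops_closed)
  ultimately show ?thesis
    by (metis inv_closed inv_inv l_one)
qed

text \<open>The whole homotopy is developed over the square. Its ends are fixed, so the development
  has the same value at the two corners on each of these constant sides, and the two remaining sides
  compute the two holonomies.\<close>

lemma holonomy_homotopic:
  assumes "homotopic_paths UNIV p q"
  shows "holonomy p = holonomy q"
proof -
  obtain F where F: "continuous_on ({0..1} \<times> {0..1}) F"
      "\<forall>x\<in>{0..1}. F (0, x) = p x" "\<forall>x\<in>{0..1}. F (1, x) = q x"
      "\<forall>t\<in>{0..1::real}. pathstart (F \<circ> Pair t) = pathstart p \<and> pathfinish (F \<circ> Pair t) = pathfinish p"
    using assms unfolding homotopic_paths by auto
  obtain \<theta> where \<theta>: "develops ({0..1} \<times> {0..1}) F \<theta>"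
    using develops_unit_square[OF F(1)] ..
  have p: "develops {0..1} p (\<lambda>t. \<theta> (0, t))" and q: "develops {0..1} q (\<lambda>t. \<theta> (1, t))"
    using F by (auto intro!: develops_pullback[OF \<theta>] continuous_intros)
  have "develops {0..1} (\<lambda>t. F (t, 0)) (\<lambda>t. \<theta> (t, 0))" "develops {0..1} (\<lambda>t. F (t, 1)) (\<lambda>t. \<theta> (t, 1))"
    by (auto intro!: develops_pullback[OF \<theta>] continuous_intros)
  then have "\<theta> (0, 0) = \<theta> (1, 0)" "\<theta> (0, 1) = \<theta> (1, 1)"
    using F(4) by (auto simp: pathstart_def pathfinish_def dest!: develops_const)
  then show ?thesis
    using holonomy_eq[OF p] holonomy_eq[OF q] by simp
qed

theorem holonomy_hom:
  obtains h where "h \<in> hom (fundamental_group a) Gr"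
    "\<And>p. path p \<Longrightarrow> pathstart p = a \<Longrightarrow> pathfinish p = a \<Longrightarrow> h (path_class p) = holonomy p"
proof -
  define h where "h A = holonomy (SOME p. p \<in> A)" for A
  have h: "h (path_class p) = holonomy p" if "path p" for p
  proof -
    have "p \<in> path_class p"
      using that by (simp add: path_class_def)
    then have "(SOME q. q \<in> path_class p) \<in> path_class p"
      using someI[of "\<lambda>q. q \<in> path_class p" p] by simp
    then have "homotopic_paths UNIV p (SOME q. q \<in> path_class p)"
      unfolding path_class_def by (rule CollectD)
    from holonomy_homotopic[OF this] show ?thesis
      by (simp add: h_def)
  qed
  have "h \<in> hom (fundamental_group a) Gr"
  proof (rule homI)
    fix A B assume "A \<in> carrier (fundamental_group a)" "B \<in> carrier (fundamental_group a)"
    then obtain p q where "path p" "pathstart p = a" "pathfinish p = a" "A = path_class p"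
      "path q" "pathstart q = a" "pathfinish q = a" "B = path_class q"
      by (meson fundamental_groupE)
    then show "h A \<in> carrier Gr" "h (A \<otimes>\<^bsub>fundamental_group a\<^esub> B) = h A \<otimes> h B"
      by (simp_all add: h holonomy_closed holonomy_join mult_path_class)
  qed
  then show ?thesis
    using h that by blast
qed

end

section \<open>The gluing of the square\<close>

definition edge_len :: "int \<Rightarrow> real" where
  "edge_len n = (if n > 0 then 2 powi (- n) else 2 powi (n - 1))"

lemma edge_len_pos [simp]: "edge_len n > 0"
  by (simp add: edge_len_def)

lemma edge_len_Suc: "n > 0 \<Longrightarrow> edge_len (n + 1) = edge_len n / 2"
proof -
  assume "n > 0"
  moreover have "(2::real) powi (- n) = 2 powi (- (n + 1)) * 2 powi 1"
    by (subst power_int_add[symmetric]) auto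
  ultimately show ?thesis by (simp add: edge_len_def)
qed

lemma edge_len_pred: "n \<le> 0 \<Longrightarrow> edge_len (n - 1) = edge_len n / 2"
proof -
  assume "n \<le> 0"
  moreover have "(2::real) powi (n - 1) = 2 powi (n - 2) * 2 powi 1"
    by (subst power_int_add[symmetric]) auto
  ultimately show ?thesis by (simp add: edge_len_def)
qed

lemma edge_len_01 [simp]: "edge_len 0 = 1 / 2" "edge_len 1 = 1 / 2"
  by (simp_all add: edge_len_def)

lemma two_edge_len:
  "n > 0 \<Longrightarrow> 2 powi (1 - n) = 2 * edge_len n" "n \<le> 0 \<Longrightarrow> 2 powi n = 2 * edge_len n"
proof -
  have "(2::real) powi (1 - n) = 2 powi (- n) * 2 powi 1" "(2::real) powi n = 2 powi (n - 1) * 2 powi 1"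
    by (subst power_int_add[symmetric]; simp)+
  then show "n > 0 \<Longrightarrow> 2 powi (1 - n) = 2 * edge_len n" "n \<le> 0 \<Longrightarrow> 2 powi n = 2 * edge_len n"
    by (simp_all add: edge_len_def)
qed

text \<open>The factor 2 separates the edges: the interval from \<open>edge_len m\<close> to
  \<open>2 * edge_len m\<close> ends no later than the one from \<open>edge_len n\<close>
  begins.\<close>

lemma edge_len_mono_pos: "0 < n \<Longrightarrow> n < m \<Longrightarrow> 2 * edge_len m \<le> edge_len n"
  by (subst two_edge_len(1)[symmetric]) (auto simp: edge_len_def intro: power_int_increasing)

lemma edge_len_mono_neg: "m \<le> 0 \<Longrightarrow> n < m \<Longrightarrow> 2 * edge_len n \<le> edge_len m"
  by (subst two_edge_len(2)[symmetric]) (auto simp: edge_len_def intro: power_int_increasing)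

lemma edge_len_le_half: "edge_len n \<le> 1 / 2"
  using edge_len_mono_pos[of 1 n] edge_len_mono_neg[of 0 n] edge_len_pos[of n]
  by (cases "n > 1"; cases "n < 0"; cases "n = 0"; cases "n = 1") auto

text \<open>All coordinates of an edge are affine in its length. With the powers of 2 hidden in
  \<open>edge_len\<close>, gluing computations become linear arithmetic.\<close>

lemma exit_edge_eq:
  "exit_edge n = (if n > 0 then {(x, y). x = 1 \<and> 1 - 2 * edge_len n < y \<and> y < 1 - edge_len n}
     else {(x, y). y = 0 \<and> edge_len n < x \<and> x < 2 * edge_len n})"
  using two_edge_len[of n] by (auto simp: exit_edge_def edge_len_def split: if_splits)

lemma entry_edge_eq:
  "entry_edge n = (if n > 0 then {(x, y). x = 0 \<and> edge_len n < y \<and> y < 2 * edge_len n}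
     else {(x, y). y = 1 \<and> 1 - 2 * edge_len n < x \<and> x < 1 - edge_len n})"
  using two_edge_len[of n] by (auto simp: entry_edge_def edge_len_def split: if_splits)

lemma edge_shift_eq:
  "edge_shift n = (if n > 0 then (- 1, 3 * edge_len n - 1) else (1 - 3 * edge_len n, 1))"
  using two_edge_len[of n] by (auto simp: edge_shift_def edge_len_def split: if_splits)

lemma exit_midpoint_eq:
  "exit_midpoint n = (if n > 0 then (1, 1 - 3 * edge_len n / 2) else (3 * edge_len n / 2, 0))"
  by (auto simp: exit_midpoint_def edge_len_def)

lemma exit_edge_unique:
  assumes "z \<in> exit_edge n" "z \<in> exit_edge m"
  shows "n = m"
proof (rule ccontr)
  assume "n \<noteq> m"
  then show False
    using assms edge_len_mono_pos[of n m] edge_len_mono_pos[of m n]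
      edge_len_mono_neg[of n m] edge_len_mono_neg[of m n] edge_len_pos[of n] edge_len_pos[of m]
      edge_len_le_half[of n] edge_len_le_half[of m]
    by (cases "n < m") (auto simp: exit_edge_eq split: if_splits)
qed

lemma exit_edge_entry_edge_disjoint: "z \<in> exit_edge n \<Longrightarrow> z \<notin> entry_edge m"
  using edge_len_pos[of n] edge_len_pos[of m] edge_len_le_half[of n] edge_len_le_half[of m]
  by (auto simp: exit_edge_eq entry_edge_eq split: if_splits)

lemma square_interior_iff: "(x, y) \<in> square_interior \<longleftrightarrow> 0 < x \<and> x < 1 \<and> 0 < y \<and> y < 1"
  by (auto simp: square_interior_def)

lemma square_interior_not_edge:
  "z \<in> square_interior \<Longrightarrow> z \<notin> exit_edge n" "z \<in> square_interior \<Longrightarrow> z \<notin> entry_edge n"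
  by (auto simp: square_interior_def exit_edge_eq entry_edge_eq split: if_splits)

lemma square_cases:
  assumes "z \<in> square"
  obtains "z \<in> square_interior" | n where "z \<in> exit_edge n" | n where "z \<in> entry_edge n"
  using assms by (auto simp: square_def)

lemma in_square:
  "z \<in> square_interior \<Longrightarrow> z \<in> square" "z \<in> exit_edge n \<Longrightarrow> z \<in> square" "z \<in> entry_edge n \<Longrightarrow> z \<in> square"
  by (auto simp: square_def)

lemma square_bounds: "(x, y) \<in> square \<Longrightarrow> 0 \<le> x \<and> x \<le> 1 \<and> 0 \<le> y \<and> y \<le> 1"
proof (erule square_cases)
  fix n
  show "(x, y) \<in> exit_edge n \<Longrightarrow> 0 \<le> x \<and> x \<le> 1 \<and> 0 \<le> y \<and> y \<le> 1"
      "(x, y) \<in> entry_edge n \<Longrightarrow> 0 \<le> x \<and> x \<le> 1 \<and> 0 \<le> y \<and> y \<le> 1"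
    using edge_len_pos[of n] edge_len_le_half[of n]
    by (auto simp: exit_edge_eq entry_edge_eq split: if_splits)
qed (auto simp: square_interior_iff)

lemma exit_edge_shift_iff: "z + edge_shift n \<in> entry_edge n \<longleftrightarrow> z \<in> exit_edge n"
  unfolding translate_exit_edge[symmetric] by auto

text \<open>Every class of glued points has exactly one representative off the exit edges.\<close>

definition canon :: "real \<times> real \<Rightarrow> real \<times> real" where
  "canon z = (if \<exists>n. z \<in> exit_edge n then z + edge_shift (THE n. z \<in> exit_edge n) else z)"

lemma canon_exit: "z \<in> exit_edge n \<Longrightarrow> canon z = z + edge_shift n"
proof -
  assume z: "z \<in> exit_edge n"
  then have "(THE n. z \<in> exit_edge n) = n"
    by (intro the_equality) (auto intro: exit_edge_unique)
  with z show ?thesis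
    by (auto simp: canon_def)
qed

lemma canon_entry: "z \<in> entry_edge n \<Longrightarrow> canon z = z"
  by (auto simp: canon_def dest: exit_edge_entry_edge_disjoint)

lemma canon_interior: "z \<in> square_interior \<Longrightarrow> canon z = z"
  using square_interior_not_edge by (auto simp: canon_def)

lemma canon_glue:
  assumes "(z, w) \<in> (edge_gluing \<union> edge_gluing\<inverse>)\<^sup>*"
  shows "canon z = canon w"
  using assms
proof induction
  case (step u v)
  have "canon a = canon b" if "(a, b) \<in> edge_gluing" for a b
  proof -
    obtain n where "a \<in> exit_edge n" "b = a + edge_shift n"
      using \<open>(a, b) \<in> edge_gluing\<close> unfolding edge_gluing_def by blast
    then show ?thesis
      using canon_exit[of a n] canon_entry[of b n] exit_edge_shift_iff[of a n] by simp
  qed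
  then have "canon u = canon v"
    using step(2) by (metis UnE converseD)
  with step show ?case by simp
qed simp

lemma canon_square: "z \<in> square \<Longrightarrow> canon z \<in> square"
  by (erule square_cases) (auto simp: canon_interior canon_entry canon_exit in_square
      intro: in_square(3)[OF exit_edge_shift_iff[THEN iffD2]])

text \<open>Every point is glued to its normal form in at most one step, and gluing preserves normal
  forms; the generated equivalence is therefore equality of normal forms.\<close>

lemma surface_point_eq_iff:
  assumes "z \<in> square" "w \<in> square"
  shows "surface_point z = surface_point w \<longleftrightarrow> canon z = canon w"
proof -
  have glued: "(u, canon u) \<in> (edge_gluing \<union> edge_gluing\<inverse>)\<^sup>*" if "u \<in> square" for u
    using that
  proof (cases rule: square_cases)
    case (2 n)
    then have "(u, canon u) \<in> edge_gluing"
      unfolding edge_gluing_def mem_Collect_eq by (intro exI[of _ n] exI[of _ u]) (simp add: canon_exit)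
    then show ?thesis by auto
  qed (auto simp: canon_interior canon_entry)
  have sym: "sym ((edge_gluing \<union> edge_gluing\<inverse>)\<^sup>*)"
    by (simp add: sym_Un_converse sym_rtrancl)
  have refl: "chamanara_rel u u" if "u \<in> square" for u
    using that by (simp add: chamanara_rel_def)
  have "surface_point z = surface_point w \<longleftrightarrow> chamanara_rel z w"
    using Quotient3_rel[OF Quotient3_chamanara, of z w] refl assms by blast
  also have "\<dots> \<longleftrightarrow> (z, w) \<in> (edge_gluing \<union> edge_gluing\<inverse>)\<^sup>*"
    using assms by (simp add: chamanara_rel_def)
  also have "\<dots> \<longleftrightarrow> canon z = canon w"
  proof
    assume "canon z = canon w"
    then show "(z, w) \<in> (edge_gluing \<union> edge_gluing\<inverse>)\<^sup>*"
      using glued[OF assms(1)] glued[OF assms(2)] symD[OF sym] by (metis rtrancl_trans)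
  qed (rule canon_glue)
  finally show ?thesis .
qed

lemma surface_point_glue: "z \<in> exit_edge n \<Longrightarrow> surface_point (z + edge_shift n) = surface_point z"
  using surface_point_eq_iff[of "z + edge_shift n" z] in_square(2)[of z n]
    in_square(3)[of "z + edge_shift n" n] canon_exit[of z n] canon_entry[of "z + edge_shift n" n]
  by (simp add: exit_edge_shift_iff)

lemma rep_chamanara_square: "rep_chamanara s \<in> square"
  using Quotient3_rep_reflp[OF Quotient3_chamanara, of s] by (simp add: chamanara_rel_def)

lemma surface_point_rep: "surface_point (rep_chamanara s) = s"
  by (rule Quotient3_abs_rep[OF Quotient3_chamanara])

lemma surface_pointE:
  obtains z where "z \<in> square" "s = surface_point z"
  using rep_chamanara_square surface_point_rep by metis

text \<open>The representative picked by the quotient type is unspecified. Normalising it makes it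
  computable: a point of an edge is always read on the entry side.\<close>

definition rep :: "chamanara \<Rightarrow> real \<times> real" where
  "rep s = canon (rep_chamanara s)"

lemma rep_surface_point: "z \<in> square \<Longrightarrow> rep (surface_point z) = canon z"
  unfolding rep_def
  using surface_point_eq_iff[of "rep_chamanara (surface_point z)" z] rep_chamanara_square surface_point_rep
  by auto

text \<open>Meant for maps defined through \<open>rep_chamanara\<close>, such as \<open>phi\<close>:
  a planar formula that respects the gluing may be evaluated at any representative.\<close>

lemma glue_invariant_rep:
  assumes "\<And>z n. z \<in> exit_edge n \<Longrightarrow> f (z + edge_shift n) = f z" "z \<in> square"
  shows "f (rep_chamanara (surface_point z)) = f z"
proof -
  have *: "f (canon w) = f w" if "w \<in> square" for w
    using that by (cases rule: square_cases) (auto simp: canon_interior canon_entry canon_exit assms(1))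
  have "canon (rep_chamanara (surface_point z)) = canon z"
    using surface_point_eq_iff[of "rep_chamanara (surface_point z)" z] rep_chamanara_square
      surface_point_rep assms(2) by auto
  then show ?thesis
    using *[OF assms(2)] *[OF rep_chamanara_square] by metis
qed

lemma continuous_on_surface_point: "continuous_on square surface_point"
  unfolding continuous_on_open_invariant
proof (intro allI impI)
  fix B :: "chamanara set" assume "open B"
  then have "openin (top_of_set square) {z \<in> square. surface_point z \<in> B}"
    by (simp add: open_chamanara_def)
  then obtain A where "open A" "{z \<in> square. surface_point z \<in> B} = square \<inter> A"
    by (auto simp: openin_open)
  then show "\<exists>A. open A \<and> A \<inter> square = surface_point -` B \<inter> square"
    by (intro exI[of _ A]) auto
qed

lemma continuous_on_chamanara:
  fixes F :: "chamanara \<Rightarrow> 'b::topological_space"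
  assumes "continuous_on square (\<lambda>z. F (surface_point z))"
  shows "continuous_on UNIV F"
proof -
  have "open (F -` B)" if "open B" for B
  proof -
    have "openin (top_of_set square) (square \<inter> (\<lambda>z. F (surface_point z)) -` B)"
      using assms that by (rule continuous_openin_preimage_gen)
    moreover have "square \<inter> (\<lambda>z. F (surface_point z)) -` B = {z \<in> square. surface_point z \<in> F -` B}"
      by auto
    ultimately show ?thesis
      by (simp add: open_chamanara_def)
  qed
  then show ?thesis
    by (simp add: continuous_on_open_vimage)
qed

section \<open>The affine automorphism\<close>

definition phi_plane :: "real \<times> real \<Rightarrow> chamanara" where
  "phi_plane z = (if snd z \<le> 1/2 then surface_point (fst z / 2, 2 * snd z)
     else surface_point (fst z / 2 + 1/2, 2 * snd z - 1))"

text \<open>The candidate for the inverse of \<open>phi\<close>: \<open>diag(2, 1/2)\<close>, after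
  which the right half of the image is carried through edge 1 by its translation
  \<open>(-1, 1/2)\<close>.\<close>

definition psi_plane :: "real \<times> real \<Rightarrow> chamanara" where
  "psi_plane z = (if fst z \<le> 1/2 then surface_point (2 * fst z, snd z / 2)
     else surface_point (2 * fst z - 1, snd z / 2 + 1/2))"

definition psi :: "chamanara \<Rightarrow> chamanara" where
  "psi s = psi_plane (rep_chamanara s)"

lemma surface_point_glueI:
  assumes "z \<in> exit_edge n" "w = z + edge_shift n"
  shows "surface_point w = surface_point z"
  using surface_point_glue assms by simp

text \<open>\<open>phi\<close> carries edge \<open>n\<close> to edge \<open>n - 1\<close>, except
  that edge 1 becomes the segment \<open>x = 1/2\<close> inside the square, where the two
  representatives already coincide.\<close>

lemma phi_plane_glue:
  assumes "z \<in> exit_edge n"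
  shows "phi_plane (z + edge_shift n) = phi_plane z"
proof -
  obtain x y where z: "z = (x, y)" by fastforce
  note L = edge_len_pos[of n] edge_len_le_half[of n]
  consider "n > 1" | "n = 1" | "n \<le> 0" by linarith
  then show ?thesis
  proof cases
    case 1
    then have len: "edge_len (n - 1) = 2 * edge_len n" "edge_len n \<le> 1/4"
      using edge_len_Suc[of "n - 1"] edge_len_le_half[of "n - 1"] by auto
    have *: "surface_point (0, 2 * (y + 3 * edge_len n - 1)) = surface_point (1, 2 * y - 1)"
      by (rule surface_point_glueI[of _ "n - 1"])
        (use 1 assms z len in \<open>auto simp: exit_edge_eq edge_shift_eq\<close>)
    then show ?thesis
      using 1 assms z len L by (auto simp: phi_plane_def exit_edge_eq edge_shift_eq algebra_simps)
  next
    case 2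
    then show ?thesis
      using assms z by (auto simp: phi_plane_def exit_edge_eq edge_shift_eq)
  next
    case 3
    then have len: "edge_len (n - 1) = edge_len n / 2"
      using edge_len_pred by auto
    have *: "surface_point ((x + 1 - 3 * edge_len n) / 2 + 1/2, 1) = surface_point (x / 2, 0)"
      by (rule surface_point_glueI[of _ "n - 1"])
        (use 3 assms z len in \<open>auto simp: exit_edge_eq edge_shift_eq field_simps\<close>)
    then show ?thesis
      using 3 assms z len L by (auto simp: phi_plane_def exit_edge_eq edge_shift_eq algebra_simps)
  qed
qed

text \<open>\<open>psi\<close> carries edge \<open>n\<close> to edge \<open>n + 1\<close>, except
  that edge 0 becomes the segment \<open>y = 1/2\<close> inside the square. This shift of labels is
  the source of the index \<open>n + 1\<close> in the formulas for the automorphism.\<close>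

lemma psi_plane_glue:
  assumes "z \<in> exit_edge n"
  shows "psi_plane (z + edge_shift n) = psi_plane z"
proof -
  obtain x y where z: "z = (x, y)" by fastforce
  note L = edge_len_pos[of n] edge_len_le_half[of n]
  consider "n > 0" | "n = 0" | "n < 0" by linarith
  then show ?thesis
  proof cases
    case 1
    then have len: "edge_len (n + 1) = edge_len n / 2"
      using edge_len_Suc[of n] by auto
    have *: "surface_point (0, (y + 3 * edge_len n - 1) / 2) = surface_point (1, y / 2 + 1/2)"
      by (rule surface_point_glueI[of _ "n + 1"])
        (use 1 assms z len in \<open>auto simp: exit_edge_eq edge_shift_eq field_simps\<close>)
    then show ?thesis
      using 1 assms z len L by (auto simp: psi_plane_def exit_edge_eq edge_shift_eq algebra_simps)
  next
    case 2
    then show ?thesis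
      using assms z by (auto simp: psi_plane_def exit_edge_eq edge_shift_eq)
  next
    case 3
    then have len: "edge_len (n + 1) = 2 * edge_len n" "edge_len n \<le> 1/4"
      using edge_len_pred[of "n + 1"] edge_len_le_half[of "n + 1"] by auto
    have *: "surface_point (2 * (x + 1 - 3 * edge_len n) - 1, 1) = surface_point (2 * x, 0)"
      by (rule surface_point_glueI[of _ "n + 1"])
        (use 3 assms z len in \<open>auto simp: exit_edge_eq edge_shift_eq field_simps\<close>)
    then show ?thesis
      using 3 assms z len L by (auto simp: psi_plane_def exit_edge_eq edge_shift_eq algebra_simps)
  qed
qed

lemma phi_surface_point: "z \<in> square \<Longrightarrow> phi (surface_point z) = phi_plane z"
  using glue_invariant_rep[of phi_plane z] phi_plane_glue
  by (simp add: phi_def phi_plane_def split_beta Let_def)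

lemma psi_surface_point: "z \<in> square \<Longrightarrow> psi (surface_point z) = psi_plane z"
  using glue_invariant_rep[of psi_plane z] psi_plane_glue by (simp add: psi_def)

text \<open>No discarded point is hit: the cut \<open>x = 1/2\<close> lands on the exit side of edge
  1, bottom edges go to bottom edges, left edges to left edges, and the top side goes to the inner
  line \<open>y = 1/2\<close>.\<close>

lemma left_half_square:
  assumes "(x, y) \<in> square" "x \<le> 1/2"
  shows "(2 * x, y / 2) \<in> square"
  using assms(1)
proof (cases rule: square_cases)
  case 1
  then show ?thesis
    using assms(2) in_square(1)[of "(2 * x, y / 2)"] in_square(2)[of "(2 * x, y / 2)" 1]
    by (cases "2 * x = 1") (simp_all add: square_interior_iff exit_edge_eq)
next
  case (2 n)
  then have "n < 0" "edge_len (n + 1) = 2 * edge_len n"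
    using assms(2) edge_len_pred[of "n + 1"] by (cases "n = 0"; auto simp: exit_edge_eq split: if_splits)+
  with 2 show ?thesis
    by (intro in_square(2)[of _ "n + 1"]) (auto simp: exit_edge_eq)
next
  case (3 n)
  show ?thesis
  proof (cases "n > 0")
    case True
    then show ?thesis
      using 3 edge_len_Suc[of n] by (intro in_square(3)[of _ "n + 1"]) (auto simp: entry_edge_eq)
  next
    case False
    have "x > 0"
      using False 3 edge_len_le_half[of n] by (auto simp: entry_edge_eq)
    moreover have "x < 1/2"
      using False 3 assms(2) edge_len_mono_neg[of 0 n] by (cases "n = 0") (auto simp: entry_edge_eq)
    ultimately show ?thesis
      using False 3 by (intro in_square(1)) (auto simp: entry_edge_eq square_interior_iff)
  qed
qed

lemma right_half_square:
  assumes "(x, y) \<in> square" "1/2 \<le> x"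
  shows "(2 * x - 1, y / 2 + 1/2) \<in> square"
  using assms(1)
proof (cases rule: square_cases)
  case 1
  then show ?thesis
    using assms(2) in_square(1)[of "(2 * x - 1, y / 2 + 1/2)"] in_square(3)[of "(2 * x - 1, y / 2 + 1/2)" 1]
    by (cases "2 * x = 1") (simp_all add: square_interior_iff entry_edge_eq)
next
  case (2 n)
  show ?thesis
  proof (cases "n > 0")
    case True
    then show ?thesis
      using 2 edge_len_Suc[of n] by (intro in_square(2)[of _ "n + 1"]) (auto simp: exit_edge_eq field_simps)
  next
    case False
    have "x < 1"
      using False 2 edge_len_le_half[of n] by (auto simp: exit_edge_eq)
    moreover have "1/2 < x"
      using False 2 assms(2) edge_len_mono_neg[of 0 n] by (cases "n = 0") (auto simp: exit_edge_eq)
    ultimately show ?thesis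
      using False 2 by (intro in_square(1)) (auto simp: exit_edge_eq square_interior_iff)
  qed
next
  case (3 n)
  then have "n < 0" "edge_len (n + 1) = 2 * edge_len n"
    using assms(2) edge_len_pred[of "n + 1"] by (cases "n = 0"; auto simp: entry_edge_eq split: if_splits)+
  with 3 show ?thesis
    by (intro in_square(3)[of _ "n + 1"]) (auto simp: entry_edge_eq)
qed

lemma psi_plane_seam:
  assumes "0 < y" "y < 1"
  shows "surface_point (1, y / 2) = surface_point (0, y / 2 + 1/2)"
  by (rule surface_point_glueI[of _ 1, symmetric]) (use assms in \<open>auto simp: exit_edge_eq edge_shift_eq\<close>)

lemma square_half_interior: "(1/2, y) \<in> square \<Longrightarrow> 0 < y \<and> y < 1"
proof (erule square_cases)
  fix n
  show "(1/2, y) \<in> exit_edge n \<Longrightarrow> 0 < y \<and> y < 1"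
    using edge_len_mono_neg[of 0 n] by (cases "n = 0") (auto simp: exit_edge_eq split: if_splits)
  show "(1/2, y) \<in> entry_edge n \<Longrightarrow> 0 < y \<and> y < 1"
    using edge_len_mono_neg[of 0 n] by (cases "n = 0") (auto simp: entry_edge_eq split: if_splits)
qed (auto simp: square_interior_iff)

text \<open>The two affine branches disagree in the plane along \<open>x = 1/2\<close>, but there
  they give the two representatives of one point of edge 1, so they paste in the surface.\<close>

lemma continuous_on_psi: "continuous_on UNIV psi"
proof (rule continuous_on_chamanara)
  have "continuous_on square psi_plane"
    unfolding psi_plane_def
  proof (rule continuous_on_cases_le)
    have "continuous_on {t \<in> square. fst t \<le> 1/2} (surface_point \<circ> (\<lambda>t. (2 * fst t, snd t / 2)))"
      by (rule continuous_on_compose, force intro: continuous_intros,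
          rule continuous_on_subset[OF continuous_on_surface_point]) (auto intro!: left_half_square)
    then show "continuous_on {t \<in> square. fst t \<le> 1/2} (\<lambda>t. surface_point (2 * fst t, snd t / 2))"
      by (simp add: o_def)
    have "continuous_on {t \<in> square. 1/2 \<le> fst t} (surface_point \<circ> (\<lambda>t. (2 * fst t - 1, snd t / 2 + 1/2)))"
      by (rule continuous_on_compose, force intro: continuous_intros,
          rule continuous_on_subset[OF continuous_on_surface_point]) (auto intro!: right_half_square)
    then show "continuous_on {t \<in> square. 1/2 \<le> fst t} (\<lambda>t. surface_point (2 * fst t - 1, snd t / 2 + 1/2))"
      by (simp add: o_def)
    show "surface_point (2 * fst t, snd t / 2) = surface_point (2 * fst t - 1, snd t / 2 + 1/2)"
      if t: "t \<in> square" "fst t = 1/2" for t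
    proof -
      obtain y where "t = (1/2, y)"
        using t by (intro that[of "snd t"]) (simp add: prod_eq_iff)
      with t show ?thesis
        using psi_plane_seam[of y] square_half_interior[of y] by simp
    qed
  qed (intro continuous_intros)
  then show "continuous_on square (\<lambda>z. psi (surface_point z))"
    by (simp add: psi_surface_point cong: continuous_on_cong)
qed

lemma phi_psi: "phi (psi s) = s"
proof -
  obtain z where z: "z \<in> square" "s = surface_point z"
    by (rule surface_pointE)
  obtain x y where xy: "z = (x, y)" by fastforce
  show ?thesis
  proof (cases "x \<le> 1/2")
    case True
    have "phi (surface_point (2 * x, y / 2)) = phi_plane (2 * x, y / 2)"
      using left_half_square[of x y] True z xy by (intro phi_surface_point) auto
    then show ?thesis
      using True z xy square_bounds[of x y] by (auto simp: psi_surface_point psi_plane_def phi_plane_def)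
  next
    case False
    have eq: "phi (surface_point (2 * x - 1, y / 2 + 1/2)) = phi_plane (2 * x - 1, y / 2 + 1/2)"
      using right_half_square[of x y] False z xy by (intro phi_surface_point) auto
    show ?thesis
    \<comment> \<open>For \<open>y = 0\<close> the image under \<open>psi\<close> has height exactly
      1/2, where \<open>phi_plane\<close> takes its lower branch and returns the point on the top
      side: the other representative of \<open>(x, 0)\<close> on edge 0.\<close>
    proof (cases "y = 0")
      case True
      have "n = 0" if "(x, y) \<in> exit_edge n" for n
        using that True False edge_len_mono_neg[of 0 n] edge_len_le_half[of n]
        by (cases "n > 0"; cases "n = 0") (auto simp: exit_edge_eq)
      moreover have "(x, y) \<in> square_interior \<or> (\<exists>n. (x, y) \<in> exit_edge n)"
        using z True xy False by (cases rule: square_cases) (auto simp: entry_edge_eq split: if_splits)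
      ultimately have e: "(x, y) \<in> exit_edge 0"
        using True by (auto simp: square_interior_iff)
      then have "surface_point (x - 1/2, 1) = surface_point (x, y)"
        by (rule surface_point_glueI) (auto simp: edge_shift_eq True)
      then show ?thesis
        using False z xy eq True by (auto simp: psi_surface_point psi_plane_def phi_plane_def diff_divide_distrib)
    next
      case y: False
      then show ?thesis
        using False z xy eq square_bounds[of x y]
        by (auto simp: psi_surface_point psi_plane_def phi_plane_def diff_divide_distrib)
    qed
  qed
qed

lemma upper_half_square:
  assumes "(x, y) \<in> square" "1/2 < y"
  shows "(x / 2 + 1/2, 2 * y - 1) \<in> square \<and> (x / 2 + 1/2 = 1/2 \<longrightarrow> 0 < 2 * y - 1 \<and> 2 * y - 1 < 1)"
  using assms(1)
proof (cases rule: square_cases)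
  case 1
  then show ?thesis
    using assms(2) by (auto intro!: in_square(1) simp: square_interior_iff)
next
  case (2 n)
  then have "n > 1" "edge_len n = edge_len (n - 1) / 2"
    using assms(2) edge_len_Suc[of "n - 1"] by (cases "n = 1"; auto simp: exit_edge_eq split: if_splits)+
  with 2 show ?thesis
    using in_square(2)[of "(x / 2 + 1/2, 2 * y - 1)" "n - 1"] by (auto simp: exit_edge_eq)
next
  case (3 n)
  show ?thesis
  proof (cases "n > 0")
    case True
    have "n = 1"
      using True 3 assms(2) edge_len_mono_pos[of 1 n] by (cases "n = 1") (auto simp: entry_edge_eq)
    with 3 show ?thesis
      using assms(2) by (auto intro!: in_square(1) simp: square_interior_iff entry_edge_eq)
  next
    case False
    with 3 show ?thesis
      using edge_len_pred[of n] edge_len_le_half[of n] in_square(3)[of "(x / 2 + 1/2, 2 * y - 1)" "n - 1"]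
      by (auto simp: entry_edge_eq field_simps)
  qed
qed

lemma lower_half_square:
  assumes "(x, y) \<in> square" "y \<le> 1/2"
  shows "(x / 2, 2 * y) \<in> square"
  using assms(1)
proof (cases rule: square_cases)
  case 1
  then show ?thesis
    using assms(2) in_square(1)[of "(x / 2, 2 * y)"] in_square(3)[of "(x / 2, 2 * y)" 0]
    by (cases "2 * y = 1") (simp_all add: square_interior_iff entry_edge_eq)
next
  case (2 n)
  show ?thesis
  proof (cases "n > 0")
    case True
    then have "n = 1"
      using 2 assms(2) edge_len_mono_pos[of 1 n] by (cases "n = 1") (auto simp: exit_edge_eq)
    with 2 show ?thesis
      by (auto intro!: in_square(1) simp: square_interior_iff exit_edge_eq)
  next
    case False
    with 2 show ?thesis
      using edge_len_pred[of n] by (intro in_square(2)[of _ "n - 1"]) (auto simp: exit_edge_eq)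
  qed
next
  case (3 n)
  then have "n > 1" "edge_len n = edge_len (n - 1) / 2"
    using assms(2) edge_len_Suc[of "n - 1"] by (cases "n = 1"; auto simp: entry_edge_eq split: if_splits)+
  with 3 show ?thesis
    by (intro in_square(3)[of _ "n - 1"]) (auto simp: entry_edge_eq)
qed

lemma psi_phi: "psi (phi s) = s"
proof -
  obtain z where z: "z \<in> square" "s = surface_point z"
    by (rule surface_pointE)
  obtain x y where xy: "z = (x, y)" by fastforce
  show ?thesis
  proof (cases "y \<le> 1/2")
    case True
    have "psi (surface_point (x / 2, 2 * y)) = psi_plane (x / 2, 2 * y)"
      using lower_half_square[of x y] True z xy by (intro psi_surface_point) auto
    then show ?thesis
      using True z xy square_bounds[of x y] by (auto simp: phi_surface_point psi_plane_def phi_plane_def)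
  next
    case False
    have eq: "psi (surface_point (x / 2 + 1/2, 2 * y - 1)) = psi_plane (x / 2 + 1/2, 2 * y - 1)"
      using upper_half_square[of x y] False z xy by (intro psi_surface_point) auto
    show ?thesis
    \<comment> \<open>For \<open>x = 0\<close> the image under \<open>phi\<close> has abscissa
      exactly 1/2, where \<open>psi_plane\<close> takes its left branch and returns the exit
      representative of \<open>(0, y)\<close> on edge 1.\<close>
    proof (cases "x = 0")
      case True
      then have "0 < 2 * y - 1" "2 * y - 1 < 1"
        using upper_half_square[of x y] False z xy by auto
      then have "surface_point (1, y - 1/2) = surface_point (0, y)"
        using psi_plane_seam[of "2 * y - 1"] by (simp add: diff_divide_distrib)
      then show ?thesis
        using False z xy eq True by (auto simp: phi_surface_point psi_plane_def phi_plane_def diff_divide_distrib)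
    next
      case x: False
      then show ?thesis
        using False z xy eq square_bounds[of x y]
        by (auto simp: phi_surface_point psi_plane_def phi_plane_def diff_divide_distrib)
    qed
  qed
qed

lemma inv_phi: "inv' phi = psi"
  by (rule inv_equality) (simp_all add: phi_psi psi_phi)

section \<open>Neighbourhoods of the edges\<close>

lemma open_square_interior: "open square_interior"
  unfolding square_interior_def by (intro open_Times) auto

lemma convex_square_interior: "convex square_interior"
  unfolding square_interior_def by (intro convex_Times) auto

lemma square_subset_closure: "square \<subseteq> closure square_interior"
proof -
  have "closure square_interior = {0..1} \<times> {0..1}"
    by (simp add: square_interior_def closure_Times)
  then show ?thesis
    using square_bounds by fastforce
qed

text \<open>The square itself is not convex, since a segment along a side runs through discarded
  points. Adding one convex piece of the boundary is harmless: a segment with an interior end is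
  interior up to its other end, and segments between two points of \<open>E\<close> stay in
  \<open>E\<close>.\<close>

lemma convex_edge_extension:
  assumes "convex E" "E \<subseteq> square"
  shows "convex (square_interior \<union> E)"
  unfolding convex_contains_open_segment
proof (intro ballI)
  fix a b assume ab: "a \<in> square_interior \<union> E" "b \<in> square_interior \<union> E"
  have one: "open_segment u v \<subseteq> square_interior" if "u \<in> square_interior" "v \<in> square_interior \<union> E" for u v
    using in_interior_closure_convex_segment[OF convex_square_interior, of u v] that assms(2)
      square_subset_closure closure_subset[of square_interior]
    by (auto simp: interior_open open_square_interior)
  consider "a \<in> square_interior" | "b \<in> square_interior" | "a \<in> E" "b \<in> E"
    using ab by blast
  then show "open_segment a b \<subseteq> square_interior \<union> E"
  proof cases
    case 1
    then show ?thesis using one ab by blast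
  next
    case 2
    then show ?thesis using one[of b a] ab by (metis open_segment_commute le_supI1)
  next
    case 3
    then show ?thesis
      using assms(1) unfolding convex_contains_open_segment by blast
  qed
qed

lemma convex_interior_exit: "convex (square_interior \<union> exit_edge n)"
  and convex_interior_entry: "convex (square_interior \<union> entry_edge n)"
proof -
  have "convex (exit_edge n)" "convex (entry_edge n)"
    by (simp_all add: exit_edge_def entry_edge_def convex_Times)
  then show "convex (square_interior \<union> exit_edge n)" "convex (square_interior \<union> entry_edge n)"
    using in_square by (intro convex_edge_extension; blast)+
qed

lemma interior_edge_subset_square:
  "square_interior \<subseteq> square" "square_interior \<union> exit_edge n \<subseteq> square" "square_interior \<union> entry_edge n \<subseteq> square"
  by (auto intro: in_square)

text \<open>The triangles with base an edge and slopes \<open>\<plusminus>1\<close>: distinct exit and entry triangles are disjoint.\<close>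

definition exit_cone :: "int \<Rightarrow> (real \<times> real) set" where
  "exit_cone n = (if n > 0
     then {(x, y). x \<le> 1 \<and> 1 - x < y - (1 - 2 * edge_len n) \<and> 1 - x < (1 - edge_len n) - y}
     else {(x, y). 0 \<le> y \<and> y < x - edge_len n \<and> y < 2 * edge_len n - x})"

definition entry_cone :: "int \<Rightarrow> (real \<times> real) set" where
  "entry_cone n = (if n > 0
     then {(x, y). 0 \<le> x \<and> x < y - edge_len n \<and> x < 2 * edge_len n - y}
     else {(x, y). y \<le> 1 \<and> 1 - y < x - (1 - 2 * edge_len n) \<and> 1 - y < (1 - edge_len n) - x})"

lemma exit_cone_cases: "z \<in> exit_cone n \<Longrightarrow> z \<in> square_interior \<or> z \<in> exit_edge n"
  using edge_len_pos[of n] edge_len_le_half[of n]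
  by (cases z) (auto simp: exit_cone_def exit_edge_eq square_interior_iff split: if_splits)

lemma entry_cone_cases: "z \<in> entry_cone n \<Longrightarrow> z \<in> square_interior \<or> z \<in> entry_edge n"
  using edge_len_pos[of n] edge_len_le_half[of n]
  by (cases z) (auto simp: entry_cone_def entry_edge_eq square_interior_iff split: if_splits)

lemma exit_edge_subset_cone: "exit_edge n \<subseteq> exit_cone n"
  by (auto simp: exit_cone_def exit_edge_eq)

lemma entry_edge_subset_cone: "entry_edge n \<subseteq> entry_cone n"
  by (auto simp: entry_cone_def entry_edge_eq)

lemma cones_subset_square: "exit_cone n \<subseteq> square" "entry_cone n \<subseteq> square"
  using exit_cone_cases[of _ n] entry_cone_cases[of _ n] in_square by (meson subsetI)+

lemma exit_coneD:
  assumes "(x, y) \<in> exit_cone n"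
  shows "y < x" "n > 0 \<Longrightarrow> (1, y) \<in> exit_edge n \<and> 1 - x < y \<and> 3/4 < x"
    "n \<le> 0 \<Longrightarrow> (x, 0) \<in> exit_edge n \<and> y < 1 - x \<and> y < 1/4"
  using assms edge_len_pos[of n] edge_len_le_half[of n]
  by (cases "n > 0"; simp add: exit_cone_def exit_edge_eq)+

lemma entry_coneD:
  assumes "(x, y) \<in> entry_cone n"
  shows "x < y" "n > 0 \<Longrightarrow> (0, y) \<in> entry_edge n \<and> x < 1 - y \<and> x < 1/4"
    "n \<le> 0 \<Longrightarrow> (x, 1) \<in> entry_edge n \<and> 1 - y < x \<and> 3/4 < y"
  using assms edge_len_pos[of n] edge_len_le_half[of n]
  by (cases "n > 0"; simp add: entry_cone_def entry_edge_eq)+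

lemma entry_edge_unique: "z \<in> entry_edge n \<Longrightarrow> z \<in> entry_edge m \<Longrightarrow> n = m"
proof (rule ccontr)
  assume "z \<in> entry_edge n" "z \<in> entry_edge m" "n \<noteq> m"
  then show False
    using edge_len_mono_pos[of n m] edge_len_mono_pos[of m n]
      edge_len_mono_neg[of n m] edge_len_mono_neg[of m n] edge_len_pos[of n] edge_len_pos[of m]
      edge_len_le_half[of n] edge_len_le_half[of m]
    by (cases "n < m") (auto simp: entry_edge_eq split: if_splits)
qed

lemma exit_cone_unique:
  assumes "z \<in> exit_cone n" "z \<in> exit_cone m"
  shows "n = m"
proof -
  obtain x y where z: "z = (x, y)" by fastforce
  note n = exit_coneD(2,3)[OF assms(1)[unfolded z]] and m = exit_coneD(2,3)[OF assms(2)[unfolded z]]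
  consider "n > 0" "m > 0" | "n \<le> 0" "m \<le> 0" | "n > 0" "m \<le> 0" | "n \<le> 0" "m > 0"
    by linarith
  then show ?thesis
    using n m by cases (auto intro: exit_edge_unique)
qed

lemma entry_cone_unique:
  assumes "z \<in> entry_cone n" "z \<in> entry_cone m"
  shows "n = m"
proof -
  obtain x y where z: "z = (x, y)" by fastforce
  note n = entry_coneD(2,3)[OF assms(1)[unfolded z]] and m = entry_coneD(2,3)[OF assms(2)[unfolded z]]
  consider "n > 0" "m > 0" | "n \<le> 0" "m \<le> 0" | "n > 0" "m \<le> 0" | "n \<le> 0" "m > 0"
    by linarith
  then show ?thesis
    using n m by cases (auto intro: entry_edge_unique)
qed

lemma exit_cone_entry_cone_disjoint: "z \<in> exit_cone n \<Longrightarrow> z \<notin> entry_cone m"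
  using exit_coneD(1)[of "fst z" "snd z" n] entry_coneD(1)[of "fst z" "snd z" m] by auto

text \<open>The triangles of one edge lie within 1/4 of opposite sides of the square. Sets of extent
  at most 1/2 therefore cannot meet both of them.\<close>

lemma exit_cone_far_from_entry_cone:
  assumes "z \<in> exit_cone n" "w \<in> entry_cone n"
  shows "\<bar>fst z - fst w\<bar> > 1/2 \<or> \<bar>snd z - snd w\<bar> > 1/2"
  using assms exit_coneD(2,3)[of "fst z" "snd z" n] entry_coneD(2,3)[of "fst w" "snd w" n]
  by (cases "n > 0") auto

lemma openin_cones:
  "openin (top_of_set square) (exit_cone n)" "openin (top_of_set square) (entry_cone n)"
proof -
  define A where "A = (if n > 0
     then {z. 1 - fst z < snd z - (1 - 2 * edge_len n)} \<inter> {z. 1 - fst z < (1 - edge_len n) - snd z}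
     else {z. snd z < fst z - edge_len n} \<inter> {z. snd z < 2 * edge_len n - fst z})"
  define B where "B = (if n > 0
     then {z. fst z < snd z - edge_len n} \<inter> {z. fst z < 2 * edge_len n - snd z}
     else {z. 1 - snd z < fst z - (1 - 2 * edge_len n)} \<inter> {z. 1 - snd z < (1 - edge_len n) - fst z})"
  have "open A" "open B"
    unfolding A_def B_def
    by (auto intro!: open_Int open_Collect_less continuous_intros)
  moreover have "exit_cone n = square \<inter> A" "entry_cone n = square \<inter> B"
    using cones_subset_square[of n] square_bounds
    by (auto simp: exit_cone_def entry_cone_def A_def B_def split: if_splits)
  ultimately show "openin (top_of_set square) (exit_cone n)" "openin (top_of_set square) (entry_cone n)"
    by (auto simp: openin_open)
qed

text \<open>The two triangles of an edge together form a set saturated under the gluing, which is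
  what makes their image in the surface open.\<close>

lemma canon_cones_iff:
  assumes "z \<in> square"
  shows "canon z \<in> exit_cone n \<union> entry_cone n \<longleftrightarrow> z \<in> exit_cone n \<union> entry_cone n"
  using assms
proof (cases rule: square_cases)
  case (2 m)
  have "canon z \<in> entry_cone m" "z \<in> exit_cone m"
    using 2 exit_edge_subset_cone[of m] entry_edge_subset_cone[of m] exit_edge_shift_iff[of z m]
    by (auto simp: canon_exit)
  then show ?thesis
    using exit_cone_unique entry_cone_unique exit_cone_entry_cone_disjoint by blast
qed (simp_all add: canon_interior canon_entry)

definition edge_nbhd :: "int \<Rightarrow> chamanara set" where
  "edge_nbhd n = surface_point ` (exit_cone n \<union> entry_cone n)"

lemma in_edge_nbhd_iff:
  assumes "z \<in> square"
  shows "surface_point z \<in> edge_nbhd n \<longleftrightarrow> z \<in> exit_cone n \<union> entry_cone n"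
proof
  assume "surface_point z \<in> edge_nbhd n"
  then obtain w where w: "w \<in> exit_cone n \<union> entry_cone n" "surface_point z = surface_point w"
    by (auto simp: edge_nbhd_def)
  then have "w \<in> square" using cones_subset_square by blast
  with w assms show "z \<in> exit_cone n \<union> entry_cone n"
    using canon_cones_iff surface_point_eq_iff by metis
qed (auto simp: edge_nbhd_def)

lemma open_edge_nbhd: "open (edge_nbhd n)"
proof -
  have "{z \<in> square. surface_point z \<in> edge_nbhd n} = exit_cone n \<union> entry_cone n"
    using in_edge_nbhd_iff cones_subset_square by blast
  then show ?thesis
    using openin_cones by (simp add: open_chamanara_def openin_Un)
qed

lemma surface_point_interior_iff:
  assumes "z \<in> square" "B \<subseteq> square_interior"
  shows "surface_point z \<in> surface_point ` B \<longleftrightarrow> z \<in> B"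
proof
  assume "surface_point z \<in> surface_point ` B"
  then obtain w where w: "w \<in> B" "surface_point z = surface_point w" by blast
  have "w \<in> square_interior"
    using w(1) assms(2) by (rule subsetD[rotated])
  then have w': "w \<in> square" "canon w = w" "w \<in> square_interior"
    by (simp_all add: canon_interior in_square(1))
  then have eq: "canon z = w"
    using surface_point_eq_iff[OF assms(1) w'(1)] w(2) by simp
  have "z = w"
    using assms(1)
  proof (cases rule: square_cases)
    case (2 n)
    then have "w \<in> entry_edge n"
      using eq exit_edge_shift_iff[of z n] by (simp add: canon_exit)
    with w'(3) show ?thesis
      using square_interior_not_edge(2) by simp
  qed (use eq in \<open>simp_all add: canon_interior canon_entry\<close>)
  with w show "z \<in> B" by simp
qed auto

lemma open_surface_point_interior:
  assumes "open B" "B \<subseteq> square_interior"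
  shows "open (surface_point ` B)"
proof -
  have "{z \<in> square. surface_point z \<in> surface_point ` B} = B"
    using surface_point_interior_iff[OF _ assms(2)] assms(2) in_square(1) by blast
  moreover have "openin (top_of_set square) B"
    using assms in_square(1) by (metis inf.absorb_iff2 openin_open subset_trans subsetI)
  ultimately show ?thesis
    by (simp add: open_chamanara_def)
qed

text \<open>A planar chart around an edge: the exit triangle, continued across the edge by the
  translated entry triangle.\<close>

definition edge_rhombus :: "int \<Rightarrow> (real \<times> real) set" where
  "edge_rhombus n = (if n > 0
     then {(x, y). \<bar>1 - x\<bar> < y - (1 - 2 * edge_len n) \<and> \<bar>1 - x\<bar> < (1 - edge_len n) - y}
     else {(x, y). \<bar>y\<bar> < x - edge_len n \<and> \<bar>y\<bar> < 2 * edge_len n - x})"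

definition edge_chart :: "int \<Rightarrow> real \<times> real \<Rightarrow> chamanara" where
  "edge_chart n z = (if z \<in> exit_cone n then surface_point z else surface_point (z + edge_shift n))"

definition edge_coord :: "int \<Rightarrow> chamanara \<Rightarrow> real \<times> real" where
  "edge_coord n s = (if rep s \<in> entry_cone n then rep s - edge_shift n else rep s)"

lemma edge_rhombus_iff: "z \<in> edge_rhombus n \<longleftrightarrow> z \<in> exit_cone n \<or> z + edge_shift n \<in> entry_cone n"
  by (cases z) (auto simp: edge_rhombus_def exit_cone_def entry_cone_def edge_shift_eq abs_if)

lemma exit_cone_in_rhombus:
  "z \<in> edge_rhombus n \<Longrightarrow> z \<in> exit_cone n \<longleftrightarrow> (if n > 0 then fst z \<le> 1 else - snd z \<le> 0)"
  by (cases z) (auto simp: edge_rhombus_def exit_cone_def)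

lemma convex_edge_rhombus: "convex (edge_rhombus n)"
proof -
  have *: "convex {z :: real \<times> real. a * fst z + b * snd z < c}" for a b c
    using convex_halfspace_lt[of "(a, b)" c] by (simp add: inner_prod_def)
  have eq: "edge_rhombus n = (if n > 0
     then {z. (- 1) * fst z + (- 1) * snd z < - (2 - 2 * edge_len n)} \<inter> {z. 1 * fst z + (- 1) * snd z < 2 * edge_len n}
       \<inter> ({z. (- 1) * fst z + 1 * snd z < - edge_len n} \<inter> {z. 1 * fst z + 1 * snd z < 2 - edge_len n})
     else {z. (- 1) * fst z + 1 * snd z < - edge_len n} \<inter> {z. (- 1) * fst z + (- 1) * snd z < - edge_len n}
       \<inter> ({z. 1 * fst z + 1 * snd z < 2 * edge_len n} \<inter> {z. 1 * fst z + (- 1) * snd z < 2 * edge_len n}))"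
    by (auto simp: edge_rhombus_def abs_less_iff)
  show ?thesis
    unfolding eq by (cases "n > 0"; simp only: if_True if_False; intro convex_Int *)
qed

lemma continuous_on_edge_chart: "continuous_on (edge_rhombus n) (edge_chart n)"
proof -
  \<comment> \<open>The signed distance across the edge: nonpositive on the exit side, zero on the
    edge, positive after crossing.\<close>
  define k where "k z = (if n > 0 then fst z - 1 else - snd z)" for z :: "real \<times> real"
  have cont: "continuous_on A k" for A
    unfolding k_def by (cases "n > 0") (auto intro!: continuous_intros)
  have exit: "z \<in> exit_cone n \<longleftrightarrow> k z \<le> 0" if "z \<in> edge_rhombus n" for z
    using exit_cone_in_rhombus[OF that] by (auto simp: k_def)
  have seam: "z \<in> exit_edge n" if "z \<in> edge_rhombus n" "k z = 0" for z
    using that by (cases z) (auto simp: k_def edge_rhombus_def exit_edge_eq split: if_splits)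
  have entry: "z + edge_shift n \<in> entry_cone n" if "z \<in> edge_rhombus n" "0 \<le> k z" for z
  proof (cases "k z = 0")
    case True
    then show ?thesis
      using seam[OF that(1)] exit_edge_shift_iff entry_edge_subset_cone by blast
  next
    case False
    then show ?thesis
      using that exit edge_rhombus_iff by fastforce
  qed
  have "continuous_on (edge_rhombus n) (\<lambda>z. if k z \<le> 0 then surface_point z else surface_point (z + edge_shift n))"
  proof (rule continuous_on_cases_le)
    show "continuous_on {t \<in> edge_rhombus n. k t \<le> 0} surface_point"
      by (rule continuous_on_subset[OF continuous_on_surface_point])
        (use exit cones_subset_square in blast)
    have "continuous_on {t \<in> edge_rhombus n. 0 \<le> k t} (surface_point \<circ> (\<lambda>t. t + edge_shift n))"
      by (rule continuous_on_compose, intro continuous_intros,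
          rule continuous_on_subset[OF continuous_on_surface_point])
        (use entry cones_subset_square in blast)
    then show "continuous_on {t \<in> edge_rhombus n. 0 \<le> k t} (\<lambda>t. surface_point (t + edge_shift n))"
      by (simp add: o_def)
    show "surface_point t = surface_point (t + edge_shift n)" if "t \<in> edge_rhombus n" "k t = 0" for t
      using surface_point_glue seam that by metis
  qed (rule cont)
  then show ?thesis
    using exit by (simp add: edge_chart_def cong: continuous_on_cong)
qed

lemma rep_exit_cone: "z \<in> exit_cone n \<Longrightarrow> rep (surface_point z) = (if z \<in> exit_edge n then z + edge_shift n else z)"
  using exit_cone_cases[of z n] canon_exit[of z n] canon_interior[of z] rep_surface_point[of z]
    subsetD[OF cones_subset_square(1), of z n] by simp argo

lemma rep_entry_cone: "z \<in> entry_cone n \<Longrightarrow> rep (surface_point z) = z"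
  using entry_cone_cases[of z n] canon_entry[of z n] canon_interior[of z] rep_surface_point[of z]
    subsetD[OF cones_subset_square(2), of z n] by auto

lemma edge_coord_exit: "z \<in> exit_cone n \<Longrightarrow> edge_coord n (surface_point z) = z"
  using exit_edge_shift_iff[of z n] entry_edge_subset_cone exit_cone_entry_cone_disjoint
  by (auto simp: edge_coord_def rep_exit_cone)

lemma edge_coord_entry: "z \<in> entry_cone n \<Longrightarrow> edge_coord n (surface_point z) = z - edge_shift n"
  by (simp add: edge_coord_def rep_entry_cone)

lemma edge_chart_shift:
  assumes "z \<in> entry_cone n"
  shows "edge_chart n (z - edge_shift n) = surface_point z"
proof (cases "z - edge_shift n \<in> exit_cone n")
  case True
  then have "z - edge_shift n \<in> exit_edge n"
    using assms by (cases z) (auto simp: exit_cone_def entry_cone_def exit_edge_eq edge_shift_eq split: if_splits)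
  then show ?thesis
    using surface_point_glue[of "z - edge_shift n" n] True by (simp add: edge_chart_def)
qed (simp add: edge_chart_def)

lemma edge_chart_coord: "s \<in> edge_nbhd n \<Longrightarrow> edge_chart n (edge_coord n s) = s"
  by (auto simp: edge_nbhd_def edge_coord_exit edge_coord_entry edge_chart_shift) (simp add: edge_chart_def)

lemma edge_coord_in_rhombus: "s \<in> edge_nbhd n \<Longrightarrow> edge_coord n s \<in> edge_rhombus n"
  by (auto simp: edge_nbhd_def edge_coord_exit edge_coord_entry edge_rhombus_iff)

lemma continuous_on_edge_coord: "continuous_on (edge_nbhd n) (edge_coord n)"
  unfolding continuous_on_open_vimage[OF open_edge_nbhd]
proof (intro allI impI)
  fix B :: "(real \<times> real) set" assume B: "open B"
  have "z \<in> square \<and> surface_point z \<in> edge_coord n -` B \<inter> edge_nbhd n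
      \<longleftrightarrow> z \<in> (exit_cone n \<inter> B) \<union> (entry_cone n \<inter> (\<lambda>z. z - edge_shift n) -` B)" for z
  proof (cases "z \<in> exit_cone n")
    case True
    then have "z \<in> square" "z \<notin> entry_cone n"
      using cones_subset_square(1) exit_cone_entry_cone_disjoint by (metis subsetD)+
    with True show ?thesis
      by (simp add: in_edge_nbhd_iff edge_coord_exit)
  next
    case no_exit: False
    show ?thesis
    proof (cases "z \<in> entry_cone n")
      case True
      then have "z \<in> square"
        using cones_subset_square(2) by (metis subsetD)
      with True no_exit show ?thesis
        by (simp add: in_edge_nbhd_iff edge_coord_entry)
    next
      case False
      with no_exit show ?thesis
        using in_edge_nbhd_iff[of z n] by simp
    qed
  qed
  then have "{z \<in> square. surface_point z \<in> edge_coord n -` B \<inter> edge_nbhd n}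
      = (exit_cone n \<inter> B) \<union> (entry_cone n \<inter> (\<lambda>z. z - edge_shift n) -` B)"
    unfolding set_eq_iff mem_Collect_eq by (rule allI)
  moreover have "open ((\<lambda>z. z - edge_shift n) -` B)"
    using B by (intro open_vimage continuous_intros)
  ultimately show "open (edge_coord n -` B \<inter> edge_nbhd n)"
    using B openin_cones[of n] by (simp add: open_chamanara_def openin_Un openin_Int_open)
qed

section \<open>Tethered plane paths\<close>

lemma path_surface_point: "path q \<Longrightarrow> path_image q \<subseteq> square \<Longrightarrow> path (surface_point \<circ> q)"
  using continuous_on_surface_point by (intro path_continuous_image) (auto intro: continuous_on_subset)

lemma path_class_convex_image_eq:
  fixes S :: "'b::real_normed_vector set" and f :: "'b \<Rightarrow> 'a::topological_space"
  assumes "convex S" "continuous_on S f" "path p" "path q" "path_image p \<subseteq> S" "path_image q \<subseteq> S"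
    "pathstart p = pathstart q" "pathfinish p = pathfinish q"
  shows "path_class (f \<circ> p) = path_class (f \<circ> q)"
proof (rule path_class_eqI, rule homotopic_paths_continuous_image[OF _ assms(2)])
  show "homotopic_paths S p q"
  proof (rule homotopic_paths_linear)
    fix t :: real assume "t \<in> {0..1}"
    then have "p t \<in> S" "q t \<in> S"
      using assms(5,6) unfolding path_image_def by blast+
    then show "closed_segment (p t) (q t) \<subseteq> S"
      using assms(1) by (rule closed_segment_subset)
  qed (use assms in simp_all)
qed auto

lemma path_class_surface_point_eq:
  assumes "convex S" "S \<subseteq> square" "path p" "path q" "path_image p \<subseteq> S" "path_image q \<subseteq> S"
    "pathstart p = pathstart q" "pathfinish p = pathfinish q"
  shows "path_class (surface_point \<circ> p) = path_class (surface_point \<circ> q)"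
  using assms continuous_on_subset[OF continuous_on_surface_point assms(2)]
  by (intro path_class_convex_image_eq)

abbreviation ray :: "real \<times> real \<Rightarrow> real \<times> real \<Rightarrow> real \<Rightarrow> chamanara" where
  "ray s z \<equiv> surface_point \<circ> linepath s z"

lemma ray_image:
  assumes "s \<in> square_interior" "z \<in> square"
  shows "path_image (linepath s z) \<subseteq> square"
proof -
  have "convex (square_interior \<union> {z})"
    using assms by (intro convex_edge_extension) auto
  then have "closed_segment s z \<subseteq> square_interior \<union> {z}"
    using assms by (intro closed_segment_subset) auto
  then show ?thesis
    using assms in_square by auto
qed

lemma path_ray: "s \<in> square_interior \<Longrightarrow> z \<in> square \<Longrightarrow> path (ray s z)"
  by (intro path_surface_point ray_image) auto

lemma ray_ends: "pathstart (ray s z) = surface_point s" "pathfinish (ray s z) = surface_point z"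
  by (simp_all add: pathstart_compose pathfinish_compose)

lemma reversepath_ray: "reversepath (ray s z) = surface_point \<circ> linepath z s"
  by (metis path_compose_reversepath reversepath_linepath)

text \<open>The planar representatives matter: passing between the two representatives of a point on an
  edge multiplies the class by a generator.\<close>

definition ray_class :: "real \<times> real \<Rightarrow> real \<times> real \<Rightarrow> (real \<Rightarrow> chamanara) \<Rightarrow> real \<times> real \<Rightarrow> (real \<Rightarrow> chamanara) set" where
  "ray_class s x p y = tethered (ray s x) p (ray s y)"

lemma ray_class_mult:
  assumes "s \<in> square_interior" "x \<in> square" "y \<in> square" "z \<in> square" "path p" "path q"
    "pathstart p = surface_point x" "pathfinish p = surface_point y"
    "pathstart q = surface_point y" "pathfinish q = surface_point z"
  shows "ray_class s x p y \<otimes>\<^bsub>Pi1 s\<^esub> ray_class s y q z = ray_class s x (p +++ q) z"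
  unfolding ray_class_def using assms by (intro tethered_mult) (auto simp: path_ray ray_ends)

lemma ray_class_cong:
  assumes "path_class p = path_class q" "s \<in> square_interior" "x \<in> square" "y \<in> square" "path p"
    "pathstart p = surface_point x" "pathfinish p = surface_point y"
  shows "ray_class s x p y = ray_class s x q y"
  unfolding ray_class_def using assms by (intro tethered_cong) (auto simp: path_ray ray_ends)

lemma ray_class_reverse:
  assumes "s \<in> square_interior" "x \<in> square" "y \<in> square" "path p"
    "pathstart p = surface_point x" "pathfinish p = surface_point y"
  shows "ray_class s y (reversepath p) x = inv\<^bsub>Pi1 s\<^esub> ray_class s x p y"
  unfolding ray_class_def using assms by (intro tethered_reverse) (auto simp: path_ray ray_ends)

lemma ray_class_closed:
  assumes "s \<in> square_interior" "x \<in> square" "y \<in> square" "path p"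
    "pathstart p = surface_point x" "pathfinish p = surface_point y"
  shows "ray_class s x p y \<in> carrier (Pi1 s)"
  unfolding ray_class_def tethered_def using assms
  by (intro path_class_in_fundamental_group) (auto simp: path_ray ray_ends)

text \<open>Both rays and the path stay in one convex planar set, where the loop contracts linearly.
  Convex pieces of the square thus contribute nothing to the fundamental group.\<close>

lemma ray_class_plane:
  assumes "convex S" "S \<subseteq> square" "s \<in> S" "path q" "path_image q \<subseteq> S"
    "pathstart q = x" "pathfinish q = y"
  shows "ray_class s x (surface_point \<circ> q) y = \<one>\<^bsub>Pi1 s\<^esub>"
proof -
  have xy: "x \<in> S" "y \<in> S"
    using assms pathstart_in_path_image pathfinish_in_path_image by blast+
  have "ray_class s x (surface_point \<circ> q) y
      = path_class (surface_point \<circ> (linepath s x +++ (q +++ linepath y s)))"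
    by (simp add: ray_class_def tethered_def reversepath_ray path_compose_join)
  also have "\<dots> = path_class (surface_point \<circ> linepath s s)"
  proof (rule path_class_surface_point_eq[OF assms(1,2)])
    have "closed_segment s x \<subseteq> S" "closed_segment y s \<subseteq> S"
      using assms xy by (intro closed_segment_subset; simp)+
    then show "path_image (linepath s x +++ (q +++ linepath y s)) \<subseteq> S"
      using assms by (simp add: path_image_join)
  qed (use assms in auto)
  also have "\<dots> = \<one>\<^bsub>Pi1 s\<^esub>"
    by (simp add: one_fundamental_group o_def)
  finally show ?thesis .
qed

lemma ray_class_segment:
  assumes "convex S" "S \<subseteq> square" "s \<in> S" "x \<in> S" "y \<in> S"
  shows "ray_class s x (surface_point \<circ> linepath x y) y = \<one>\<^bsub>Pi1 s\<^esub>"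
  using assms closed_segment_subset[of x S y] by (intro ray_class_plane[of S]) simp_all

lemma exit_midpoint_square: "exit_midpoint n \<in> square" "exit_midpoint n + edge_shift n \<in> square"
  using exit_midpoint_in_exit_edge[of n] in_square(2) in_square(3) exit_edge_shift_iff by blast+

text \<open>A generator is a constant path at an edge point, tethered on one side through the exit
  representative and on the other through the entry representative. All generators found below arise
  in this way.\<close>

lemma gamma_eq_ray_class:
  assumes "s \<in> square_interior"
  shows "gamma s n = ray_class s (exit_midpoint n) (\<lambda>_. surface_point (exit_midpoint n)) (exit_midpoint n + edge_shift n)"
proof -
  let ?m = "exit_midpoint n" and ?m' = "exit_midpoint n + edge_shift n"
  have glue: "surface_point ?m' = surface_point ?m"
    by (rule surface_point_glue[OF exit_midpoint_in_exit_edge])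
  have p: "path (surface_point \<circ> linepath s ?m)"
    by (rule path_ray[OF assms exit_midpoint_square(1)])
  have "path (reversepath (ray s ?m'))"
    by (simp only: path_reversepath) (rule path_ray[OF assms exit_midpoint_square(2)])
  then have q: "path (surface_point \<circ> linepath ?m' s)"
    by (simp only: reversepath_ray)
  have l: "path_class ((\<lambda>_. surface_point ?m) +++ (surface_point \<circ> linepath ?m' s)) = path_class (surface_point \<circ> linepath ?m' s)"
    by (rule path_class_lid[OF q]) (simp only: pathstart_compose pathstart_linepath glue)
  show ?thesis
    unfolding gamma_def ray_class_def tethered_def reversepath_ray
    by (rule path_class_join_cong[OF refl l[symmetric] p q])
      (simp only: pathstart_compose pathfinish_compose pathstart_linepath pathfinish_linepath glue)
qed

lemma gamma_closed:
  assumes "s \<in> square_interior"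
  shows "gamma s n \<in> carrier (Pi1 s)"
  unfolding gamma_eq_ray_class[OF assms]
  by (rule ray_class_closed[OF assms exit_midpoint_square path_constant])
    (simp_all only: pathstart_const pathfinish_const surface_point_glue[OF exit_midpoint_in_exit_edge])

text \<open>Changing the planar representative of the end point amounts to appending a constant path
  there, whose tethered class is the correction; at the midpoint of an edge this is a generator or
  its inverse.\<close>

lemma ray_class_change_end:
  assumes "s \<in> square_interior" "x \<in> square" "y \<in> square" "y' \<in> square" "path p"
    "pathstart p = surface_point x" "pathfinish p = surface_point y" "surface_point y' = surface_point y"
  shows "ray_class s x p y' = ray_class s x p y \<otimes>\<^bsub>Pi1 s\<^esub> ray_class s y (\<lambda>_. surface_point y) y'"
proof -
  have "ray_class s x p y \<otimes>\<^bsub>Pi1 s\<^esub> ray_class s y (\<lambda>_. surface_point y) y'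
      = ray_class s x (p +++ (\<lambda>_. surface_point y)) y'"
    using assms by (intro ray_class_mult) (simp_all add: path_constant pathstart_const pathfinish_const)
  also have "\<dots> = ray_class s x p y'"
    using assms by (intro ray_class_cong path_class_rid)
      (simp_all add: path_constant pathstart_const pathfinish_const)
  finally show ?thesis by simp
qed

lemma ray_class_change_start:
  assumes "s \<in> square_interior" "x \<in> square" "x' \<in> square" "y \<in> square" "path p"
    "pathstart p = surface_point x" "pathfinish p = surface_point y" "surface_point x' = surface_point x"
  shows "ray_class s x' p y = ray_class s x' (\<lambda>_. surface_point x') x \<otimes>\<^bsub>Pi1 s\<^esub> ray_class s x p y"
proof -
  have "ray_class s x' (\<lambda>_. surface_point x') x \<otimes>\<^bsub>Pi1 s\<^esub> ray_class s x p y
      = ray_class s x' ((\<lambda>_. surface_point x') +++ p) y"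
    using assms by (intro ray_class_mult) (simp_all add: path_constant pathstart_const pathfinish_const)
  also have "\<dots> = ray_class s x' p y"
    using assms by (intro ray_class_cong path_class_lid)
      (simp_all add: path_constant pathstart_const pathfinish_const)
  finally show ?thesis by simp
qed

lemma ray_class_base:
  assumes "s \<in> square_interior" "path p" "pathstart p = surface_point s" "pathfinish p = surface_point s"
  shows "ray_class s s p s = path_class p"
proof -
  have ray: "ray s s = (\<lambda>_. surface_point s)"
    by (simp add: o_def)
  have rev: "reversepath (\<lambda>_. surface_point s) = (\<lambda>_. surface_point s)"
    by (simp add: reversepath_def)
  have "path_class (p +++ (\<lambda>_. surface_point s)) = path_class p"
    using assms path_class_rid[of p "surface_point s"] by simp
  moreover have "path_class ((\<lambda>_. surface_point s) +++ (p +++ (\<lambda>_. surface_point s)))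
      = path_class (p +++ (\<lambda>_. surface_point s))"
    using assms by (intro path_class_lid) (simp_all add: path_constant pathstart_const)
  ultimately show ?thesis
    by (simp add: ray_class_def tethered_def ray rev)
qed

section \<open>Generators of the fundamental group\<close>

lemma exit_cone_eq_rhombus_halfplane:
  "exit_cone n = edge_rhombus n \<inter> {z. (if n > 0 then (1, 0) else (0, - 1)) \<bullet> z \<le> (if n > 0 then 1 else 0)}"
  by (auto simp: exit_cone_def edge_rhombus_def inner_prod_def split: if_splits)

lemma entry_cone_eq_rhombus_halfplane:
  "{z. z + edge_shift n \<in> entry_cone n}
     = edge_rhombus n \<inter> {z. (if n > 0 then (1, 0) else (0, - 1)) \<bullet> z \<ge> (if n > 0 then 1 else 0)}"
  by (auto simp: entry_cone_def edge_rhombus_def inner_prod_def edge_shift_eq split: if_splits)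

lemma convex_exit_cone: "convex (exit_cone n)"
  unfolding exit_cone_eq_rhombus_halfplane
  by (intro convex_Int convex_edge_rhombus convex_halfspace_le)

lemma convex_shifted_entry_cone: "convex {z. z + edge_shift n \<in> entry_cone n}"
  unfolding entry_cone_eq_rhombus_halfplane
  by (intro convex_Int convex_edge_rhombus convex_halfspace_ge)

lemma exit_midpoint_in_cones:
  "exit_midpoint n \<in> exit_cone n" "exit_midpoint n + edge_shift n \<in> entry_cone n"
  using exit_midpoint_in_exit_edge[of n] exit_edge_subset_cone[of n] entry_edge_subset_cone[of n]
    exit_edge_shift_iff[of "exit_midpoint n" n] by blast+

lemma cone_subset_extension:
  "exit_cone n \<subseteq> square_interior \<union> exit_edge n" "entry_cone n \<subseteq> square_interior \<union> entry_edge n"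
  using exit_cone_cases[of _ n] entry_cone_cases[of _ n] by blast+

text \<open>The segment stays in one of the two triangles. On the exit side everything lies in a
  convex planar piece and the class is trivial. On the entry side, to which points of the edge are
  assigned by \<open>rep\<close>, the segment reaches the entry representative of the midpoint, and
  the switch to the exit representative costs \<open>inv (gamma s n)\<close>.\<close>

lemma edge_chart_half_segment:
  assumes s: "s \<in> square_interior" and x0: "x0 \<in> edge_rhombus n"
  defines "q \<equiv> edge_chart n \<circ> linepath x0 (exit_midpoint n)"
  shows "ray_class s (rep (edge_chart n x0)) q (exit_midpoint n) \<in> generate (Pi1 s) (range (gamma s))"
proof -
  interpret G: group "Pi1 s" by (rule group_fundamental_group)
  let ?m = "exit_midpoint n" and ?m' = "exit_midpoint n + edge_shift n"
  have sub: "s \<in> square_interior \<union> exit_edge n" "s \<in> square_interior \<union> entry_edge n"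
    using s by auto
  show ?thesis
  proof (cases "x0 + edge_shift n \<in> entry_cone n")
    case True
    let ?x = "x0 + edge_shift n"
    have chart: "edge_chart n z = surface_point (z + edge_shift n)" if "z + edge_shift n \<in> entry_cone n" for z
      using edge_chart_shift[OF that] by simp
    have seg: "closed_segment x0 ?m \<subseteq> {z. z + edge_shift n \<in> entry_cone n}"
      using True exit_midpoint_in_cones(2)[of n]
      by (intro closed_segment_subset convex_shifted_entry_cone) auto
    have q: "q t = (surface_point \<circ> linepath ?x ?m') t" if "t \<in> {0..1}" for t
    proof -
      have "linepath x0 ?m t \<in> closed_segment x0 ?m"
        using that by (simp add: linepath_in_path)
      then have "q t = surface_point (linepath x0 ?m t + edge_shift n)"
        unfolding q_def o_def using seg by (intro chart) auto
      also have "linepath x0 ?m t + edge_shift n = linepath ?x ?m' t"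
        by (simp add: linepath_def algebra_simps)
      finally show ?thesis by simp
    qed
    have x: "?x \<in> square" and rep: "rep (edge_chart n x0) = ?x"
      using True cones_subset_square(2)[of n] by (auto simp: chart rep_entry_cone)
    have ends: "?x \<in> square_interior \<union> entry_edge n" "?m' \<in> square_interior \<union> entry_edge n"
      using True exit_midpoint_in_cones(2)[of n] cone_subset_extension(2)[of n] by blast+
    have path: "path (surface_point \<circ> linepath ?x ?m')"
      using closed_segment_subset[OF ends convex_interior_entry] interior_edge_subset_square(3)[of n]
      by (intro path_surface_point) auto
    have glue: "surface_point ?m = surface_point ?m'"
      using surface_point_glue[OF exit_midpoint_in_exit_edge, of n] by simp
    have "path q"
      using path q path_eq by metis
    have pc: "path_class (surface_point \<circ> linepath ?x ?m') = path_class q"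
      using path q by (intro path_class_cong) simp_all
    have "ray_class s ?x q ?m = ray_class s ?x (surface_point \<circ> linepath ?x ?m') ?m"
      using path x exit_midpoint_square[of n] glue
      by (intro ray_class_cong[OF pc s, symmetric]) (simp_all add: pathstart_compose pathfinish_compose)
    also have "\<dots> = ray_class s ?x (surface_point \<circ> linepath ?x ?m') ?m' \<otimes>\<^bsub>Pi1 s\<^esub> ray_class s ?m' (\<lambda>_. surface_point ?m') ?m"
      using path x exit_midpoint_square[of n] glue
      by (intro ray_class_change_end[OF s]) (simp_all add: pathstart_compose pathfinish_compose)
    also have "ray_class s ?x (surface_point \<circ> linepath ?x ?m') ?m' = \<one>\<^bsub>Pi1 s\<^esub>"
      using sub ends by (intro ray_class_segment[OF convex_interior_entry interior_edge_subset_square(3)])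
    also have "ray_class s ?m' (\<lambda>_. surface_point ?m') ?m = inv\<^bsub>Pi1 s\<^esub> gamma s n"
      using ray_class_reverse[OF s exit_midpoint_square[of n] path_constant, of "surface_point ?m"] glue
      by (simp add: gamma_eq_ray_class[OF s] pathstart_const pathfinish_const reversepath_def)
    finally have "ray_class s ?x q ?m = inv\<^bsub>Pi1 s\<^esub> gamma s n"
      using gamma_closed[OF s, of n] by simp
    then show ?thesis
      unfolding rep by (simp add: generate.inv)
  next
    case False
    then have x: "x0 \<in> exit_cone n"
      using x0 edge_rhombus_iff by blast
    have not_edge: "x0 \<notin> exit_edge n"
      using False exit_edge_shift_iff[of x0 n] entry_edge_subset_cone[of n] by blast
    have seg: "closed_segment x0 ?m \<subseteq> exit_cone n"
      using x exit_midpoint_in_cones(1)[of n] by (intro closed_segment_subset convex_exit_cone)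
    have q: "q t = (surface_point \<circ> linepath x0 ?m) t" if "t \<in> {0..1}" for t
    proof -
      have "linepath x0 ?m t \<in> exit_cone n"
        using that seg linepath_in_path by blast
      then show ?thesis
        by (simp add: q_def edge_chart_def)
    qed
    have rep: "rep (edge_chart n x0) = x0"
      using x not_edge by (simp add: edge_chart_def rep_exit_cone)
    have ends: "x0 \<in> square_interior \<union> exit_edge n" "?m \<in> square_interior \<union> exit_edge n"
      using x exit_midpoint_in_cones(1)[of n] cone_subset_extension(1)[of n] by blast+
    have path: "path (surface_point \<circ> linepath x0 ?m)"
      using closed_segment_subset[OF ends convex_interior_exit] interior_edge_subset_square(2)[of n]
      by (intro path_surface_point) auto
    have pc: "path_class (surface_point \<circ> linepath x0 ?m) = path_class q"
      using path q by (intro path_class_cong) simp_all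
    have "ray_class s x0 q ?m = ray_class s x0 (surface_point \<circ> linepath x0 ?m) ?m"
      using path ends interior_edge_subset_square(2)[of n]
      by (intro ray_class_cong[OF pc s, symmetric]) (auto simp: pathstart_compose pathfinish_compose)
    also have "\<dots> = \<one>\<^bsub>Pi1 s\<^esub>"
      using sub ends by (intro ray_class_segment[OF convex_interior_exit interior_edge_subset_square(2)])
    finally show ?thesis
      unfolding rep by (simp add: generate.one)
  qed
qed

lemma rep_in_square: "rep x \<in> square"
  unfolding rep_def by (intro canon_square rep_chamanara_square)

lemma surface_point_rep_canon: "surface_point (rep x) = x"
proof -
  have "canon (canon z) = canon z" if "z \<in> square" for z
    using that
  proof (cases rule: square_cases)
    case (2 n)
    then show ?thesis
      using exit_edge_shift_iff[of z n] canon_entry[of "z + edge_shift n" n] by (simp add: canon_exit)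
  qed (simp_all add: canon_interior canon_entry)
  then have "surface_point (rep x) = surface_point (rep_chamanara x)"
    using rep_in_square[of x] rep_chamanara_square by (simp add: surface_point_eq_iff rep_def)
  then show ?thesis
    by (simp add: surface_point_rep)
qed

text \<open>In the chart the path runs in a convex rhombus, so it may be replaced by the broken line
  through the midpoint of the edge; each half has already been computed.\<close>

lemma ray_class_edge_nbhd:
  assumes s: "s \<in> square_interior" and p: "path p" "path_image p \<subseteq> edge_nbhd n"
  shows "ray_class s (rep (pathstart p)) p (rep (pathfinish p)) \<in> generate (Pi1 s) (range (gamma s))"
proof -
  interpret G: group "Pi1 s" by (rule group_fundamental_group)
  let ?m = "exit_midpoint n" and ?c = "edge_chart n"
  define x where "x = edge_coord n (pathstart p)"
  define y where "y = edge_coord n (pathfinish p)"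
  have ends: "pathstart p \<in> edge_nbhd n" "pathfinish p \<in> edge_nbhd n"
    using p(2) pathstart_in_path_image pathfinish_in_path_image by blast+
  have xy: "x \<in> edge_rhombus n" "y \<in> edge_rhombus n" "?c x = pathstart p" "?c y = pathfinish p"
    using ends by (simp_all add: x_def y_def edge_coord_in_rhombus edge_chart_coord)
  have m: "?m \<in> edge_rhombus n" "?c ?m = surface_point ?m"
    using exit_midpoint_in_cones(1)[of n] by (simp_all add: edge_rhombus_iff edge_chart_def)
  have seg: "closed_segment u v \<subseteq> edge_rhombus n" if "u \<in> edge_rhombus n" "v \<in> edge_rhombus n" for u v
    using that by (intro closed_segment_subset convex_edge_rhombus)
  have path: "path (?c \<circ> linepath u v)" if "u \<in> edge_rhombus n" "v \<in> edge_rhombus n" for u v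
    using seg[OF that] continuous_on_subset[OF continuous_on_edge_chart, of "closed_segment u v" n]
    by (intro path_continuous_image) auto
  have coord: "path (edge_coord n \<circ> p)"
    using p continuous_on_subset[OF continuous_on_edge_coord p(2)] by (intro path_continuous_image)
  have "path_class p = path_class (?c \<circ> (edge_coord n \<circ> p))"
  proof (rule path_class_cong[OF p(1)])
    fix t :: real assume "t \<in> {0..1}"
    then have "p t \<in> edge_nbhd n"
      using p(2) by (auto simp: path_image_def)
    then show "p t = (?c \<circ> (edge_coord n \<circ> p)) t"
      by (simp add: edge_chart_coord)
  qed
  also have "\<dots> = path_class (?c \<circ> (linepath x ?m +++ linepath ?m y))"
  proof (rule path_class_convex_image_eq[OF convex_edge_rhombus continuous_on_edge_chart coord])
    show "path_image (edge_coord n \<circ> p) \<subseteq> edge_rhombus n"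
      using p(2) edge_coord_in_rhombus by (auto simp: path_image_def)
    show "path_image (linepath x ?m +++ linepath ?m y) \<subseteq> edge_rhombus n"
      using seg xy m by (simp add: path_image_join)
  qed (simp_all add: x_def y_def pathstart_compose pathfinish_compose)
  also have "\<dots> = path_class ((?c \<circ> linepath x ?m) +++ (?c \<circ> linepath ?m y))"
    by (simp add: path_compose_join)
  finally have pc: "path_class p = path_class ((?c \<circ> linepath x ?m) +++ (?c \<circ> linepath ?m y))" .
  have "ray_class s (rep (pathstart p)) p (rep (pathfinish p))
      = ray_class s (rep (pathstart p)) ((?c \<circ> linepath x ?m) +++ (?c \<circ> linepath ?m y)) (rep (pathfinish p))"
    using p by (intro ray_class_cong[OF pc s]) (simp_all add: rep_in_square surface_point_rep_canon)
  also have "\<dots> = ray_class s (rep (pathstart p)) (?c \<circ> linepath x ?m) ?m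
      \<otimes>\<^bsub>Pi1 s\<^esub> ray_class s ?m (?c \<circ> linepath ?m y) (rep (pathfinish p))"
    using path xy m by (intro ray_class_mult[symmetric] s)
      (simp_all add: rep_in_square surface_point_rep_canon exit_midpoint_square pathstart_compose pathfinish_compose)
  also have "ray_class s ?m (?c \<circ> linepath ?m y) (rep (pathfinish p))
      = inv\<^bsub>Pi1 s\<^esub> ray_class s (rep (pathfinish p)) (?c \<circ> linepath y ?m) ?m"
  proof -
    have rv: "?c \<circ> linepath ?m y = reversepath (?c \<circ> linepath y ?m)"
      by (metis path_compose_reversepath reversepath_linepath)
    show ?thesis
      unfolding rv using path xy m by (intro ray_class_reverse s)
        (simp_all add: rep_in_square surface_point_rep_canon exit_midpoint_square pathstart_compose pathfinish_compose)
  qed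
  finally show ?thesis
    using edge_chart_half_segment[OF s xy(1)] edge_chart_half_segment[OF s xy(2)] xy(3,4)
      G.generate_m_inv_closed[of "range (gamma s)"] gamma_closed[OF s]
    by (simp add: generate.eng image_subset_iff o_def)
qed

lemma continuous_on_rep_interior: "continuous_on (surface_point ` square_interior) rep"
  unfolding continuous_on_open_vimage[OF open_surface_point_interior[OF open_square_interior subset_refl]]
proof (intro allI impI)
  fix B :: "(real \<times> real) set" assume "open B"
  have "rep -` B \<inter> surface_point ` square_interior = surface_point ` (square_interior \<inter> B)"
    using in_square(1) by (auto simp: rep_surface_point canon_interior)
  then show "open (rep -` B \<inter> surface_point ` square_interior)"
    using \<open>open B\<close> by (auto intro!: open_surface_point_interior open_Int open_square_interior)
qed

lemma ray_class_interior:
  assumes s: "s \<in> square_interior" and p: "path p" "path_image p \<subseteq> surface_point ` square_interior"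
  shows "ray_class s (rep (pathstart p)) p (rep (pathfinish p)) = \<one>\<^bsub>Pi1 s\<^esub>"
proof -
  have "path (rep \<circ> p)"
    using p continuous_on_subset[OF continuous_on_rep_interior p(2)] by (intro path_continuous_image)
  moreover have "rep (surface_point z) = z" if "z \<in> square_interior" for z
    using that by (simp add: rep_surface_point in_square(1) canon_interior)
  then have "path_image (rep \<circ> p) \<subseteq> square_interior"
    using p(2) unfolding path_image_compose by fastforce
  moreover have "surface_point \<circ> (rep \<circ> p) = p"
    by (simp add: fun_eq_iff surface_point_rep_canon)
  ultimately show ?thesis
    using ray_class_plane[OF convex_square_interior interior_edge_subset_square(1) s, of "rep \<circ> p"]
    by (simp add: pathstart_compose pathfinish_compose)
qed

text \<open>Short pieces of a loop lie in the interior or near a single edge, where their tethered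
  classes are known products of generators; bisection multiplies the pieces together.\<close>

theorem gammas_generate:
  assumes s: "s \<in> square_interior" and A: "A \<in> carrier (Pi1 s)"
  shows "A \<in> generate (Pi1 s) (range (gamma s))"
proof -
  interpret G: group "Pi1 s" by (rule group_fundamental_group)
  obtain p where p: "path p" "pathstart p = surface_point s" "pathfinish p = surface_point s" "A = path_class p"
    using A by (rule fundamental_groupE)
  have good: "\<exists>M. open M \<and> x \<in> M \<and> (\<forall>q. path q \<longrightarrow> path_image q \<subseteq> M \<longrightarrow>
      ray_class s (rep (pathstart q)) q (rep (pathfinish q)) \<in> generate (Pi1 s) (range (gamma s)))" for x
  proof -
    obtain z where z: "z \<in> square" "x = surface_point z"
      by (rule surface_pointE)
    have nbhd: "surface_point w \<in> edge_nbhd n" if "w \<in> exit_cone n \<union> entry_cone n" for w n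
      using that by (simp add: edge_nbhd_def)
    have "x \<in> surface_point ` square_interior \<or> (\<exists>n. x \<in> edge_nbhd n)"
      using z(1)
    proof (cases rule: square_cases)
      case (2 n)
      then show ?thesis using nbhd[of z n] exit_edge_subset_cone z by blast
    next
      case (3 n)
      then show ?thesis using nbhd[of z n] entry_edge_subset_cone z by blast
    qed (use z in simp)
    then show ?thesis
    proof
      assume "x \<in> surface_point ` square_interior"
      then show ?thesis
        using ray_class_interior[OF s] open_surface_point_interior[OF open_square_interior subset_refl]
        by (intro exI[of _ "surface_point ` square_interior"]) (simp add: generate.one)
    next
      assume "\<exists>n. x \<in> edge_nbhd n"
      then show ?thesis
        using ray_class_edge_nbhd[OF s] open_edge_nbhd by blast
    qed
  qed
  \<comment> \<open>All division points are read through the one section \<open>rep\<close>, so the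
    classes of adjacent pieces multiply without any correction where they meet.\<close>
  define P where "P a b \<longleftrightarrow> (0 \<le> a \<longrightarrow> b \<le> 1 \<longrightarrow> a \<le> b \<longrightarrow>
      ray_class s (rep (p a)) (p \<circ> linepath a b) (rep (p b)) \<in> generate (Pi1 s) (range (gamma s)))" for a b
  have sub: "path (p \<circ> linepath a b)" "pathstart (p \<circ> linepath a b) = p a" "pathfinish (p \<circ> linepath a b) = p b"
    if "0 \<le> a" "b \<le> 1" "a \<le> b" for a b
    using path_subpath_compose[OF p(1), of a b] that by (simp_all add: pathstart_compose pathfinish_compose)
  have "P 0 1"
  proof (rule Bolzano)
    fix a b c assume H: "P a b" "P b c" "a \<le> b" "b \<le> c"
    show "P a c"
      unfolding P_def
    proof (intro impI)
      assume ac: "0 \<le> a" "c \<le> 1" "a \<le> c"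
      then have b: "0 \<le> b" "b \<le> 1" using H by auto
      have "ray_class s (rep (p a)) (p \<circ> linepath a c) (rep (p c))
          = ray_class s (rep (p a)) ((p \<circ> linepath a b) +++ (p \<circ> linepath b c)) (rep (p c))"
        using path_class_subpath_join[OF p(1), of a b c] ac b H sub[of a c]
        by (intro ray_class_cong s) (simp_all add: rep_in_square surface_point_rep_canon)
      also have "\<dots> = ray_class s (rep (p a)) (p \<circ> linepath a b) (rep (p b))
          \<otimes>\<^bsub>Pi1 s\<^esub> ray_class s (rep (p b)) (p \<circ> linepath b c) (rep (p c))"
        using ac b H sub[of a b] sub[of b c]
        by (intro ray_class_mult[symmetric] s) (simp_all add: rep_in_square surface_point_rep_canon)
      finally show "ray_class s (rep (p a)) (p \<circ> linepath a c) (rep (p c)) \<in> generate (Pi1 s) (range (gamma s))"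
        using H ac b by (simp add: P_def generate.eng)
    qed
  next
    fix t :: real assume t: "0 \<le> t" "t \<le> 1"
    obtain M where M: "open M" "p t \<in> M"
      "\<And>q. path q \<Longrightarrow> path_image q \<subseteq> M \<Longrightarrow>
        ray_class s (rep (pathstart q)) q (rep (pathfinish q)) \<in> generate (Pi1 s) (range (gamma s))"
      using good[of "p t"] by metis
    have "continuous_on {0..1} p"
      using p(1) by (simp add: path_def)
    then obtain B where B: "open B" "B \<inter> {0..1} = p -` M \<inter> {0..1}"
      using M(1) unfolding continuous_on_open_invariant by blast
    then have "t \<in> B" using M t by auto
    then obtain e where e: "e > 0" "ball t e \<subseteq> B"
      using B(1) open_contains_ball by blast
    show "\<exists>d>0. \<forall>a b. a \<le> t \<and> t \<le> b \<and> b - a < d \<longrightarrow> P a b"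
    proof (intro exI[of _ e] conjI allI impI e)
      fix a b assume ab: "a \<le> t \<and> t \<le> b \<and> b - a < e"
      show "P a b"
        unfolding P_def
      proof (intro impI)
        assume H: "0 \<le> a" "b \<le> 1" "a \<le> b"
        have "{a..b} \<subseteq> ball t e"
          using ab by (auto simp: dist_real_def)
        then have "{a..b} \<subseteq> B \<inter> {0..1}"
          using e H by auto
        then have "p ` {a..b} \<subseteq> M"
          using B(2) by auto
        then have "path_image (p \<circ> linepath a b) \<subseteq> M"
          using H by (simp add: path_image_compose closed_segment_eq_real_ivl)
        then show "ray_class s (rep (p a)) (p \<circ> linepath a b) (rep (p b)) \<in> generate (Pi1 s) (range (gamma s))"
          using M(3)[of "p \<circ> linepath a b"] sub[OF H] by simp
      qed
    qed
  qed simp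
  moreover have "p \<circ> linepath 0 1 = p"
    by (auto simp: fun_eq_iff linepath_def)
  moreover have "rep (p 0) = s" "rep (p 1) = s"
    using p(2,3) s by (simp_all add: pathstart_def pathfinish_def rep_surface_point in_square(1) canon_interior)
  ultimately show ?thesis
    using ray_class_base[OF s p(1-3)] p(4) by (simp add: P_def)
qed

section \<open>The automorphism on the generators\<close>

definition psi_rep :: "real \<times> real \<Rightarrow> real \<times> real" where
  "psi_rep z = (if fst z \<le> 1/2 then (2 * fst z, snd z / 2) else (2 * fst z - 1, snd z / 2 + 1/2))"

lemma psi_rep_square: "z \<in> square \<Longrightarrow> psi_rep z \<in> square"
  using left_half_square[of "fst z" "snd z"] right_half_square[of "fst z" "snd z"] by (simp add: psi_rep_def)

lemma psi_surface_point_rep: "z \<in> square \<Longrightarrow> psi (surface_point z) = surface_point (psi_rep z)"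
  by (simp add: psi_surface_point psi_plane_def psi_rep_def)

lemma psi_surface_point_right:
  assumes "z \<in> square" "1/2 \<le> fst z"
  shows "psi (surface_point z) = surface_point (2 * fst z - 1, snd z / 2 + 1/2)"
proof (cases "fst z = 1/2")
  case True
  then have "0 < snd z" "snd z < 1"
    using square_half_interior[of "snd z"] assms(1) by (metis prod.collapse)+
  then show ?thesis
    using assms(1) psi_plane_seam[of "snd z"] by (simp add: psi_surface_point psi_plane_def True)
qed (use assms in \<open>simp add: psi_surface_point psi_plane_def\<close>)

lemma path_psi: "path p \<Longrightarrow> path (psi \<circ> p)"
  using continuous_on_psi by (intro path_continuous_image) (auto intro: continuous_on_subset)

lemma path_class_psi_cong:
  assumes "path_class p = path_class q" "path p"
  shows "path_class (psi \<circ> p) = path_class (psi \<circ> q)"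
proof -
  have "homotopic_paths UNIV p q"
    using assms path_class_eq_iff by blast
  then show ?thesis
    by (intro path_class_eqI homotopic_paths_continuous_image[of UNIV]) (simp_all add: continuous_on_psi)
qed

lemma convex_interior_insert: "y \<in> square \<Longrightarrow> convex (square_interior \<union> {y})"
  by (rule convex_edge_extension) simp_all

lemma ray_class_between:
  assumes "s \<in> square_interior" "x \<in> square_interior" "y \<in> square"
  shows "ray_class s x (surface_point \<circ> linepath x y) y = \<one>\<^bsub>Pi1 s\<^esub>"
    "ray_class s y (surface_point \<circ> linepath y x) x = \<one>\<^bsub>Pi1 s\<^esub>"
    "path (surface_point \<circ> linepath x y)" "path (surface_point \<circ> linepath y x)"
proof -
  have conv: "convex (square_interior \<union> {y})" and sub: "square_interior \<union> {y} \<subseteq> square"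
    using assms in_square(1) by (auto simp only: convex_interior_insert)
  show "ray_class s x (surface_point \<circ> linepath x y) y = \<one>\<^bsub>Pi1 s\<^esub>"
      "ray_class s y (surface_point \<circ> linepath y x) x = \<one>\<^bsub>Pi1 s\<^esub>"
    using assms by (intro ray_class_segment[OF conv sub]; simp)+
  show "path (surface_point \<circ> linepath x y)" "path (surface_point \<circ> linepath y x)"
    using closed_segment_subset[OF _ _ conv, of x y] closed_segment_subset[OF _ _ conv, of y x] assms sub
    by (auto intro!: path_surface_point)
qed

text \<open>The ray stays in the left half, where \<open>psi\<close> is given by one linear branch;
  its image is again a planar segment of the square.\<close>

lemma psi_ray_class_left:
  assumes s: "s \<in> square_interior" "fst s < 1/2" and x: "x \<in> square" "fst x \<le> 1/2"
  shows "ray_class s (psi_rep s) (psi \<circ> ray s x) (psi_rep x) = \<one>\<^bsub>Pi1 s\<^esub>"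
proof -
  have s1: "psi_rep s \<in> square_interior" "psi_rep x \<in> square"
    using s psi_rep_square[OF x(1)] by (auto simp: psi_rep_def square_interior_def)
  have eq: "(surface_point \<circ> linepath (psi_rep s) (psi_rep x)) t = (psi \<circ> ray s x) t" if t: "t \<in> {0..1}" for t
  proof -
    have "linepath s x t \<in> square"
      using ray_image[OF s(1) x(1)] t by (auto simp: path_image_def)
    moreover have "fst (linepath s x t) \<le> 1/2"
    proof -
      have "fst (linepath s x t) = (1 - t) * fst s + t * fst x"
        by (simp add: linepath_def)
      also have "\<dots> \<le> 1/2"
        using t s x by (intro convex_bound_le) auto
      finally show ?thesis .
    qed
    ultimately have "psi (surface_point (linepath s x t)) = surface_point (2 * fst (linepath s x t), snd (linepath s x t) / 2)"
      by (simp add: psi_surface_point psi_plane_def)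
    moreover have "(2 * fst (linepath s x t), snd (linepath s x t) / 2) = linepath (psi_rep s) (psi_rep x) t"
      using s x by (simp add: psi_rep_def linepath_def prod_eq_iff algebra_simps add_divide_distrib diff_divide_distrib)
    ultimately show ?thesis
      by (simp add: o_def)
  qed
  have "path_class (surface_point \<circ> linepath (psi_rep s) (psi_rep x)) = path_class (psi \<circ> ray s x)"
    using ray_class_between(3)[OF s(1) s1] eq by (rule path_class_cong)
  then have "ray_class s (psi_rep s) (surface_point \<circ> linepath (psi_rep s) (psi_rep x)) (psi_rep x)
      = ray_class s (psi_rep s) (psi \<circ> ray s x) (psi_rep x)"
    using ray_class_between(3)[OF s(1) s1] s s1
    by (intro ray_class_cong) (simp_all add: in_square(1) pathstart_compose pathfinish_compose)
  with ray_class_between(1)[OF s(1) s1] show ?thesis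
    by simp
qed

text \<open>The ray is bent so that it meets the line \<open>x = 1/2\<close> in its midpoint, whose image under
  \<open>psi\<close> is the midpoint of the edge \<open>1\<close>.\<close>

lemma psi_ray_class_right:
  assumes s: "s \<in> square_interior" "fst s < 1/2" and x: "x \<in> square" "1/2 < fst x"
  shows "ray_class s (psi_rep s) (psi \<circ> ray s x) (psi_rep x) = gamma s 1"
proof -
  interpret G: group "Pi1 s" by (rule group_fundamental_group)
  \<comment> \<open>The branches of \<open>psi\<close> send \<open>w\<close> to the two
    representatives of the midpoint of edge 1, and \<open>w'\<close> to the inner point
    \<open>?v\<close>. With \<open>?v\<close> inserted, each planar segment of the image has an
    inner end, as \<open>ray_class_between\<close> requires.\<close>
  define w w' :: "real \<times> real" where "w = (1/2, 1/2)" and "w' = (3/4, 1/2)"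
  have w: "w \<in> square_interior" "w' \<in> square_interior"
    by (simp_all add: w_def w'_def square_interior_def)
  have mid: "exit_midpoint 1 = (1, 1/4)" "exit_midpoint 1 + edge_shift 1 = (0, 3/4)"
    by (simp_all add: exit_midpoint_eq edge_shift_eq)
  let ?m = "(1, 1/4) :: real \<times> real" and ?m' = "(0, 3/4) :: real \<times> real" and ?v = "(1/2, 3/4) :: real \<times> real"
  have m: "?m \<in> square" "?m' \<in> square" "?v \<in> square_interior"
    using exit_midpoint_square[of 1] by (simp_all add: mid(1) edge_shift_eq square_interior_def)
  have glue: "surface_point ?m' = surface_point ?m"
    using surface_point_glue[OF exit_midpoint_in_exit_edge, of 1] by (simp add: mid(1) edge_shift_eq)
  have s1: "psi_rep s \<in> square_interior" "psi_rep x \<in> square"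
    using s psi_rep_square[OF x(1)] by (auto simp: psi_rep_def square_interior_def)
  let ?a = "surface_point \<circ> linepath (psi_rep s) ?m" and ?b = "surface_point \<circ> linepath ?m' ?v"
    and ?c = "surface_point \<circ> linepath ?v (psi_rep x)"
  have paths: "path ?a" "path ?b" "path ?c"
    using ray_class_between(3)[OF s(1) s1(1) m(1)] ray_class_between(4)[OF s(1) m(3) m(2)]
      ray_class_between(3)[OF s(1) m(3) s1(2)] .
  have conv: "convex (square_interior \<union> {x})" and sub: "square_interior \<union> {x} \<subseteq> square"
    using x(1) in_square(1) by (auto simp only: convex_interior_insert)
  have segs: "closed_segment s w \<subseteq> square_interior \<union> {x}" "closed_segment w w' \<subseteq> square_interior \<union> {x}"
    "closed_segment w' x \<subseteq> square_interior \<union> {x}" "closed_segment s x \<subseteq> square_interior \<union> {x}"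
    using s w by (intro closed_segment_subset conv; simp)+
  have "path_class (ray s x) = path_class (surface_point \<circ> (linepath s w +++ (linepath w w' +++ linepath w' x)))"
    using segs by (intro path_class_surface_point_eq[OF conv sub]) (simp_all add: path_image_join)
  then have "path_class (psi \<circ> ray s x)
      = path_class (psi \<circ> (surface_point \<circ> (linepath s w +++ (linepath w w' +++ linepath w' x))))"
    using path_ray[OF s(1) x(1)] by (rule path_class_psi_cong)
  also have "\<dots> = path_class (?a +++ (?b +++ ?c))"
  proof (rule path_class_cong[symmetric])
    show "path (?a +++ (?b +++ ?c))"
      using paths by (simp add: pathstart_compose pathfinish_compose glue)
    have left: "psi (surface_point (linepath s w t)) = surface_point (linepath (psi_rep s) ?m t)"
      if t: "t \<in> {0..1}" for t
    proof -
      have "linepath s w t \<in> square"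
        using segs(1) t sub linepath_in_path by blast
      moreover have "fst (linepath s w t) \<le> 1/2"
      proof -
        have "fst (linepath s w t) = (1 - t) * fst s + t * fst w"
          by (simp add: linepath_def)
        also have "\<dots> \<le> 1/2"
          using t s by (intro convex_bound_le) (auto simp: w_def)
        finally show ?thesis .
      qed
      ultimately have "psi (surface_point (linepath s w t)) = surface_point (2 * fst (linepath s w t), snd (linepath s w t) / 2)"
        by (simp add: psi_surface_point psi_plane_def)
      moreover have "(2 * fst (linepath s w t), snd (linepath s w t) / 2) = linepath (psi_rep s) ?m t"
        using s by (simp add: psi_rep_def linepath_def w_def prod_eq_iff algebra_simps add_divide_distrib diff_divide_distrib)
      ultimately show ?thesis by simp
    qed
    have right: "psi (surface_point (linepath u v t))
        = surface_point (linepath (2 * fst u - 1, snd u / 2 + 1/2) (2 * fst v - 1, snd v / 2 + 1/2) t)"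
      if t: "t \<in> {0..1}" and uv: "1/2 \<le> fst u" "1/2 \<le> fst v" "closed_segment u v \<subseteq> square_interior \<union> {x}" for t u v
    proof -
      have "linepath u v t \<in> square"
        using uv(3) t sub linepath_in_path by blast
      moreover have "1/2 \<le> fst (linepath u v t)"
      proof -
        have "fst (linepath u v t) = (1 - t) * fst u + t * fst v"
          by (simp add: linepath_def)
        moreover have "(1 - t) * (1/2) + t * (1/2) \<le> (1 - t) * fst u + t * fst v"
          using t uv by (intro add_mono mult_left_mono) simp_all
        ultimately show ?thesis
          by (simp add: field_simps)
      qed
      ultimately have "psi (surface_point (linepath u v t))
          = surface_point (2 * fst (linepath u v t) - 1, snd (linepath u v t) / 2 + 1/2)"
        by (rule psi_surface_point_right)
      moreover have "(2 * fst (linepath u v t) - 1, snd (linepath u v t) / 2 + 1/2)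
          = linepath (2 * fst u - 1, snd u / 2 + 1/2) (2 * fst v - 1, snd v / 2 + 1/2) t"
        by (simp add: linepath_def prod_eq_iff algebra_simps add_divide_distrib diff_divide_distrib)
      ultimately show ?thesis by simp
    qed
    have b: "psi (surface_point (linepath w w' t)) = surface_point (linepath ?m' ?v t)" if "t \<in> {0..1}" for t
      using right[OF that _ _ segs(2)] by (simp add: w_def w'_def)
    have c: "psi (surface_point (linepath w' x t)) = surface_point (linepath ?v (psi_rep x) t)" if "t \<in> {0..1}" for t
      using right[OF that _ _ segs(3)] x by (simp add: w'_def psi_rep_def)
    show "(?a +++ (?b +++ ?c)) t = (psi \<circ> (surface_point \<circ> (linepath s w +++ (linepath w w' +++ linepath w' x)))) t"
      if "t \<in> {0..1}" for t
      using that left b c by (simp add: joinpaths_def)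
  qed
  finally have pc: "path_class (psi \<circ> ray s x) = path_class (?a +++ (?b +++ ?c))" .
  have "ray_class s (psi_rep s) (psi \<circ> ray s x) (psi_rep x)
      = ray_class s (psi_rep s) (?a +++ (?b +++ ?c)) (psi_rep x)"
    using path_psi[OF path_ray[OF s(1) x(1)]] s1 s x
    by (intro ray_class_cong[OF pc])
      (simp_all add: in_square(1) pathstart_compose pathfinish_compose psi_surface_point_rep)
  also have "\<dots> = ray_class s (psi_rep s) ?a ?m' \<otimes>\<^bsub>Pi1 s\<^esub> ray_class s ?m' (?b +++ ?c) (psi_rep x)"
    using paths s1 m s by (intro ray_class_mult[symmetric]) (simp_all add: in_square(1) pathstart_compose pathfinish_compose glue)
  also have "ray_class s ?m' (?b +++ ?c) (psi_rep x) = ray_class s ?m' ?b ?v \<otimes>\<^bsub>Pi1 s\<^esub> ray_class s ?v ?c (psi_rep x)"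
    using paths s1 m s by (intro ray_class_mult[symmetric]) (simp_all add: in_square(1) pathstart_compose pathfinish_compose)
  also have "ray_class s ?m' ?b ?v = \<one>\<^bsub>Pi1 s\<^esub>"
    by (rule ray_class_between(2)[OF s(1) m(3) m(2)])
  also have "ray_class s ?v ?c (psi_rep x) = \<one>\<^bsub>Pi1 s\<^esub>"
    by (rule ray_class_between(1)[OF s(1) m(3) s1(2)])
  also have "ray_class s (psi_rep s) ?a ?m' = ray_class s (psi_rep s) ?a ?m \<otimes>\<^bsub>Pi1 s\<^esub> ray_class s ?m (\<lambda>_. surface_point ?m) ?m'"
    using paths s1 m s glue
    by (intro ray_class_change_end) (simp_all add: in_square(1) pathstart_compose pathfinish_compose)
  also have "ray_class s (psi_rep s) ?a ?m = \<one>\<^bsub>Pi1 s\<^esub>"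
    by (rule ray_class_between(1)[OF s(1) s1(1) m(1)])
  also have "ray_class s ?m (\<lambda>_. surface_point ?m) ?m' = gamma s 1"
    using gamma_eq_ray_class[OF s(1), of 1] by (simp add: mid(1) edge_shift_eq)
  finally show ?thesis
    using gamma_closed[OF s(1), of 1] by (simp add: o_def)
qed

text \<open>For a base point in the left half, the ray to \<open>x\<close> passes the cut
  \<open>x = 1/2\<close> once, from left to right, exactly when \<open>x\<close> lies in the right
  half. The cut is sent by \<open>psi\<close> to edge 1.\<close>

definition psi_crossing :: "real \<times> real \<Rightarrow> real \<times> real \<Rightarrow> (real \<Rightarrow> chamanara) set" where
  "psi_crossing s x = (if fst x \<le> 1/2 then \<one>\<^bsub>Pi1 s\<^esub> else gamma s 1)"

section \<open>Conjugation by \<beta> and the formulas on the generators\<close>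

locale base_change =
  fixes s :: "real \<times> real" and \<beta> :: "real \<Rightarrow> real \<times> real"
  assumes s: "s \<in> {0<..<1/2} \<times> {0<..<1/2}"
    and \<beta>: "path \<beta>" "path_image \<beta> \<subseteq> square_interior"
      "surface_point (pathstart \<beta>) = inv' phi (surface_point s)" "pathfinish \<beta> = s"
begin

sublocale group "Pi1 s" by (rule group_fundamental_group)

lemma s_interior: "s \<in> square_interior" and s_left: "fst s < 1/2"
  using s by (auto simp: square_interior_def)

lemma psi_rep_s: "psi_rep s \<in> square_interior"
  using s by (auto simp: psi_rep_def square_interior_def)

text \<open>The assumption on the start of \<beta> holds in the surface only; it determines the
  planar point because an inner point of the square has no other representative.\<close>

lemma pathstart_\<beta>: "pathstart \<beta> = psi_rep s"
proof -
  have int: "pathstart \<beta> \<in> square_interior"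
    using \<beta>(2) pathstart_in_path_image by blast
  have "surface_point (pathstart \<beta>) = surface_point (psi_rep s)"
    using \<beta>(3) s_interior by (simp add: inv_phi psi_surface_point_rep in_square(1))
  then show ?thesis
    using int psi_rep_s by (simp add: surface_point_eq_iff in_square(1) canon_interior)
qed

lemma path_surface_\<beta>: "path (surface_point \<circ> \<beta>)"
  using \<beta>(1,2) interior_edge_subset_square(1) by (intro path_surface_point) auto

text \<open>The curve \<beta> lies in the convex interior, hence is homotopic to the straight
  segment with the same ends. Conjugating by it is therefore the same as tethering by rays.\<close>

lemma phi_beta_inv_path_class:
  assumes p: "path p" "pathstart p = surface_point s" "pathfinish p = surface_point s"
  shows "phi_beta_inv \<beta> (path_class p) = ray_class s (psi_rep s) (psi \<circ> p) (psi_rep s)"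
proof -
  let ?b = "surface_point \<circ> \<beta>"
  have b: "pathstart ?b = surface_point (psi_rep s)" "pathfinish ?b = surface_point s"
    using pathstart_\<beta> \<beta>(4) by (simp_all add: pathstart_compose pathfinish_compose)
  have psi_s: "psi (surface_point s) = surface_point (psi_rep s)"
    using s_interior by (simp add: psi_surface_point_rep in_square(1))
  let ?j = "\<lambda>q. reversepath ?b +++ ((psi \<circ> q) +++ ?b)"
  have mem: "r \<in> phi_beta_inv \<beta> (path_class p) \<longleftrightarrow> homotopic_paths UNIV (?j p) r" for r
  proof
    assume "r \<in> phi_beta_inv \<beta> (path_class p)"
    then obtain q where q: "homotopic_paths UNIV p q" and r: "homotopic_paths UNIV (?j q) r"
      by (auto simp: phi_beta_inv_def path_class_def inv_phi)
    have "homotopic_paths UNIV (psi \<circ> p) (psi \<circ> q)"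
      using q by (rule homotopic_paths_continuous_image) (simp_all add: continuous_on_psi)
    then have "homotopic_paths UNIV (?j p) (?j q)"
      using path_surface_\<beta> b p psi_s
      by (intro homotopic_paths_join) (simp_all add: pathstart_compose pathfinish_compose)
    then show "homotopic_paths UNIV (?j p) r"
      using r by (rule homotopic_paths_trans)
  next
    assume "homotopic_paths UNIV (?j p) r"
    then show "r \<in> phi_beta_inv \<beta> (path_class p)"
      using p(1) by (auto simp: phi_beta_inv_def path_class_def inv_phi intro!: exI[of _ p])
  qed
  have "phi_beta_inv \<beta> (path_class p) = path_class (?j p)"
    unfolding path_class_def[of "?j p"] using mem by blast
  also have "\<dots> = ray_class s (psi_rep s) (psi \<circ> p) (psi_rep s)"
    unfolding ray_class_def tethered_def reversepath_ray
  proof (intro path_class_join_cong)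
    have seg: "closed_segment s (psi_rep s) \<subseteq> square_interior" "closed_segment (psi_rep s) s \<subseteq> square_interior"
      using s_interior psi_rep_s by (intro closed_segment_subset convex_square_interior; simp)+
    show beta: "path_class ?b = path_class (surface_point \<circ> linepath (psi_rep s) s)"
      using \<beta> pathstart_\<beta> seg
      by (intro path_class_surface_point_eq[OF convex_square_interior interior_edge_subset_square(1)]) simp_all
    have "path_class (surface_point \<circ> reversepath \<beta>) = path_class (ray s (psi_rep s))"
      using \<beta> pathstart_\<beta> seg
      by (intro path_class_surface_point_eq[OF convex_square_interior interior_edge_subset_square(1)]) simp_all
    then show "path_class (reversepath ?b) = path_class (ray s (psi_rep s))"
      by (simp add: path_compose_reversepath)
  qed (use path_psi[OF p(1)] path_surface_\<beta> b p psi_s in \<open>simp_all add: pathstart_compose pathfinish_compose\<close>)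
  finally show ?thesis .
qed

lemma psi_path_ends:
  assumes "path p" "pathstart p = surface_point s" "pathfinish p = surface_point s"
  shows "path (psi \<circ> p)" "pathstart (psi \<circ> p) = surface_point (psi_rep s)"
    "pathfinish (psi \<circ> p) = surface_point (psi_rep s)"
  using assms path_psi s_interior
  by (simp_all add: pathstart_compose pathfinish_compose psi_surface_point_rep in_square(1))

lemma phi_beta_inv_hom: "phi_beta_inv \<beta> \<in> hom (Pi1 s) (Pi1 s)"
proof (rule homI)
  fix A assume "A \<in> carrier (Pi1 s)"
  then obtain p where p: "path p" "pathstart p = surface_point s" "pathfinish p = surface_point s" "A = path_class p"
    by (rule fundamental_groupE)
  show "phi_beta_inv \<beta> A \<in> carrier (Pi1 s)"
    using p psi_path_ends[OF p(1-3)] psi_rep_s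
    by (auto simp: phi_beta_inv_path_class in_square(1) intro!: ray_class_closed s_interior)
  fix B assume "B \<in> carrier (Pi1 s)"
  then obtain q where q: "path q" "pathstart q = surface_point s" "pathfinish q = surface_point s" "B = path_class q"
    by (rule fundamental_groupE)
  have "A \<otimes>\<^bsub>Pi1 s\<^esub> B = path_class (p +++ q)"
    using p q by (simp add: mult_path_class)
  then show "phi_beta_inv \<beta> (A \<otimes>\<^bsub>Pi1 s\<^esub> B) = phi_beta_inv \<beta> A \<otimes>\<^bsub>Pi1 s\<^esub> phi_beta_inv \<beta> B"
    using p q psi_path_ends[OF p(1-3)] psi_path_ends[OF q(1-3)] psi_rep_s
    by (simp add: phi_beta_inv_path_class path_compose_join ray_class_mult s_interior in_square(1))
qed

lemma psi_ray_class:
  assumes "x \<in> square"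
  shows "ray_class s (psi_rep s) (psi \<circ> ray s x) (psi_rep x) = psi_crossing s x"
  using psi_ray_class_left[OF s_interior s_left assms] psi_ray_class_right[OF s_interior s_left assms]
  by (simp add: psi_crossing_def)

text \<open>The three factors are the crossing of edge 1 by the image of the outgoing ray, the
  switch of representative at the image of the edge, and the crossing by the returning ray, which is
  traversed backwards.\<close>

lemma phi_beta_inv_gamma:
  "phi_beta_inv \<beta> (gamma s n) = psi_crossing s (exit_midpoint n)
     \<otimes>\<^bsub>Pi1 s\<^esub> ray_class s (psi_rep (exit_midpoint n)) (\<lambda>_. surface_point (psi_rep (exit_midpoint n)))
          (psi_rep (exit_midpoint n + edge_shift n))
     \<otimes>\<^bsub>Pi1 s\<^esub> inv\<^bsub>Pi1 s\<^esub> psi_crossing s (exit_midpoint n + edge_shift n)"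
proof -
  let ?m = "exit_midpoint n" and ?m' = "exit_midpoint n + edge_shift n" and ?s1 = "psi_rep s"
  note m = exit_midpoint_square[of n]
  have glue: "surface_point ?m' = surface_point ?m"
    by (rule surface_point_glue[OF exit_midpoint_in_exit_edge])
  then have glue': "surface_point (psi_rep ?m') = surface_point (psi_rep ?m)"
    using m psi_surface_point_rep by metis
  let ?a = "ray s ?m" and ?b = "ray s ?m'"
  have rays: "path ?a" "path ?b"
    using path_ray[OF s_interior] m by auto
  have g: "gamma s n = path_class (?a +++ reversepath ?b)"
    unfolding gamma_def reversepath_ray by simp
  have A: "path (psi \<circ> ?a)" "pathstart (psi \<circ> ?a) = surface_point ?s1" "pathfinish (psi \<circ> ?a) = surface_point (psi_rep ?m)"
    and B: "path (psi \<circ> ?b)" "pathstart (psi \<circ> ?b) = surface_point ?s1" "pathfinish (psi \<circ> ?b) = surface_point (psi_rep ?m')"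
    using rays m s_interior
    by (simp_all add: path_psi pathstart_compose pathfinish_compose psi_surface_point_rep in_square(1))
  have sq: "?s1 \<in> square" "psi_rep ?m \<in> square" "psi_rep ?m' \<in> square"
    using psi_rep_s m by (auto simp: in_square(1) psi_rep_square)
  have "phi_beta_inv \<beta> (gamma s n) = ray_class s ?s1 (psi \<circ> (?a +++ reversepath ?b)) ?s1"
    unfolding g using rays glue by (intro phi_beta_inv_path_class) (simp_all add: ray_ends)
  also have "psi \<circ> (?a +++ reversepath ?b) = (psi \<circ> ?a) +++ reversepath (psi \<circ> ?b)"
    by (simp only: path_compose_join path_compose_reversepath)
  also have "ray_class s ?s1 ((psi \<circ> ?a) +++ reversepath (psi \<circ> ?b)) ?s1
      = ray_class s ?s1 (psi \<circ> ?a) (psi_rep ?m) \<otimes>\<^bsub>Pi1 s\<^esub> ray_class s (psi_rep ?m) (reversepath (psi \<circ> ?b)) ?s1"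
    using A B sq glue' by (intro ray_class_mult[symmetric] s_interior) simp_all
  also have "ray_class s (psi_rep ?m) (reversepath (psi \<circ> ?b)) ?s1
      = ray_class s (psi_rep ?m) (\<lambda>_. surface_point (psi_rep ?m)) (psi_rep ?m')
        \<otimes>\<^bsub>Pi1 s\<^esub> ray_class s (psi_rep ?m') (reversepath (psi \<circ> ?b)) ?s1"
    using A B sq glue' by (intro ray_class_change_start s_interior) simp_all
  also have "ray_class s (psi_rep ?m') (reversepath (psi \<circ> ?b)) ?s1 = inv\<^bsub>Pi1 s\<^esub> ray_class s ?s1 (psi \<circ> ?b) (psi_rep ?m')"
    using B sq by (intro ray_class_reverse s_interior) simp_all
  finally have eq: "phi_beta_inv \<beta> (gamma s n) = ray_class s ?s1 (psi \<circ> ?a) (psi_rep ?m)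
      \<otimes>\<^bsub>Pi1 s\<^esub> (ray_class s (psi_rep ?m) (\<lambda>_. surface_point (psi_rep ?m)) (psi_rep ?m')
        \<otimes>\<^bsub>Pi1 s\<^esub> inv\<^bsub>Pi1 s\<^esub> ray_class s ?s1 (psi \<circ> ?b) (psi_rep ?m'))" .
  have closed: "psi_crossing s x \<in> carrier (Pi1 s)" for x
    using gamma_closed[OF s_interior] by (simp add: psi_crossing_def)
  have "ray_class s (psi_rep ?m) (\<lambda>_. surface_point (psi_rep ?m)) (psi_rep ?m') \<in> carrier (Pi1 s)"
    using sq glue' by (intro ray_class_closed s_interior path_constant) (simp_all only: pathstart_const pathfinish_const)
  then show ?thesis
    unfolding eq psi_ray_class[OF m(1)] psi_ray_class[OF m(2)]
    by (intro m_assoc[symmetric] closed inv_closed)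
qed

lemma ray_class_const_same:
  assumes "x \<in> square"
  shows "ray_class s x (\<lambda>_. surface_point x) x = \<one>\<^bsub>Pi1 s\<^esub>"
proof -
  have "ray_class s x (surface_point \<circ> linepath x x) x = \<one>\<^bsub>Pi1 s\<^esub>"
  proof (rule ray_class_segment)
    show "convex (square_interior \<union> {x})" "square_interior \<union> {x} \<subseteq> square"
      using assms in_square(1) by (auto simp only: convex_interior_insert)
  qed (use s_interior in auto)
  then show ?thesis
    by (simp add: o_def)
qed

text \<open>The exit midpoint is on the right side and the entry midpoint on the left, so only the
  outgoing ray crosses edge 1; the middle factor is the generator of the image edge.\<close>

theorem phi_beta_inv_gamma_pos:
  assumes "n > 0"
  shows "phi_beta_inv \<beta> (gamma s n) = gamma s 1 \<otimes>\<^bsub>Pi1 s\<^esub> gamma s (n + 1)"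
proof -
  have len: "edge_len (n + 1) = edge_len n / 2"
    using assms by (rule edge_len_Suc)
  have "psi_rep (exit_midpoint n) = exit_midpoint (n + 1)"
    "psi_rep (exit_midpoint n + edge_shift n) = exit_midpoint (n + 1) + edge_shift (n + 1)"
    "psi_crossing s (exit_midpoint n) = gamma s 1" "psi_crossing s (exit_midpoint n + edge_shift n) = \<one>\<^bsub>Pi1 s\<^esub>"
    using assms by (simp_all add: len psi_rep_def psi_crossing_def exit_midpoint_eq edge_shift_eq diff_divide_distrib)
  then show ?thesis
    unfolding phi_beta_inv_gamma[of n]
    using gamma_eq_ray_class[OF s_interior, of "n + 1", symmetric] gamma_closed[OF s_interior] by simp
qed

text \<open>Edge 0 is carried into the interior, both representatives of its midpoint going to the
  centre of the square. The middle factor disappears and only the crossing by the outgoing ray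
  remains.\<close>

theorem phi_beta_inv_gamma_zero: "phi_beta_inv \<beta> (gamma s 0) = gamma s 1"
proof -
  have "psi_rep (exit_midpoint 0) = (1/2, 1/2)" "psi_rep (exit_midpoint 0 + edge_shift 0) = (1/2, 1/2)"
    "psi_crossing s (exit_midpoint 0) = gamma s 1" "psi_crossing s (exit_midpoint 0 + edge_shift 0) = \<one>\<^bsub>Pi1 s\<^esub>"
    by (simp_all add: psi_rep_def psi_crossing_def exit_midpoint_eq edge_shift_eq)
  moreover have "(1/2, 1/2) \<in> square"
    by (intro in_square(1)) (simp add: square_interior_def)
  ultimately show ?thesis
    unfolding phi_beta_inv_gamma[of 0] using gamma_closed[OF s_interior] by (simp add: ray_class_const_same)
qed

text \<open>Here the exit midpoint lies in the left half and the entry midpoint in the right half,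
  so the crossing belongs to the returning ray and appears as an inverse on the right.\<close>

theorem phi_beta_inv_gamma_neg:
  assumes "n < 0"
  shows "phi_beta_inv \<beta> (gamma s n) = gamma s (n + 1) \<otimes>\<^bsub>Pi1 s\<^esub> inv\<^bsub>Pi1 s\<^esub> gamma s 1"
proof -
  have len: "edge_len (n + 1) = 2 * edge_len n" "edge_len n \<le> 1/4"
    using assms edge_len_pred[of "n + 1"] edge_len_le_half[of "n + 1"] by auto
  have "psi_rep (exit_midpoint n) = exit_midpoint (n + 1)"
    "psi_rep (exit_midpoint n + edge_shift n) = exit_midpoint (n + 1) + edge_shift (n + 1)"
    "psi_crossing s (exit_midpoint n) = \<one>\<^bsub>Pi1 s\<^esub>" "psi_crossing s (exit_midpoint n + edge_shift n) = gamma s 1"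
    using assms len by (simp_all add: psi_rep_def psi_crossing_def exit_midpoint_eq edge_shift_eq)
  then show ?thesis
    unfolding phi_beta_inv_gamma[of n]
    using gamma_eq_ray_class[OF s_interior, of "n + 1", symmetric] gamma_closed[OF s_interior] by simp
qed

end

section \<open>Homomorphisms with prescribed values on the generators\<close>

locale edge_labelling = group Gr for Gr :: "'g monoid" (structure) +
  fixes f :: "int \<Rightarrow> 'g"
  assumes f_closed [simp]: "f n \<in> carrier Gr"
begin

text \<open>A potential of the cocycle near a single edge. The edge itself counts as entry side,
  since \<open>rep\<close> takes its points there, and receives the trivial value.\<close>

definition exit_value :: "chamanara \<Rightarrow> 'g" where
  "exit_value x = (if \<exists>n. rep x \<in> exit_cone n then f (THE n. rep x \<in> exit_cone n) else \<one>)"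

lemma exit_value_exit: "rep x \<in> exit_cone n \<Longrightarrow> exit_value x = f n"
proof -
  assume x: "rep x \<in> exit_cone n"
  then have "(THE n. rep x \<in> exit_cone n) = n"
    by (intro the_equality) (auto intro: exit_cone_unique)
  with x show ?thesis
    by (auto simp: exit_value_def)
qed

lemma exit_value_entry: "rep x \<in> entry_cone n \<Longrightarrow> exit_value x = \<one>"
  by (auto simp: exit_value_def dest: exit_cone_entry_cone_disjoint)

lemma exit_value_closed [simp]: "exit_value x \<in> carrier Gr"
  by (simp add: exit_value_def)

text \<open>Near one edge this is the coboundary of \<open>exit_value\<close>, hence multiplicative;
  inside small sets of the interior it is trivial. The label is determined by the point because
  triangles of distinct edges are disjoint.\<close>

definition crossing :: "chamanara \<Rightarrow> chamanara \<Rightarrow> 'g" where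
  "crossing x y = (if \<exists>n. x \<in> edge_nbhd n \<and> y \<in> edge_nbhd n then exit_value x \<otimes> inv (exit_value y) else \<one>)"

text \<open>Small open sets inside the square do not meet both triangles of an edge.\<close>

definition small :: "(real \<times> real) set \<Rightarrow> bool" where
  "small B \<longleftrightarrow> open B \<and> B \<subseteq> square_interior \<and>
     (\<forall>z\<in>B. \<forall>w\<in>B. \<bar>fst z - fst w\<bar> \<le> 1/2 \<and> \<bar>snd z - snd w\<bar> \<le> 1/2)"

definition crossing_cover :: "chamanara set set" where
  "crossing_cover = range edge_nbhd \<union> (\<lambda>B. surface_point ` B) ` {B. small B}"

lemma crossing_small:
  assumes "small B" "z \<in> B" "w \<in> B"
  shows "crossing (surface_point z) (surface_point w) = \<one>"
proof (cases "\<exists>n. surface_point z \<in> edge_nbhd n \<and> surface_point w \<in> edge_nbhd n")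
  case True
  have int: "z \<in> square_interior" "w \<in> square_interior"
    using assms by (auto simp: small_def)
  then have rep: "rep (surface_point z) = z" "rep (surface_point w) = w"
    by (simp_all add: rep_surface_point in_square(1) canon_interior)
  obtain n where n: "z \<in> exit_cone n \<union> entry_cone n" "w \<in> exit_cone n \<union> entry_cone n"
    using True int in_edge_nbhd_iff in_square(1) by blast
  have close: "\<bar>fst z - fst w\<bar> \<le> 1/2" "\<bar>snd z - snd w\<bar> \<le> 1/2"
    using assms by (auto simp: small_def)
  then have "(z \<in> exit_cone n \<and> w \<in> exit_cone n) \<or> (z \<in> entry_cone n \<and> w \<in> entry_cone n)"
    using n exit_cone_far_from_entry_cone[of z n w] exit_cone_far_from_entry_cone[of w n z]
    by (auto simp: abs_minus_commute)
  then have "exit_value (surface_point z) = exit_value (surface_point w)"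
    using rep exit_value_exit[of "surface_point z" n] exit_value_exit[of "surface_point w" n]
      exit_value_entry[of "surface_point z" n] exit_value_entry[of "surface_point w" n] by auto
  then show ?thesis
    by (simp add: crossing_def)
next
  case False
  then show ?thesis
    by (simp only: crossing_def if_False)
qed

lemma small_nbhd:
  assumes "z \<in> square_interior"
  shows "\<exists>B. small B \<and> z \<in> B"
proof -
  have "\<bar>fst u - fst v\<bar> \<le> 1/2 \<and> \<bar>snd u - snd v\<bar> \<le> 1/2" if "u \<in> ball z (1/4)" "v \<in> ball z (1/4)" for u v
    using that dist_fst_le[of z u] dist_fst_le[of z v] dist_snd_le[of z u] dist_snd_le[of z v]
    unfolding mem_ball dist_real_def by (intro conjI; linarith)
  then have "small (square_interior \<inter> ball z (1/4))"
    by (auto simp: small_def open_square_interior)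
  with assms show ?thesis
    by (intro exI[of _ "square_interior \<inter> ball z (1/4)"]) auto
qed

sublocale local_cocycle Gr crossing_cover crossing
proof
  fix M assume "M \<in> crossing_cover"
  then show "open M"
    using open_edge_nbhd open_surface_point_interior by (auto simp: crossing_cover_def small_def)
next
  have "x \<in> \<Union>crossing_cover" for x
  proof -
    obtain z where z: "z \<in> square" "x = surface_point z"
      by (rule surface_pointE)
    from z(1) show ?thesis
    proof (cases rule: square_cases)
      case 1
      then show ?thesis
        using small_nbhd[of z] z(2) by (auto simp: crossing_cover_def)
    next
      case (2 n)
      then have "x \<in> edge_nbhd n"
        using exit_edge_subset_cone[of n] z(2) by (auto simp: edge_nbhd_def)
      then show ?thesis by (auto simp: crossing_cover_def)
    next
      case (3 n)
      then have "x \<in> edge_nbhd n"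
        using entry_edge_subset_cone[of n] z(2) by (auto simp: edge_nbhd_def)
      then show ?thesis by (auto simp: crossing_cover_def)
    qed
  qed
  then show "\<Union>crossing_cover = UNIV" by blast
next
  show "crossing x y \<in> carrier Gr" for x y
    by (simp add: crossing_def)
next
  fix M x y z assume M: "M \<in> crossing_cover" and xyz: "x \<in> M" "y \<in> M" "z \<in> M"
  consider n where "M = edge_nbhd n" | B where "small B" "M = surface_point ` B"
    using M by (auto simp: crossing_cover_def)
  then show "crossing x y \<otimes> crossing y z = crossing x z"
  proof cases
    case 1
    then have "crossing u v = exit_value u \<otimes> inv (exit_value v)" if "u \<in> M" "v \<in> M" for u v
      using that by (auto simp: crossing_def)
    then show ?thesis
      using xyz by (simp add: m_assoc cancel_inv_left)
  next
    case 2
    then show ?thesis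
      using xyz crossing_small by auto
  qed
qed

section \<open>The cocycle lifted to the planar square\<close>

definition exit_edge_value :: "real \<times> real \<Rightarrow> 'g" where
  "exit_edge_value z = (if \<exists>n. z \<in> exit_edge n then f (THE n. z \<in> exit_edge n) else \<one>)"

lemma exit_edge_value_exit: "z \<in> exit_edge n \<Longrightarrow> exit_edge_value z = f n"
proof -
  assume z: "z \<in> exit_edge n"
  then have "(THE n. z \<in> exit_edge n) = n"
    by (intro the_equality) (auto intro: exit_edge_unique)
  with z show ?thesis
    by (auto simp: exit_edge_value_def)
qed

lemma exit_edge_value_other: "(\<And>n. z \<notin> exit_edge n) \<Longrightarrow> exit_edge_value z = \<one>"
  by (simp add: exit_edge_value_def)

lemma exit_edge_value_closed [simp]: "exit_edge_value z \<in> carrier Gr"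
  by (simp add: exit_edge_value_def)

lemma crossing_same_edge:
  "x \<in> edge_nbhd n \<Longrightarrow> y \<in> edge_nbhd n \<Longrightarrow> crossing x y = exit_value x \<otimes> inv (exit_value y)"
  by (auto simp: crossing_def)

text \<open>In the planar square, where an edge appears twice, the cocycle does have a global
  potential: the label on an exit edge and \<open>\<one>\<close> elsewhere. Leaving the exit edge
  inward multiplies by \<open>inv (f n)\<close>, which is exactly the jump of the potential.\<close>

lemma exit_edge_value_local:
  assumes "z \<in> square"
  shows "\<exists>A. openin (top_of_set square) A \<and> z \<in> A \<and>
    (\<forall>w\<in>A. exit_edge_value w = exit_edge_value z \<otimes> crossing (surface_point z) (surface_point w))"
  using assms
proof (cases rule: square_cases)
  case 1
  then obtain B where B: "small B" "z \<in> B"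
    using small_nbhd by blast
  have "B \<subseteq> square"
    using B(1) interior_edge_subset_square(1) unfolding small_def by (meson order_trans)
  then have "openin (top_of_set square) B"
    using B(1) unfolding openin_open small_def by (intro exI[of _ B]) blast
  moreover have "exit_edge_value w = \<one>" if "w \<in> B" for w
  proof -
    have "w \<in> square_interior"
      using that B(1) unfolding small_def by blast
    then show ?thesis
      by (intro exit_edge_value_other square_interior_not_edge)
  qed
  ultimately show ?thesis
    using B crossing_small[OF B(1,2)] by (intro exI[of _ B]) simp
next
  case (2 n)
  have z: "z \<in> exit_cone n" using 2 exit_edge_subset_cone by blast
  have zval: "exit_edge_value z = f n" "exit_value (surface_point z) = \<one>"
    using 2 z entry_edge_subset_cone[of n] exit_edge_shift_iff[of z n]
    by (auto simp: exit_edge_value_exit rep_exit_cone intro!: exit_value_entry[of _ n])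
  have local: "exit_edge_value w = exit_edge_value z \<otimes> crossing (surface_point z) (surface_point w)"
    if w: "w \<in> exit_cone n" for w
  proof -
    have nb: "surface_point z \<in> edge_nbhd n" "surface_point w \<in> edge_nbhd n"
      using z w by (auto simp: edge_nbhd_def)
    show ?thesis
    proof (cases "w \<in> exit_edge n")
      case True
      then have "exit_value (surface_point w) = \<one>"
        using w entry_edge_subset_cone[of n] exit_edge_shift_iff[of w n]
        by (auto simp: rep_exit_cone intro!: exit_value_entry[of _ n])
      then show ?thesis
        using True zval by (simp add: crossing_same_edge[OF nb] exit_edge_value_exit)
    next
      case False
      then have "exit_value (surface_point w) = f n"
        using w by (intro exit_value_exit) (simp add: rep_exit_cone)
      moreover have "w \<notin> exit_edge m" for m
        using False w exit_edge_subset_cone[of m] exit_cone_unique[of w n m] by blast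
      then have "exit_edge_value w = \<one>"
        by (rule exit_edge_value_other)
      ultimately show ?thesis
        using zval by (simp add: crossing_same_edge[OF nb])
    qed
  qed
  show ?thesis
    by (intro exI[of _ "exit_cone n"] conjI ballI openin_cones z local)
next
  case (3 n)
  have z: "z \<in> entry_cone n" using 3 entry_edge_subset_cone by blast
  have val: "exit_edge_value w = \<one>" "exit_value (surface_point w) = \<one>" if w: "w \<in> entry_cone n" for w
  proof -
    have "w \<notin> exit_edge m" for m
      using w exit_edge_subset_cone[of m] exit_cone_entry_cone_disjoint[of w m n] by blast
    then show "exit_edge_value w = \<one>"
      by (rule exit_edge_value_other)
    show "exit_value (surface_point w) = \<one>"
      using w by (intro exit_value_entry[of _ n]) (simp add: rep_entry_cone)
  qed
  have local: "exit_edge_value w = exit_edge_value z \<otimes> crossing (surface_point z) (surface_point w)"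
    if w: "w \<in> entry_cone n" for w
  proof -
    have "surface_point z \<in> edge_nbhd n" "surface_point w \<in> edge_nbhd n"
      using z w by (auto simp: edge_nbhd_def)
    then show ?thesis
      using val[OF z] val[OF w] by (simp add: crossing_same_edge)
  qed
  show ?thesis
    by (intro exI[of _ "entry_cone n"] conjI ballI openin_cones z local)
qed

text \<open>The potential along \<open>q\<close> is a development, so only the planar ends matter,
  including the side on which an edge point is read.\<close>

lemma holonomy_plane_path:
  assumes "path q" "path_image q \<subseteq> square"
  shows "holonomy (surface_point \<circ> q) = inv (exit_edge_value (pathstart q)) \<otimes> exit_edge_value (pathfinish q)"
proof -
  have "develops {0..1} (surface_point \<circ> q) (\<lambda>t. exit_edge_value (q t))"
    unfolding develops_def
  proof (intro conjI ballI)
    fix t :: real assume t: "t \<in> {0..1}"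
    then have "q t \<in> square"
      using assms(2) by (auto simp: path_image_def)
    from exit_edge_value_local[OF this] obtain A where A: "openin (top_of_set square) A" "q t \<in> A"
      and val: "\<forall>w\<in>A. exit_edge_value w = exit_edge_value (q t) \<otimes> crossing (surface_point (q t)) (surface_point w)"
      by (elim exE conjE) (rule that)
    from A(1) obtain A' where A': "open A'" "A = square \<inter> A'"
      by (auto simp: openin_open)
    obtain N where N: "open N" "N \<inter> {0..1} = q -` A' \<inter> {0..1}"
      using assms(1)[unfolded path_def continuous_on_open_invariant, rule_format, OF A'(1)] by blast
    show "\<exists>N. open N \<and> t \<in> N \<and> (\<forall>b\<in>N \<inter> {0..1}. exit_edge_value (q b)
        = exit_edge_value (q t) \<otimes> crossing ((surface_point \<circ> q) t) ((surface_point \<circ> q) b))"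
    proof (intro exI[of _ N] conjI ballI N(1))
      have "t \<in> q -` A' \<inter> {0..1}"
        using t A(2) unfolding A'(2) by simp
      then show "t \<in> N"
        unfolding N(2)[symmetric] by simp
      fix b assume b: "b \<in> N \<inter> {0..1}"
      then have "q b \<in> square" using assms(2) by (auto simp: path_image_def)
      moreover have "q b \<in> A'" using b unfolding N(2) by simp
      ultimately have "q b \<in> A" unfolding A'(2) by simp
      then show "exit_edge_value (q b)
          = exit_edge_value (q t) \<otimes> crossing ((surface_point \<circ> q) t) ((surface_point \<circ> q) b)"
        unfolding o_def using val by (rule bspec[rotated])
    qed
  qed simp
  from holonomy_eq[OF this] show ?thesis
    by (simp add: pathstart_def pathfinish_def)
qed

text \<open>A generator is made of two planar segments: the first ends at the exit representative
  and contributes \<open>f n\<close>, the second starts at the entry representative and contributes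
  nothing.\<close>

theorem hom_with_values:
  assumes s: "s \<in> square_interior"
  obtains h where "h \<in> hom (Pi1 s) Gr" "\<And>n. h (gamma s n) = f n"
proof -
  obtain h where h: "h \<in> hom (Pi1 s) Gr"
    "\<And>p. path p \<Longrightarrow> pathstart p = surface_point s \<Longrightarrow> pathfinish p = surface_point s \<Longrightarrow> h (path_class p) = holonomy p"
    using holonomy_hom[of "surface_point s"] by blast
  have "h (gamma s n) = f n" for n
  proof -
    let ?m = "exit_midpoint n" and ?m' = "exit_midpoint n + edge_shift n"
    let ?a = "surface_point \<circ> linepath s ?m" and ?b = "surface_point \<circ> linepath ?m' s"
    have glue: "surface_point ?m' = surface_point ?m"
      by (rule surface_point_glue[OF exit_midpoint_in_exit_edge])
    have img: "path_image (linepath s ?m) \<subseteq> square" "path_image (linepath ?m' s) \<subseteq> square"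
      using ray_image[OF s exit_midpoint_square(1)[of n]] ray_image[OF s exit_midpoint_square(2)[of n]]
      by (simp_all add: closed_segment_commute)
    have paths: "path ?a" "path ?b"
      using img by (intro path_surface_point; simp)+
    have vals: "exit_edge_value s = \<one>" "exit_edge_value ?m = f n" "exit_edge_value ?m' = \<one>"
    proof -
      show "exit_edge_value s = \<one>"
        using s by (intro exit_edge_value_other square_interior_not_edge)
      show "exit_edge_value ?m = f n"
        by (rule exit_edge_value_exit[OF exit_midpoint_in_exit_edge])
      show "exit_edge_value ?m' = \<one>"
        using exit_midpoint_in_exit_edge[of n] exit_edge_shift_iff[of ?m n] exit_edge_entry_edge_disjoint
        by (intro exit_edge_value_other) blast
    qed
    have "h (gamma s n) = holonomy (?a +++ ?b)"
      unfolding gamma_def using paths glue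
      by (intro h(2)) (simp_all add: pathstart_compose pathfinish_compose)
    also have "\<dots> = holonomy ?a \<otimes> holonomy ?b"
      using paths glue by (intro holonomy_join) (simp_all add: pathstart_compose pathfinish_compose)
    also have "\<dots> = f n"
      using vals img by (simp add: holonomy_plane_path)
    finally show ?thesis .
  qed
  with h(1) that show ?thesis by blast
qed

end

section \<open>Permutation groups\<close>

lemma inv_sym_group: "p permutes {1..d} \<Longrightarrow> inv\<^bsub>sym_group d\<^esub> p = inv' p"
  by (intro group.inv_equality sym_group_is_group)
    (simp_all add: sym_group_def permutes_inv permutes_inv_o)

lemma subgroup_sym_group_permutes: "subgroup H (sym_group d) \<Longrightarrow> x \<in> H \<Longrightarrow> x permutes {1..d}"
  using subgroup.mem_carrier by (metis sym_group_carrier)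

lemma subgroup_sym_group_comp: "subgroup H (sym_group d) \<Longrightarrow> x \<in> H \<Longrightarrow> y \<in> H \<Longrightarrow> x \<circ> y \<in> H"
  using subgroup.m_closed[of H "sym_group d" x y] by (simp add: sym_group_mult)

lemma subgroup_sym_group_id: "subgroup H (sym_group d) \<Longrightarrow> id \<in> H"
  using subgroup.one_closed[of H "sym_group d"] by (simp add: sym_group_one)

lemma subgroup_sym_group_inv: "subgroup H (sym_group d) \<Longrightarrow> x \<in> H \<Longrightarrow> inv' x \<in> H"
  using subgroup.m_inv_closed[of H "sym_group d" x] inv_sym_group[OF subgroup_sym_group_permutes, of H d x]
  by simp

lemma subgroup_sym_group_cancel_right:
  assumes "subgroup H (sym_group d)" "x \<circ> y \<in> H" "y \<in> H"
  shows "x \<in> H"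
proof -
  have "(x \<circ> y) \<circ> inv' y = x"
    using permutes_inv_o(1)[OF subgroup_sym_group_permutes[OF assms(1,3)]] by (simp add: comp_assoc)
  then show ?thesis
    using assms subgroup_sym_group_comp subgroup_sym_group_inv by metis
qed

lemma subgroup_sym_group_cancel_left:
  assumes "subgroup H (sym_group d)" "x \<circ> y \<in> H" "x \<in> H"
  shows "y \<in> H"
proof -
  have "inv' x \<circ> (x \<circ> y) = y"
    using permutes_inv_o(2)[OF subgroup_sym_group_permutes[OF assms(1,3)]] by (simp flip: comp_assoc)
  then show ?thesis
    using assms subgroup_sym_group_comp subgroup_sym_group_inv by metis
qed

lemma finite_subgroup_sym_group: "subgroup H (sym_group d) \<Longrightarrow> finite H"
  by (rule finite_subset[OF _ finite_permutations[of "{1..d}"]]) (auto dest: subgroup_sym_group_permutes)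

lemma conj_comp:
  assumes "\<sigma> permutes {1..d}"
  shows "(\<sigma> \<circ> x \<circ> inv' \<sigma>) \<circ> (\<sigma> \<circ> y \<circ> inv' \<sigma>) = \<sigma> \<circ> (x \<circ> y) \<circ> inv' \<sigma>"
  using assms by (simp add: fun_eq_iff permutes_inverses)

section \<open>The space of homomorphisms\<close>

lemma openin_product_discrete_iff:
  "openin (product_topology (\<lambda>_. discrete_topology G) I) U \<longleftrightarrow>
     U \<subseteq> I \<rightarrow>\<^sub>E G \<and> (\<forall>x\<in>U. \<exists>F. finite F \<and> F \<subseteq> I \<and> (\<forall>y\<in>I \<rightarrow>\<^sub>E G. (\<forall>i\<in>F. y i = x i) \<longrightarrow> y \<in> U))"
  (is "?L \<longleftrightarrow> ?R")
proof
  assume L: ?L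
  show ?R
  proof (intro conjI ballI)
    show sub: "U \<subseteq> I \<rightarrow>\<^sub>E G"
      using openin_subset[OF L] by (simp add: topspace_product_topology)
    fix x assume x: "x \<in> U"
    then obtain V where V: "finite {i \<in> I. V i \<noteq> G}" "\<And>i. i \<in> I \<Longrightarrow> V i \<subseteq> G" "x \<in> Pi\<^sub>E I V" "Pi\<^sub>E I V \<subseteq> U"
      using L unfolding openin_product_topology_alt by auto
    show "\<exists>F. finite F \<and> F \<subseteq> I \<and> (\<forall>y\<in>I \<rightarrow>\<^sub>E G. (\<forall>i\<in>F. y i = x i) \<longrightarrow> y \<in> U)"
    proof (intro exI[of _ "{i \<in> I. V i \<noteq> G}"] conjI ballI impI V(1))
      fix y assume y: "y \<in> I \<rightarrow>\<^sub>E G" "\<forall>i\<in>{i \<in> I. V i \<noteq> G}. y i = x i"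
      have "y i \<in> V i" if "i \<in> I" for i
        using y V(3) that by (cases "V i = G") (auto simp: PiE_iff)
      then have "y \<in> Pi\<^sub>E I V"
        using y by (auto simp: PiE_iff)
      then show "y \<in> U" using V(4) by blast
    qed auto
  qed
next
  assume R: ?R
  show ?L
    unfolding openin_product_topology_alt
  proof (intro ballI)
    fix x assume x: "x \<in> U"
    then obtain F where F: "finite F" "F \<subseteq> I" "\<And>y. y \<in> I \<rightarrow>\<^sub>E G \<Longrightarrow> (\<And>i. i \<in> F \<Longrightarrow> y i = x i) \<Longrightarrow> y \<in> U"
      using R by metis
    have xE: "x \<in> I \<rightarrow>\<^sub>E G" using R x by blast
    define V where "V i = (if i \<in> F then {x i} else G)" for i
    show "\<exists>V. finite {i \<in> I. V i \<noteq> topspace (discrete_topology G)} \<and>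
        (\<forall>i\<in>I. openin (discrete_topology G) (V i)) \<and> x \<in> Pi\<^sub>E I V \<and> Pi\<^sub>E I V \<subseteq> U"
    proof (intro exI[of _ V] conjI ballI)
      show "finite {i \<in> I. V i \<noteq> topspace (discrete_topology G)}"
        by (rule finite_subset[OF _ F(1)]) (auto simp: V_def)
      show "openin (discrete_topology G) (V i)" if "i \<in> I" for i
        using xE that by (auto simp: V_def PiE_iff)
      show "x \<in> Pi\<^sub>E I V"
        using xE by (auto simp: V_def PiE_iff)
      show "Pi\<^sub>E I V \<subseteq> U"
      proof
        fix y assume y: "y \<in> Pi\<^sub>E I V"
        have "V i \<subseteq> G" if "i \<in> I" for i
          using xE that by (auto simp: V_def PiE_iff)
        then have "y \<in> I \<rightarrow>\<^sub>E G"
          using y by (auto simp: PiE_iff)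
        moreover have "y i = x i" if "i \<in> F" for i
        proof -
          have "y i \<in> V i" using y that F(2) by (auto simp: PiE_iff)
          then show ?thesis using that by (simp add: V_def)
        qed
        ultimately show "y \<in> U" by (rule F(3))
      qed
    qed
  qed
qed

lemma Hom_subset_PiE: "Hom d \<Gamma> G \<subseteq> carrier \<Gamma> \<rightarrow>\<^sub>E G"
  by (auto simp: Hom_def hom_def PiE_iff extensional_def)

lemma topspace_Hom_topology [simp]: "topspace (Hom_topology d \<Gamma> G) = Hom d \<Gamma> G"
  using Hom_subset_PiE[of d \<Gamma> G] by (auto simp: Hom_topology_def topspace_product_topology)

lemma openin_Hom_topology_iff:
  "openin (Hom_topology d \<Gamma> G) U \<longleftrightarrow>
     U \<subseteq> Hom d \<Gamma> G \<and>
     (\<forall>h\<in>U. \<exists>F. finite F \<and> F \<subseteq> carrier \<Gamma> \<and> (\<forall>h'\<in>Hom d \<Gamma> G. (\<forall>g\<in>F. h' g = h g) \<longrightarrow> h' \<in> U))"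
  (is "?L \<longleftrightarrow> ?R")
proof
  assume ?L
  then obtain T where T: "openin (product_topology (\<lambda>_. discrete_topology G) (carrier \<Gamma>)) T" "U = T \<inter> Hom d \<Gamma> G"
    by (auto simp: Hom_topology_def openin_subtopology)
  show ?R
  proof (intro conjI ballI)
    show "U \<subseteq> Hom d \<Gamma> G" using T(2) by blast
    fix h assume "h \<in> U"
    then have "h \<in> T" using T(2) by blast
    then obtain F where F: "finite F" "F \<subseteq> carrier \<Gamma>" "\<forall>y\<in>carrier \<Gamma> \<rightarrow>\<^sub>E G. (\<forall>i\<in>F. y i = h i) \<longrightarrow> y \<in> T"
      using T(1) unfolding openin_product_discrete_iff by meson
    have "h' \<in> U" if "h' \<in> Hom d \<Gamma> G" "\<forall>g\<in>F. h' g = h g" for h'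
    proof -
      have "h' \<in> carrier \<Gamma> \<rightarrow>\<^sub>E G" using that(1) Hom_subset_PiE by (rule subsetD[rotated])
      then have "h' \<in> T" using F(3) that(2) by blast
      then show ?thesis using that(1) T(2) by blast
    qed
    with F(1,2) show "\<exists>F. finite F \<and> F \<subseteq> carrier \<Gamma> \<and> (\<forall>h'\<in>Hom d \<Gamma> G. (\<forall>g\<in>F. h' g = h g) \<longrightarrow> h' \<in> U)"
      by blast
  qed
next
  assume R: ?R
  \<comment> \<open>The union of the cylinders around points of \<open>U\<close> whose homomorphisms
    all belong to \<open>U\<close>: an open set of the product that cuts out
    \<open>U\<close>.\<close>
  define T where "T = {x \<in> carrier \<Gamma> \<rightarrow>\<^sub>E G. \<exists>h\<in>U. \<exists>F. finite F \<and> F \<subseteq> carrier \<Gamma> \<and>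
      (\<forall>h'\<in>Hom d \<Gamma> G. (\<forall>g\<in>F. h' g = h g) \<longrightarrow> h' \<in> U) \<and> (\<forall>g\<in>F. x g = h g)}"
  have "openin (product_topology (\<lambda>_. discrete_topology G) (carrier \<Gamma>)) T"
    unfolding openin_product_discrete_iff
  proof (intro conjI ballI)
    show "T \<subseteq> carrier \<Gamma> \<rightarrow>\<^sub>E G" by (auto simp: T_def)
    fix x assume "x \<in> T"
    then obtain h F where hF: "h \<in> U" "finite F" "F \<subseteq> carrier \<Gamma>"
      "\<forall>h'\<in>Hom d \<Gamma> G. (\<forall>g\<in>F. h' g = h g) \<longrightarrow> h' \<in> U" "\<forall>g\<in>F. x g = h g"
      unfolding T_def by blast
    have "y \<in> T" if y: "y \<in> carrier \<Gamma> \<rightarrow>\<^sub>E G" "\<forall>i\<in>F. y i = x i" for y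
    proof -
      have "\<forall>g\<in>F. y g = h g" using y(2) hF(5) by metis
      then show ?thesis
        unfolding T_def using y(1) hF(1-4) by blast
    qed
    then show "\<exists>F. finite F \<and> F \<subseteq> carrier \<Gamma> \<and> (\<forall>y\<in>carrier \<Gamma> \<rightarrow>\<^sub>E G. (\<forall>i\<in>F. y i = x i) \<longrightarrow> y \<in> T)"
      using hF(2,3) by blast
  qed
  moreover have "U = T \<inter> Hom d \<Gamma> G"
  proof
    show "U \<subseteq> T \<inter> Hom d \<Gamma> G"
    proof
      fix h assume h: "h \<in> U"
      then have "h \<in> Hom d \<Gamma> G" using R by blast
      moreover have "h \<in> carrier \<Gamma> \<rightarrow>\<^sub>E G" using calculation Hom_subset_PiE by (rule subsetD[rotated])
      moreover obtain F where "finite F" "F \<subseteq> carrier \<Gamma>" "\<forall>h'\<in>Hom d \<Gamma> G. (\<forall>g\<in>F. h' g = h g) \<longrightarrow> h' \<in> U"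
        using R h by meson
      ultimately show "h \<in> T \<inter> Hom d \<Gamma> G"
        unfolding T_def using h by blast
    qed
    show "T \<inter> Hom d \<Gamma> G \<subseteq> U"
      unfolding T_def by blast
  qed
  ultimately show ?L
    by (auto simp: Hom_topology_def openin_subtopology)
qed

text \<open>A failure of multiplicativity is visible on the three coordinates \<open>A\<close>,
  \<open>B\<close> and \<open>A \<otimes> B\<close>, so the homomorphisms form a closed subset of a
  compact product of finite sets.\<close>

lemma compact_space_Hom_topology:
  assumes "finite G" "group \<Gamma>"
  shows "compact_space (Hom_topology d \<Gamma> G)"
proof -
  let ?X = "product_topology (\<lambda>_. discrete_topology G) (carrier \<Gamma>)"
  have X: "compact_space ?X"
    using assms(1) by (auto simp: compact_space_product_topology compact_space_discrete_topology)
  have top: "topspace ?X = carrier \<Gamma> \<rightarrow>\<^sub>E G" by (simp add: topspace_product_topology)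
  interpret group \<Gamma> by fact
  have "openin ?X (topspace ?X - Hom d \<Gamma> G)"
    unfolding openin_product_discrete_iff top
  proof (intro conjI ballI)
    fix x assume "x \<in> (carrier \<Gamma> \<rightarrow>\<^sub>E G) - Hom d \<Gamma> G"
    then obtain A B where AB: "A \<in> carrier \<Gamma>" "B \<in> carrier \<Gamma>" "x (A \<otimes>\<^bsub>\<Gamma>\<^esub> B) \<noteq> x A \<circ> x B"
      by (auto simp: Hom_def hom_def PiE_iff sym_group_def)
    have "y \<notin> Hom d \<Gamma> G" if "\<forall>i\<in>{A, B, A \<otimes>\<^bsub>\<Gamma>\<^esub> B}. y i = x i" for y
      using that AB by (auto simp: Hom_def hom_def sym_group_def)
    then show "\<exists>F. finite F \<and> F \<subseteq> carrier \<Gamma> \<and>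
        (\<forall>y\<in>carrier \<Gamma> \<rightarrow>\<^sub>E G. (\<forall>i\<in>F. y i = x i) \<longrightarrow> y \<in> (carrier \<Gamma> \<rightarrow>\<^sub>E G) - Hom d \<Gamma> G)"
      using AB by (intro exI[of _ "{A, B, A \<otimes>\<^bsub>\<Gamma>\<^esub> B}"]) simp
  qed auto
  then have "closedin ?X (Hom d \<Gamma> G)"
    using Hom_subset_PiE by (simp add: closedin_def top)
  then show ?thesis
    unfolding Hom_topology_def using X closedin_compact_space compact_space_subtopology by blast
qed

text \<open>If each point of \<open>C\<close> had a neighbourhood visited only finitely often, a
  finite subcover would show that \<open>C\<close> itself is visited only finitely often.\<close>

lemma compact_space_accumulation_point:
  assumes "compact_space X" "closedin X C" "\<exists>\<^sub>F n in sequentially. s n \<in> C"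
  shows "\<exists>x\<in>C. accumulation_point X s x"
proof (rule ccontr)
  assume "\<not> ?thesis"
  then have "\<forall>x\<in>C. \<exists>U. openin X U \<and> x \<in> U \<and> \<not> (\<exists>\<^sub>F n in sequentially. s n \<in> U)"
    using closedin_subset[OF assms(2)] unfolding accumulation_point_def by blast
  then obtain U where U: "\<And>x. x \<in> C \<Longrightarrow> openin X (U x) \<and> x \<in> U x \<and> \<not> (\<exists>\<^sub>F n in sequentially. s n \<in> U x)"
    by metis
  have "compactin X C"
    by (rule closedin_compact_space[OF assms(1,2)])
  then obtain \<F> where \<F>: "finite \<F>" "\<F> \<subseteq> U ` C" "C \<subseteq> \<Union>\<F>"
  proof -
    have "\<exists>\<F>. finite \<F> \<and> \<F> \<subseteq> U ` C \<and> C \<subseteq> \<Union>\<F>"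
      using \<open>compactin X C\<close> by (rule compactinD) (use U in blast)+
    then show ?thesis using that by blast
  qed
  obtain D where D: "finite D" "D \<subseteq> C" "\<F> = U ` D"
    using finite_subset_image[OF \<F>(1,2)] by auto
  have "\<forall>\<^sub>F n in sequentially. \<forall>x\<in>D. s n \<notin> U x"
    using D U by (intro eventually_ball_finite ballI) (auto simp: frequently_def)
  then have "\<forall>\<^sub>F n in sequentially. s n \<notin> C"
    by eventually_elim (use \<F> D in blast)
  with assms(3) show False
    by (simp add: frequently_def)
qed

section \<open>The orbit of a homomorphism\<close>

locale monodromy = base_change s \<beta> for s \<beta> +
  fixes d :: nat and G :: "(nat \<Rightarrow> nat) set"
  assumes G: "subgroup G (sym_group d)"
begin

abbreviation "\<Gamma> \<equiv> Pi1 s"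
abbreviation "\<gamma> \<equiv> gamma s"
abbreviation "\<Phi> \<equiv> phi_beta_inv \<beta>"
abbreviation "HomG \<equiv> Hom d \<Gamma> G"
abbreviation "orbit \<equiv> phi_orbit s \<beta>"

lemma gamma_in [simp]: "\<gamma> n \<in> carrier \<Gamma>"
  by (rule gamma_closed[OF s_interior])

lemma HomD:
  assumes "h \<in> Hom d \<Gamma> H"
  shows "A \<in> carrier \<Gamma> \<Longrightarrow> h A \<in> H" "A \<in> carrier \<Gamma> \<Longrightarrow> B \<in> carrier \<Gamma> \<Longrightarrow> h (A \<otimes>\<^bsub>\<Gamma>\<^esub> B) = h A \<circ> h B"
    "h \<in> extensional (carrier \<Gamma>)"
  using assms by (auto simp: Hom_def hom_def sym_group_def)

lemma HomI:
  assumes "\<And>A. A \<in> carrier \<Gamma> \<Longrightarrow> h A \<in> H"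
    "\<And>A B. A \<in> carrier \<Gamma> \<Longrightarrow> B \<in> carrier \<Gamma> \<Longrightarrow> h (A \<otimes>\<^bsub>\<Gamma>\<^esub> B) = h A \<circ> h B"
    "h \<in> extensional (carrier \<Gamma>)"
  shows "h \<in> Hom d \<Gamma> H"
  using assms by (auto simp: Hom_def hom_def sym_group_def)

lemma Hom_permutes: "h \<in> HomG \<Longrightarrow> A \<in> carrier \<Gamma> \<Longrightarrow> h A permutes {1..d}"
  using HomD(1) subgroup_sym_group_permutes[OF G] by blast

lemma Phi_pow_hom: "(\<Phi> ^^ n) \<in> hom \<Gamma> \<Gamma>"
proof (induction n)
  case (Suc n)
  show ?case
  proof (rule homI)
    fix A assume A: "A \<in> carrier \<Gamma>"
    then show "(\<Phi> ^^ Suc n) A \<in> carrier \<Gamma>"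
      using hom_in_carrier[OF Suc] hom_in_carrier[OF phi_beta_inv_hom] by simp
    fix B assume "B \<in> carrier \<Gamma>"
    with A show "(\<Phi> ^^ Suc n) (A \<otimes>\<^bsub>\<Gamma>\<^esub> B) = (\<Phi> ^^ Suc n) A \<otimes>\<^bsub>\<Gamma>\<^esub> (\<Phi> ^^ Suc n) B"
      using hom_mult[OF Suc] hom_mult[OF phi_beta_inv_hom] hom_in_carrier[OF Suc] by simp
  qed
qed (auto simp: hom_def)

lemma Phi_pow_closed [simp]: "A \<in> carrier \<Gamma> \<Longrightarrow> (\<Phi> ^^ n) A \<in> carrier \<Gamma>"
  using Phi_pow_hom hom_in_carrier by fast

lemma Phi_closed [simp]: "A \<in> carrier \<Gamma> \<Longrightarrow> \<Phi> A \<in> carrier \<Gamma>"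
  using phi_beta_inv_hom hom_in_carrier by fast

lemma orbit_eq: "A \<in> carrier \<Gamma> \<Longrightarrow> orbit h n A = h ((\<Phi> ^^ n) A)"
  by (simp add: phi_orbit_def compose_eq)

lemma orbit_Suc: "A \<in> carrier \<Gamma> \<Longrightarrow> orbit h (Suc n) A = orbit h n (\<Phi> A)"
  by (simp add: orbit_eq funpow_swap1)

lemma orbit_add: "A \<in> carrier \<Gamma> \<Longrightarrow> orbit h n ((\<Phi> ^^ i) A) = orbit h (n + i) A"
  by (simp add: orbit_eq funpow_add)

lemma orbit_Hom: "h \<in> HomG \<Longrightarrow> orbit h n \<in> HomG"
proof (rule HomI)
  assume h: "h \<in> HomG"
  show "orbit h n A \<in> G" if "A \<in> carrier \<Gamma>" for A
    using that HomD(1)[OF h] by (simp add: orbit_eq)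
  show "orbit h n (A \<otimes>\<^bsub>\<Gamma>\<^esub> B) = orbit h n A \<circ> orbit h n B" if "A \<in> carrier \<Gamma>" "B \<in> carrier \<Gamma>" for A B
    using that HomD(2)[OF h] by (simp add: orbit_eq hom_mult[OF Phi_pow_hom] o_def)
qed (simp add: phi_orbit_def compose_def)

lemma orbit_0: "A \<in> carrier \<Gamma> \<Longrightarrow> orbit h 0 A = h A"
  by (simp add: orbit_eq)

lemma orbit_gamma_pos: "h \<in> HomG \<Longrightarrow> m > 0 \<Longrightarrow> orbit h (Suc n) (\<gamma> m) = orbit h n (\<gamma> 1) \<circ> orbit h n (\<gamma> (m + 1))"
  using HomD(2)[OF orbit_Hom] by (simp add: orbit_Suc phi_beta_inv_gamma_pos)

lemma orbit_gamma_zero: "orbit h (Suc n) (\<gamma> 0) = orbit h n (\<gamma> 1)"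
  by (simp add: orbit_Suc phi_beta_inv_gamma_zero)

lemma orbit_gamma_neg:
  assumes "h \<in> HomG" "m < 0"
  shows "orbit h (Suc n) (\<gamma> m) \<circ> orbit h n (\<gamma> 1) = orbit h n (\<gamma> (m + 1))"
proof -
  have "\<Phi> (\<gamma> m) \<otimes>\<^bsub>\<Gamma>\<^esub> \<gamma> 1 = \<gamma> (m + 1)"
    using assms(2) by (simp add: phi_beta_inv_gamma_neg m_assoc)
  then show ?thesis
    using HomD(2)[OF orbit_Hom[OF assms(1)], of "\<Phi> (\<gamma> m)" "\<gamma> 1"] by (simp add: orbit_Suc)
qed

section \<open>Towers over the orbit of the first generator\<close>

fun tower :: "(nat \<Rightarrow> nat \<Rightarrow> nat) \<Rightarrow> nat \<Rightarrow> nat \<Rightarrow> nat" where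
  "tower g 0 = id"
| "tower g (Suc n) = g n \<circ> tower g n"

lemma tower_in: "subgroup H (sym_group d) \<Longrightarrow> (\<And>i. i < n \<Longrightarrow> g i \<in> H) \<Longrightarrow> tower g n \<in> H"
  by (induction n) (auto simp: subgroup_sym_group_id subgroup_sym_group_comp)

lemma tower_cong: "(\<And>i. i < n \<Longrightarrow> g i = g' i) \<Longrightarrow> tower g n = tower g' n"
  by (induction n) auto

text \<open>Each use of \<open>orbit_gamma_pos\<close> trades one power of \<open>\<Phi>\<close> for
  one step of the label. For \<open>m = 1\<close> this is the recursion by which the values
  \<open>orbit h n (\<gamma> 1)\<close> and the values of \<open>h\<close> on the positive
  generators determine each other.\<close>

lemma orbit_gamma_tower:
  assumes "h \<in> HomG" "m > 0"
  shows "orbit h n (\<gamma> m) = tower (\<lambda>i. orbit h i (\<gamma> 1)) n \<circ> h (\<gamma> (int n + m))"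
  using assms(2)
proof (induction n arbitrary: m)
  case (Suc n)
  then show ?case
    using Suc.IH[of "m + 1"] by (simp add: orbit_gamma_pos[OF assms(1)] comp_assoc add.commute add.left_commute)
qed (simp add: orbit_0)

text \<open>The recursions are solved for the unknown generator by cancelling in \<open>H\<close>.
  For positive labels the same bound \<open>N\<close> works throughout, since the known terms are at
  later times; for the other labels each step down refers to an earlier time, so the bound grows
  with the label.\<close>

lemma eventually_orbit_in:
  assumes h: "h \<in> HomG" and H: "subgroup H (sym_group d)" and N: "\<And>n. n \<ge> N \<Longrightarrow> orbit h n (\<gamma> 1) \<in> H"
  shows "\<exists>N. \<forall>n\<ge>N. orbit h n (\<gamma> m) \<in> H"
proof -
  have pos: "\<forall>n\<ge>N. orbit h n (\<gamma> (int k + 1)) \<in> H" for k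
  proof (induction k)
    case (Suc k)
    show ?case
    proof (intro allI impI)
      fix n assume n: "n \<ge> N"
      have "orbit h n (\<gamma> 1) \<circ> orbit h n (\<gamma> (int (Suc k) + 1)) \<in> H"
        using orbit_gamma_pos[OF h, of "int k + 1" n] Suc[rule_format, of "Suc n"] n by (simp add: add.commute)
      then show "orbit h n (\<gamma> (int (Suc k) + 1)) \<in> H"
        using subgroup_sym_group_cancel_left[OF H] N[OF n] by blast
    qed
  qed (use N in simp)
  have neg: "\<exists>N. \<forall>n\<ge>N. orbit h n (\<gamma> (- int k)) \<in> H" for k
  proof (induction k)
    case 0
    have "orbit h n (\<gamma> 0) \<in> H" if "n \<ge> Suc N" for n
      using that N[of "n - 1"] orbit_gamma_zero[of h "n - 1"] by simp
    then show ?case by auto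
  next
    case (Suc k)
    then obtain M where M: "\<And>n. n \<ge> M \<Longrightarrow> orbit h n (\<gamma> (- int k)) \<in> H" by blast
    have "orbit h n (\<gamma> (- int (Suc k))) \<in> H" if n: "n \<ge> Suc (max M N)" for n
    proof -
      have "orbit h n (\<gamma> (- int (Suc k))) \<circ> orbit h (n - 1) (\<gamma> 1) \<in> H"
        using orbit_gamma_neg[OF h, of "- int (Suc k)" "n - 1"] M[of "n - 1"] n by simp
      then show ?thesis
        using subgroup_sym_group_cancel_right[OF H] N[of "n - 1"] n by auto
    qed
    then show ?case by blast
  qed
  show ?thesis
  proof (cases "m > 0")
    case True
    then show ?thesis
      using pos[of "nat (m - 1)"] by auto
  next
    case False
    then show ?thesis
      using neg[of "nat (- m)"] by auto
  qed
qed

lemma Hom_mem_iff_gamma: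
  assumes "h \<in> HomG" "subgroup H (sym_group d)" "\<And>n. h (\<gamma> n) \<in> H"
  shows "h \<in> Hom d \<Gamma> H"
proof (rule HomI)
  fix A assume "A \<in> carrier \<Gamma>"
  then have "A \<in> generate \<Gamma> (range \<gamma>)"
    by (rule gammas_generate[OF s_interior])
  then show "h A \<in> H"
  proof induction
    case one
    have "h \<one>\<^bsub>\<Gamma>\<^esub> \<circ> h (\<gamma> 0) = h (\<gamma> 0)"
      using HomD(2)[OF assms(1), of "\<one>\<^bsub>\<Gamma>\<^esub>" "\<gamma> 0"] by simp
    then show ?case
      using assms(3)[of 0] subgroup_sym_group_cancel_right[OF assms(2)] by metis
  next
    case (incl x)
    then show ?case using assms(3) by auto
  next
    case (inv x)
    have "h \<one>\<^bsub>\<Gamma>\<^esub> \<circ> h (\<gamma> 0) = h (\<gamma> 0)"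
      using HomD(2)[OF assms(1), of "\<one>\<^bsub>\<Gamma>\<^esub>" "\<gamma> 0"] by simp
    then have "h \<one>\<^bsub>\<Gamma>\<^esub> \<in> H"
      using assms(3)[of 0] subgroup_sym_group_cancel_right[OF assms(2)] by metis
    moreover have "h (inv\<^bsub>\<Gamma>\<^esub> x) \<circ> h x = h \<one>\<^bsub>\<Gamma>\<^esub>"
      using inv HomD(2)[OF assms(1), of "inv\<^bsub>\<Gamma>\<^esub> x" x] by auto
    ultimately show ?case
      using inv assms(3) subgroup_sym_group_cancel_right[OF assms(2)] by (metis rangeE)
  next
    case (eng x y)
    have "range \<gamma> \<subseteq> carrier \<Gamma>" by auto
    then have "x \<in> carrier \<Gamma>" "y \<in> carrier \<Gamma>"
      using eng generate_in_carrier by blast+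
    then show ?case
      using eng HomD(2)[OF assms(1)] subgroup_sym_group_comp[OF assms(2)] by (simp add: o_def)
  qed
qed (use HomD[OF assms(1)] in auto)

section \<open>Dependence on finitely many generators\<close>

definition agree :: "nat \<Rightarrow> ((real \<Rightarrow> chamanara) set \<Rightarrow> nat \<Rightarrow> nat) \<Rightarrow> ((real \<Rightarrow> chamanara) set \<Rightarrow> nat \<Rightarrow> nat) \<Rightarrow> bool" where
  "agree N h h' \<longleftrightarrow> h \<in> HomG \<and> h' \<in> HomG \<and> (\<forall>n. \<bar>n\<bar> \<le> int N \<longrightarrow> h (\<gamma> n) = h' (\<gamma> n))"

lemma agreeD: "agree N h h' \<Longrightarrow> \<bar>n\<bar> \<le> int N \<Longrightarrow> h (\<gamma> n) = h' (\<gamma> n)"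
  by (simp add: agree_def)

lemma agree_Hom: "agree N h h' \<Longrightarrow> h \<in> HomG" "agree N h h' \<Longrightarrow> h' \<in> HomG"
  by (simp_all add: agree_def)

lemma agree_mono: "agree N h h' \<Longrightarrow> M \<le> N \<Longrightarrow> agree M h h'"
  by (simp add: agree_def)

text \<open>An element is a finite word in the generators, so finitely many labels decide its image.
  Windows of labels thus give a neighbourhood base for pointwise convergence.\<close>

lemma Hom_agree:
  assumes "A \<in> carrier \<Gamma>"
  shows "\<exists>N. \<forall>h h'. agree N h h' \<longrightarrow> h A = h' A"
proof -
  have inj: "inj x" if "h \<in> HomG" "x = h B" "B \<in> carrier \<Gamma>" for h x B
    using Hom_permutes[OF that(1,3)] that(2) permutes_inj by blast
  have one: "h \<one>\<^bsub>\<Gamma>\<^esub> = id" if "h \<in> HomG" for h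
  proof -
    have "h \<one>\<^bsub>\<Gamma>\<^esub> \<circ> h \<one>\<^bsub>\<Gamma>\<^esub> = h \<one>\<^bsub>\<Gamma>\<^esub>"
      using HomD(2)[OF that, of "\<one>\<^bsub>\<Gamma>\<^esub>" "\<one>\<^bsub>\<Gamma>\<^esub>"] by simp
    then show ?thesis
      using inj[OF that refl, of "\<one>\<^bsub>\<Gamma>\<^esub>"] by (auto simp: fun_eq_iff inj_def)
  qed
  have "A \<in> generate \<Gamma> (range \<gamma>)"
    using assms by (rule gammas_generate[OF s_interior])
  then show ?thesis
  proof induction
    case one
    show ?case using \<open>\<And>h. h \<in> HomG \<Longrightarrow> h \<one>\<^bsub>\<Gamma>\<^esub> = id\<close> agree_Hom by metis
  next
    case (incl x)
    then obtain n where "x = \<gamma> n" by auto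
    then show ?case
      using agreeD[of "nat \<bar>n\<bar>" _ _ n] by (intro exI[of _ "nat \<bar>n\<bar>"]) auto
  next
    case (inv x)
    then obtain n where x: "x = \<gamma> n" by auto
    have "h (inv\<^bsub>\<Gamma>\<^esub> x) = inv' (h x)" if "h \<in> HomG" for h
    proof -
      have "h x \<circ> h (inv\<^bsub>\<Gamma>\<^esub> x) = id"
        using HomD(2)[OF that, of x "inv\<^bsub>\<Gamma>\<^esub> x"] one[OF that] x by simp
      then show ?thesis
        using Hom_permutes[OF that, of x] x
        by (metis comp_id fun.map_id0 gamma_in id_comp o_assoc permutes_inv_o(2))
    qed
    then show ?case
      using x agreeD[of "nat \<bar>n\<bar>" _ _ n] agree_Hom[of "nat \<bar>n\<bar>"]
      by (intro exI[of _ "nat \<bar>n\<bar>"]) auto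
  next
    case (eng x y)
    have "range \<gamma> \<subseteq> carrier \<Gamma>" by auto
    then have xy: "x \<in> carrier \<Gamma>" "y \<in> carrier \<Gamma>"
      using eng generate_in_carrier by blast+
    obtain N where N: "\<And>h h'. agree N h h' \<Longrightarrow> h x = h' x"
      using eng.IH(1) by blast
    obtain M where M: "\<And>h h'. agree M h h' \<Longrightarrow> h y = h' y"
      using eng.IH(2) by blast
    have "h (x \<otimes>\<^bsub>\<Gamma>\<^esub> y) = h' (x \<otimes>\<^bsub>\<Gamma>\<^esub> y)" if ag: "agree (max N M) h h'" for h h'
    proof -
      have "h x = h' x" "h y = h' y"
        using N[OF agree_mono[OF ag]] M[OF agree_mono[OF ag]] by simp_all
      then show ?thesis
        using HomD(2)[OF agree_Hom(1)[OF ag] xy] HomD(2)[OF agree_Hom(2)[OF ag] xy] by simp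
    qed
    then show ?case by blast
  qed
qed

lemma Hom_agree_finite:
  assumes "finite F" "F \<subseteq> carrier \<Gamma>"
  shows "\<exists>N. \<forall>h h'. agree N h h' \<longrightarrow> (\<forall>A\<in>F. h A = h' A)"
  using assms
proof (induction F rule: finite_induct)
  case (insert A F)
  then obtain N where N: "\<And>h h'. agree N h h' \<Longrightarrow> \<forall>A\<in>F. h A = h' A"
    by blast
  obtain M where M: "\<And>h h'. agree M h h' \<Longrightarrow> h A = h' A"
    using Hom_agree[of A] insert.prems by blast
  have "\<forall>B\<in>insert A F. h B = h' B" if ag: "agree (max N M) h h'" for h h'
    using N[OF agree_mono[OF ag]] M[OF agree_mono[OF ag]] by simp
  then show ?case by blast
qed simp

end

text \<open>Any \<open>r\<close> consecutive integers meet every residue; this keeps the recurrence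
  below within windows of bounded length.\<close>

lemma mod_window:
  fixes r :: nat
  assumes "j < r"
  shows "\<exists>i<r. (n + i) mod r = j"
proof (cases "n mod r \<le> j")
  case True
  have "n + (j - n mod r) = r * (n div r) + j"
    using True mult_div_mod_eq[of r n] by linarith
  then have "(n + (j - n mod r)) mod r = j"
    using assms by simp
  then show ?thesis
    using assms by (intro exI[of _ "j - n mod r"]) auto
next
  case False
  have "n mod r < r" using assms by simp
  moreover have "r * (n div r + 1) = r * (n div r) + r" by simp
  ultimately have "n + (r + j - n mod r) = r * (n div r + 1) + j"
    using mult_div_mod_eq[of r n] by linarith
  then have "(n + (r + j - n mod r)) mod r = j"
    using assms by (metis mod_less mod_mult_self4)
  then show ?thesis
    using False \<open>n mod r < r\<close> by (intro exI[of _ "r + j - n mod r"]) auto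
qed

lemma finite_enumeration:
  assumes "finite A"
  obtains e where "\<And>i. i < card A \<Longrightarrow> e i \<in> A" "\<And>x. x \<in> A \<Longrightarrow> \<exists>i<card A. e i = (x :: 'a)"
proof -
  obtain e where e: "bij_betw e {0..<card A} A"
    using ex_bij_betw_nat_finite[OF assms] by blast
  show ?thesis
  proof (rule that[of e])
    show "e i \<in> A" if "i < card A" for i
      using e that by (auto simp: bij_betw_def)
    show "\<exists>i<card A. e i = x" if "x \<in> A" for x
    proof -
      have "x \<in> e ` {0..<card A}" using e that by (simp add: bij_betw_def)
      then show ?thesis by auto
    qed
  qed
qed

context monodromy
begin

section \<open>The space of covers\<close>

abbreviation "cover_class \<equiv> conj_class d \<Gamma> G"
abbreviation "Cov \<equiv> Cov_topology d \<Gamma> G"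

definition conjugates :: "(nat \<Rightarrow> nat) \<Rightarrow> (real \<Rightarrow> chamanara) set set \<Rightarrow>
    ((real \<Rightarrow> chamanara) set \<Rightarrow> nat \<Rightarrow> nat) \<Rightarrow> ((real \<Rightarrow> chamanara) set \<Rightarrow> nat \<Rightarrow> nat) \<Rightarrow> bool" where
  "conjugates \<sigma> F h h' \<longleftrightarrow> \<sigma> permutes {1..d} \<and> (\<forall>A\<in>F. h' A = \<sigma> \<circ> h A \<circ> inv' \<sigma>)"

lemma cover_class_eq: "cover_class h = {h' \<in> HomG. \<exists>\<sigma>. conjugates \<sigma> (carrier \<Gamma>) h h'}"
  by (simp add: conj_class_def conjugates_def)

lemma conjugates_id: "conjugates id F h h"
  by (simp add: conjugates_def permutes_id)

lemma conjugates_sym: "conjugates \<sigma> F h h' \<Longrightarrow> conjugates (inv' \<sigma>) F h' h"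
proof -
  assume "conjugates \<sigma> F h h'"
  then have \<sigma>: "\<sigma> permutes {1..d}" and eq: "\<And>A. A \<in> F \<Longrightarrow> h' A = \<sigma> \<circ> h A \<circ> inv' \<sigma>"
    by (auto simp: conjugates_def)
  have "h A = inv' \<sigma> \<circ> h' A \<circ> inv' (inv' \<sigma>)" if "A \<in> F" for A
    unfolding eq[OF that] using \<sigma>
    by (simp add: fun_eq_iff permutes_inverses permutes_inv_inv)
  then show ?thesis
    using \<sigma> by (simp add: conjugates_def permutes_inv)
qed

lemma conjugates_trans: "conjugates \<sigma> F h h' \<Longrightarrow> conjugates \<tau> F h' h'' \<Longrightarrow> conjugates (\<tau> \<circ> \<sigma>) F h h''"
proof -
  assume "conjugates \<sigma> F h h'" "conjugates \<tau> F h' h''"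
  then have \<sigma>: "\<sigma> permutes {1..d}" "\<tau> permutes {1..d}"
    and eq: "\<And>A. A \<in> F \<Longrightarrow> h' A = \<sigma> \<circ> h A \<circ> inv' \<sigma>" "\<And>A. A \<in> F \<Longrightarrow> h'' A = \<tau> \<circ> h' A \<circ> inv' \<tau>"
    by (auto simp: conjugates_def)
  have "inv' (\<tau> \<circ> \<sigma>) = inv' \<sigma> \<circ> inv' \<tau>"
    using \<sigma> by (intro o_inv_distrib permutes_bij; auto)
  then show ?thesis
    using \<sigma> eq by (simp add: conjugates_def permutes_compose comp_assoc)
qed

lemma conjugates_subset: "conjugates \<sigma> F h h' \<Longrightarrow> F' \<subseteq> F \<Longrightarrow> conjugates \<sigma> F' h h'"
  by (auto simp: conjugates_def)

lemma cover_class_eqI: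
  assumes "conjugates \<sigma> (carrier \<Gamma>) h h'"
  shows "cover_class h = cover_class h'"
proof -
  have "(\<exists>\<tau>. conjugates \<tau> (carrier \<Gamma>) h k) \<longleftrightarrow> (\<exists>\<tau>. conjugates \<tau> (carrier \<Gamma>) h' k)" for k
    using conjugates_trans[OF conjugates_sym[OF assms], of _ k] conjugates_trans[OF assms, of _ k] by blast
  then show ?thesis
    by (simp add: cover_class_eq)
qed

lemma cover_class_eqD:
  assumes "h' \<in> HomG" "cover_class h = cover_class h'"
  shows "\<exists>\<sigma>. conjugates \<sigma> (carrier \<Gamma>) h h'"
proof -
  have "h' \<in> cover_class h'"
    using assms(1) conjugates_id by (auto simp: cover_class_eq)
  then show ?thesis
    unfolding assms(2)[symmetric] by (simp add: cover_class_eq)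
qed

lemma topspace_Cov: "topspace Cov = cover_class ` HomG"
  using quotient_imp_surjective_map[OF quotient_map_quotient_topology[of "Hom_topology d \<Gamma> G" cover_class]]
  by (simp add: Cov_topology_def)

lemma openin_Cov_iff:
  "openin Cov V \<longleftrightarrow> V \<subseteq> cover_class ` HomG \<and> openin (Hom_topology d \<Gamma> G) {h \<in> HomG. cover_class h \<in> V}"
  by (simp add: Cov_topology_def openin_quotient_topology)

text \<open>Being conjugate to \<open>k\<close> on the finite set \<open>F\<close> is an open
  condition, and it is saturated under conjugation, so it descends to an open set of covers. The
  conjugator obtained depends on \<open>n\<close> and on \<open>F\<close>.\<close>

lemma accumulation_in_Cov:
  assumes acc: "accumulation_point Cov (\<lambda>n. cover_class (u n)) (cover_class k)"
    and k: "k \<in> HomG" and u: "\<And>n. u n \<in> HomG" and F: "finite F" "F \<subseteq> carrier \<Gamma>"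
  shows "\<exists>\<^sub>F n in sequentially. \<exists>\<sigma>. conjugates \<sigma> F k (u n)"
proof -
  define U where "U = {h \<in> HomG. \<exists>\<sigma>. conjugates \<sigma> F k h}"
  have sat: "h \<in> U" if hG: "h \<in> HomG" and hU: "cover_class h \<in> cover_class ` U" for h
  proof -
    obtain h' where h': "h' \<in> U" "cover_class h = cover_class h'"
      using hU by blast
    obtain \<sigma> where \<sigma>: "conjugates \<sigma> (carrier \<Gamma>) h' h"
      using cover_class_eqD[OF hG h'(2)[symmetric]] by blast
    obtain \<tau> where "conjugates \<tau> F k h'"
      using h'(1) by (auto simp: U_def)
    then have "conjugates (\<sigma> \<circ> \<tau>) F k h"
      by (rule conjugates_trans[OF _ conjugates_subset[OF \<sigma> F(2)]])
    then show ?thesis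
      using hG by (auto simp: U_def)
  qed
  have "openin (Hom_topology d \<Gamma> G) U"
    unfolding openin_Hom_topology_iff
  proof (intro conjI ballI)
    show "U \<subseteq> HomG" by (auto simp: U_def)
    fix h assume "h \<in> U"
    then obtain \<sigma> where \<sigma>: "conjugates \<sigma> F k h" by (auto simp: U_def)
    have "h' \<in> U" if "h' \<in> HomG" "\<forall>g\<in>F. h' g = h g" for h'
      using that \<sigma> by (auto simp: U_def conjugates_def)
    with F show "\<exists>F. finite F \<and> F \<subseteq> carrier \<Gamma> \<and> (\<forall>h'\<in>HomG. (\<forall>g\<in>F. h' g = h g) \<longrightarrow> h' \<in> U)"
      by blast
  qed
  moreover have "{h \<in> HomG. cover_class h \<in> cover_class ` U} = U"
    using sat by (auto simp: U_def)
  ultimately have "openin Cov (cover_class ` U)"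
    by (auto simp: openin_Cov_iff U_def)
  moreover have "cover_class k \<in> cover_class ` U"
    using k conjugates_id by (auto simp: U_def)
  ultimately have "\<exists>\<^sub>F n in sequentially. cover_class (u n) \<in> cover_class ` U"
    using acc unfolding accumulation_point_def by blast
  then show ?thesis
  proof (rule frequently_mono[rotated], intro allI impI)
    fix n assume "cover_class (u n) \<in> cover_class ` U"
    then have "u n \<in> U" by (rule sat[OF u])
    then show "\<exists>\<sigma>. conjugates \<sigma> F k (u n)" by (simp add: U_def)
  qed
qed

lemma conjugates_orbit:
  assumes "conjugates \<sigma> (carrier \<Gamma>) h h'"
  shows "conjugates \<sigma> (carrier \<Gamma>) (orbit h n) (orbit h' n)"
  using assms by (simp add: conjugates_def orbit_eq o_def)

lemma conjugates_Hom:
  assumes h: "h \<in> HomG" and H: "subgroup H (sym_group d)" and \<sigma>: "\<sigma> permutes {1..d}"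
    and mem: "\<And>n. \<sigma> \<circ> h (\<gamma> n) \<circ> inv' \<sigma> \<in> H"
  shows "\<exists>h'\<in>Hom d \<Gamma> H. conjugates \<sigma> (carrier \<Gamma>) h h'"
proof -
  \<comment> \<open>Conjugation by \<sigma> may lead out of \<open>G\<close>. The conjugate is first
    treated as a homomorphism to the full symmetric group; its values on the generators then place
    it in \<open>H\<close>.\<close>
  interpret S: monodromy s \<beta> d "carrier (sym_group d)"
    by (intro monodromy.intro monodromy_axioms.intro base_change_axioms group.subgroup_self sym_group_is_group)
  define h' where "h' = (\<lambda>A\<in>carrier \<Gamma>. \<sigma> \<circ> h A \<circ> inv' \<sigma>)"
  have "h' \<in> Hom d \<Gamma> (carrier (sym_group d))"
  proof (rule HomI)
    show "h' A \<in> carrier (sym_group d)" if "A \<in> carrier \<Gamma>" for A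
      using that \<sigma> Hom_permutes[OF h] by (auto simp: h'_def sym_group_def intro!: permutes_compose permutes_inv)
    show "h' (A \<otimes>\<^bsub>\<Gamma>\<^esub> B) = h' A \<circ> h' B" if "A \<in> carrier \<Gamma>" "B \<in> carrier \<Gamma>" for A B
    proof -
      have "h' (A \<otimes>\<^bsub>\<Gamma>\<^esub> B) = \<sigma> \<circ> (h A \<circ> h B) \<circ> inv' \<sigma>"
        using that HomD(2)[OF h] by (simp add: h'_def)
      then show ?thesis
        using that conj_comp[OF \<sigma>, of "h A" "h B"] by (simp add: h'_def)
    qed
  qed (simp add: h'_def)
  moreover have "h' (\<gamma> n) \<in> H" for n
    unfolding h'_def restrict_apply'[OF gamma_in] by (rule mem)
  ultimately have "h' \<in> Hom d \<Gamma> H"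
    by (rule S.Hom_mem_iff_gamma[OF _ H])
  then show ?thesis
    using \<sigma> by (intro bexI[of _ h']) (simp_all add: conjugates_def h'_def)
qed

text \<open>Exhausting \<open>G\<close> on the generators makes the cover connected when
  \<open>G\<close> is transitive. The tail must stay in \<open>H\<close>, and each of its windows of
  fixed length \<open>card H\<close> must fill \<open>H\<close>: only a bounded window can be tested
  on a finite set of group elements.\<close>

definition recurrent :: "(nat \<Rightarrow> nat) set \<Rightarrow> ((real \<Rightarrow> chamanara) set \<Rightarrow> nat \<Rightarrow> nat) \<Rightarrow> bool" where
  "recurrent H h \<longleftrightarrow> h \<in> HomG \<and> (\<forall>x\<in>G. \<exists>n. h (\<gamma> n) = x) \<and>
     (\<exists>N. \<forall>n\<ge>N. orbit h n (\<gamma> 1) \<in> H \<and> (\<forall>x\<in>H. \<exists>i<card H. orbit h (n + i) (\<gamma> 1) = x))"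

lemma recurrent_accumulation:
  assumes rec: "recurrent H h" and H: "subgroup H (sym_group d)" "H \<subseteq> G"
    and acc: "accumulation_point Cov (\<lambda>n. cover_class (orbit h n)) c"
  shows "c \<in> cover_class ` Hom d \<Gamma> H"
proof -
  have h: "h \<in> HomG" using rec by (simp add: recurrent_def)
  obtain N where N: "\<And>n. n \<ge> N \<Longrightarrow> orbit h n (\<gamma> 1) \<in> H"
    using rec unfolding recurrent_def by blast
  have "c \<in> cover_class ` HomG"
    using acc topspace_Cov by (simp add: accumulation_point_def)
  then obtain k where k: "k \<in> HomG" "c = cover_class k" by blast
  have "\<exists>\<sigma>. \<sigma> permutes {1..d} \<and> (\<forall>m. \<bar>m\<bar> \<le> int M \<longrightarrow> \<sigma> \<circ> k (\<gamma> m) \<circ> inv' \<sigma> \<in> H)" for M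
  proof -
    have ev: "\<forall>\<^sub>F n in sequentially. \<forall>m\<in>{- int M..int M}. orbit h n (\<gamma> m) \<in> H"
      using eventually_orbit_in[OF h H(1) N(1)]
      by (intro eventually_ball_finite ballI) (auto simp: eventually_sequentially)
    have "\<exists>\<^sub>F n in sequentially. \<exists>\<sigma>. conjugates \<sigma> (\<gamma> ` {- int M..int M}) k (orbit h n)"
      using acc k(2) orbit_Hom[OF h] by (intro accumulation_in_Cov k(1)) auto
    from frequently_ex[OF frequently_eventually_conj[OF this ev]]
    obtain n \<sigma> where n: "\<forall>m\<in>{- int M..int M}. orbit h n (\<gamma> m) \<in> H"
      "conjugates \<sigma> (\<gamma> ` {- int M..int M}) k (orbit h n)" by blast
    have "\<sigma> \<circ> k (\<gamma> m) \<circ> inv' \<sigma> \<in> H" if "\<bar>m\<bar> \<le> int M" for m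
    proof -
      have m: "m \<in> {- int M..int M}" using that by auto
      then have "orbit h n (\<gamma> m) = \<sigma> \<circ> k (\<gamma> m) \<circ> inv' \<sigma>"
        using n(2) by (simp add: conjugates_def)
      then show ?thesis
        using n(1) m by metis
    qed
    moreover have "\<sigma> permutes {1..d}" using n(2) by (simp add: conjugates_def)
    ultimately show ?thesis by blast
  qed
  then obtain \<sigma> where \<sigma>: "\<And>M. \<sigma> M permutes {1..d}"
    "\<And>M m. \<bar>m\<bar> \<le> int M \<Longrightarrow> \<sigma> M \<circ> k (\<gamma> m) \<circ> inv' (\<sigma> M) \<in> H"
    by metis
  \<comment> \<open>There are only finitely many permutations, so one conjugator recurs for
    arbitrarily large windows \<open>M\<close> and therefore works for all generators at
    once.\<close>
  have "finite (range \<sigma>)"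
    using \<sigma>(1) by (intro finite_subset[OF _ finite_permutations[of "{1..d}"]]) auto
  then obtain M0 where M0: "infinite {M. \<sigma> M = \<sigma> M0}"
    using pigeonhole_infinite[of "UNIV :: nat set" \<sigma>] by auto
  have "\<sigma> M0 \<circ> k (\<gamma> m) \<circ> inv' (\<sigma> M0) \<in> H" for m
  proof -
    obtain M where "M \<in> {M. \<sigma> M = \<sigma> M0}" "nat \<bar>m\<bar> \<le> M"
      using M0 unfolding infinite_nat_iff_unbounded_le by blast
    then have "\<sigma> M = \<sigma> M0" "\<bar>m\<bar> \<le> int M" by auto
    with \<sigma>(2)[of m M] show ?thesis by simp
  qed
  then obtain k' where "k' \<in> Hom d \<Gamma> H" "conjugates (\<sigma> M0) (carrier \<Gamma>) k k'"
    using conjugates_Hom[OF k(1) H(1) \<sigma>(1)] by blast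
  then show ?thesis
    using k(2) cover_class_eqI by (metis imageI)
qed

text \<open>On \<open>card H\<close> consecutive iterates of \<open>\<gamma> 1\<close> the orbit
  takes every value in \<open>H\<close>. If the limit took its values in \<open>H'\<close>, a
  conjugate of \<open>H'\<close> would contain \<open>H\<close>, against their
  cardinalities.\<close>

lemma recurrent_accumulation_minimal:
  assumes rec: "recurrent H h" and H: "subgroup H (sym_group d)" "H \<subseteq> G"
    and acc: "accumulation_point Cov (\<lambda>n. cover_class (orbit h n)) c"
    and H': "subgroup H' (sym_group d)" "H' \<subset> H"
  shows "c \<notin> cover_class ` Hom d \<Gamma> H'"
proof (rule notI)
  assume "c \<in> cover_class ` Hom d \<Gamma> H'"
  then obtain k where k: "k \<in> Hom d \<Gamma> H'" "c = cover_class k" by blast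
  have kG: "k \<in> HomG"
  proof -
    have "H' \<subseteq> G" using H'(2) H(2) by blast
    then show ?thesis
      using HomD[OF k(1)] by (intro HomI) (simp_all add: subset_iff)
  qed
  have h: "h \<in> HomG" using rec by (simp add: recurrent_def)
  obtain N where N: "\<And>n x. n \<ge> N \<Longrightarrow> x \<in> H \<Longrightarrow> \<exists>i<card H. orbit h (n + i) (\<gamma> 1) = x"
    using rec unfolding recurrent_def by blast
  define F where "F = (\<lambda>i. (\<Phi> ^^ i) (\<gamma> 1)) ` {..<card H}"
  have F: "finite F" "F \<subseteq> carrier \<Gamma>" by (auto simp: F_def)
  have "\<exists>\<^sub>F n in sequentially. \<exists>\<sigma>. conjugates \<sigma> F k (orbit h n)"
    using acc k(2) orbit_Hom[OF h] by (intro accumulation_in_Cov kG F) auto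
  from frequently_ex[OF frequently_eventually_conj[OF this eventually_ge_at_top[of N]]]
  obtain n \<sigma> where n: "n \<ge> N" "conjugates \<sigma> F k (orbit h n)" by blast
  have "H \<subseteq> (\<lambda>x. \<sigma> \<circ> x \<circ> inv' \<sigma>) ` H'"
  proof
    fix x assume "x \<in> H"
    then obtain i where i: "i < card H" "orbit h (n + i) (\<gamma> 1) = x"
      using N[OF n(1)] by blast
    let ?A = "(\<Phi> ^^ i) (\<gamma> 1)"
    have "x = orbit h n ?A"
      using i(2) by (simp add: orbit_add)
    also have "\<dots> = \<sigma> \<circ> k ?A \<circ> inv' \<sigma>"
    proof -
      have "\<forall>A\<in>F. orbit h n A = \<sigma> \<circ> k A \<circ> inv' \<sigma>"
        using n(2) unfolding conjugates_def by (rule conjunct2)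
      moreover have "?A \<in> F"
        using i(1) by (simp add: F_def)
      ultimately show ?thesis by (rule bspec)
    qed
    finally show "x \<in> (\<lambda>x. \<sigma> \<circ> x \<circ> inv' \<sigma>) ` H'"
      by (rule image_eqI[where x = "k ?A"]) (simp add: HomD(1)[OF k(1)])
  qed
  then have "card H \<le> card H'"
    using finite_subgroup_sym_group[OF H'(1)] by (meson card_image_le card_mono finite_imageI order_trans)
  moreover have "card H' < card H"
    using H'(2) finite_subgroup_sym_group[OF H(1)] by (rule psubset_card_mono[rotated])
  ultimately show False by simp
qed

lemma recurrent_exists:
  assumes h0: "h0 \<in> HomG" and H: "subgroup H (sym_group d)" "H \<subseteq> G"
  shows "\<exists>h. recurrent H h \<and> agree M h0 h"
proof -
  have card: "card H > 0" "card G > 0"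
    using finite_subgroup_sym_group[OF H(1)] finite_subgroup_sym_group[OF G]
      subgroup_sym_group_id[OF H(1)] subgroup_sym_group_id[OF G] by (auto simp: card_gt_0_iff)
  obtain eH where eH: "\<And>i. i < card H \<Longrightarrow> eH i \<in> H" "\<And>x. x \<in> H \<Longrightarrow> \<exists>i<card H. eH i = x"
    using finite_enumeration[OF finite_subgroup_sym_group[OF H(1)]] by blast
  obtain eG where eG: "\<And>i. i < card G \<Longrightarrow> eG i \<in> G" "\<And>x. x \<in> G \<Longrightarrow> \<exists>i<card G. eG i = x"
    using finite_enumeration[OF finite_subgroup_sym_group[OF G]] by blast
  \<comment> \<open>The prescribed orbit of \<open>\<gamma> 1\<close>: the first \<open>M\<close>
    terms are those of \<open>h0\<close>, which will fix \<open>h\<close> on the labels from 1 to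
    \<open>M\<close>; afterwards it cycles through \<open>H\<close>.\<close>
  define g where "g n = (if n < M then orbit h0 n (\<gamma> 1) else eH (n mod card H))" for n
  define T where "T = tower g"
  \<comment> \<open>For positive labels, \<open>g n = T n \<circ> h (\<gamma> (n + 1))\<close> is
    solved for \<open>h\<close>, so label \<open>m\<close> uses index \<open>m - 1\<close>. The
    labels from \<open>- M\<close> to 0 are copied from \<open>h0\<close>, and the enumeration of
    \<open>G\<close> starts at label \<open>- (M + 1)\<close>.\<close>
  define f where "f m = (if m > 0 then inv' (T (nat (m - 1))) \<circ> g (nat (m - 1))
      else if - m \<le> int M then h0 (\<gamma> m) else eG (nat (- m - int M - 1) mod card G))" for m
  have gH: "g n \<in> H" if "n \<ge> M" for n
    using that eH(1) card by (simp add: g_def)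
  have gG: "g n \<in> G" for n
    using gH[of n] H(2) HomD(1)[OF orbit_Hom[OF h0], of "\<gamma> 1" n] by (cases "n < M") (auto simp: g_def)
  have TG: "T n \<in> G" for n
    unfolding T_def by (intro tower_in G gG)
  have fG: "f m \<in> G" for m
    using gG TG HomD(1)[OF h0] eG(1) card
    by (auto simp: f_def intro!: subgroup_sym_group_comp[OF G] subgroup_sym_group_inv[OF G])
  let ?Gr = "sym_group d\<lparr>carrier := G\<rparr>"
  interpret L: edge_labelling ?Gr f
  proof -
    have "group ?Gr"
      using subgroup.subgroup_is_group[OF G sym_group_is_group] .
    then show "edge_labelling ?Gr f"
      by (simp add: edge_labelling_def edge_labelling_axioms_def fG)
  qed
  obtain h1 where h1: "h1 \<in> hom \<Gamma> ?Gr" "\<And>n. h1 (\<gamma> n) = f n"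
    using L.hom_with_values[OF s_interior] by blast
  define h where "h = restrict h1 (carrier \<Gamma>)"
  have h: "h \<in> HomG"
    using h1(1) by (auto simp: Hom_def hom_def h_def)
  have hf: "h (\<gamma> n) = f n" for n
    by (simp add: h_def h1(2))
  \<comment> \<open>The tower at \<open>n\<close> involves only earlier terms of the orbit, so
    strong induction identifies it with \<open>T n\<close>, and the inverse built into
    \<open>f\<close> cancels.\<close>
  have orb: "orbit h n (\<gamma> 1) = g n" for n
  proof (induction n rule: less_induct)
    case (less n)
    have "orbit h n (\<gamma> 1) = tower (\<lambda>i. orbit h i (\<gamma> 1)) n \<circ> h (\<gamma> (int n + 1))"
      by (rule orbit_gamma_tower[OF h]) simp
    also have "tower (\<lambda>i. orbit h i (\<gamma> 1)) n = T n"
      unfolding T_def using less by (intro tower_cong)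
    also have "h (\<gamma> (int n + 1)) = inv' (T n) \<circ> g n"
      by (simp add: hf f_def)
    also have "T n \<circ> (inv' (T n) \<circ> g n) = g n"
      using permutes_inv_o(1)[OF subgroup_sym_group_permutes[OF G TG]] by (simp flip: comp_assoc)
    finally show ?case .
  qed
  have "h0 (\<gamma> m) = f m" if m: "\<bar>m\<bar> \<le> int M" for m
  proof (cases "m > 0")
    case True
    \<comment> \<open>Below \<open>M\<close> the sequence \<open>g\<close> is the orbit of
      \<open>h0\<close>, so the towers agree and the recursion solved for \<open>f\<close> returns
      the old value.\<close>
    define n where "n = nat (m - 1)"
    have n: "m = int n + 1" "n < M" using True m by (auto simp: n_def)
    have "tower (\<lambda>i. orbit h0 i (\<gamma> 1)) n = T n"
      unfolding T_def using n(2) by (intro tower_cong) (simp add: g_def)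
    then have "g n = T n \<circ> h0 (\<gamma> m)"
      using orbit_gamma_tower[OF h0, of 1 n] n by (simp add: g_def)
    then have "f m = inv' (T n) \<circ> (T n \<circ> h0 (\<gamma> m))"
      using True by (simp add: f_def n_def)
    also have "\<dots> = h0 (\<gamma> m)"
      using permutes_inv_o(2)[OF subgroup_sym_group_permutes[OF G TG]] by (simp flip: comp_assoc)
    finally show ?thesis by simp
  qed (use m in \<open>auto simp: f_def\<close>)
  then have "agree M h0 h"
    using h0 h hf by (simp add: agree_def)
  moreover have "\<forall>x\<in>G. \<exists>n. h (\<gamma> n) = x"
  proof
    fix x assume "x \<in> G"
    then obtain i where i: "i < card G" "eG i = x" using eG(2) by blast
    then have "f (- (int M + 1 + int i)) = x"
      by (simp add: f_def)
    then show "\<exists>n. h (\<gamma> n) = x"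
      using hf by (intro exI[of _ "- (int M + 1 + int i)"]) simp
  qed
  moreover have "\<forall>n\<ge>M. orbit h n (\<gamma> 1) \<in> H \<and> (\<forall>x\<in>H. \<exists>i<card H. orbit h (n + i) (\<gamma> 1) = x)"
  proof (intro allI impI conjI ballI)
    fix n assume n: "M \<le> n"
    show "orbit h n (\<gamma> 1) \<in> H"
      using gH[OF n] orb by simp
    fix x assume "x \<in> H"
    then obtain j where j: "j < card H" "eH j = x" using eH(2) by blast
    obtain i where "i < card H" "(n + i) mod card H = j"
      using mod_window[OF j(1)] by blast
    then show "\<exists>i<card H. orbit h (n + i) (\<gamma> 1) = x"
      using n j(2) orb by (intro exI[of _ i]) (simp add: g_def)
  qed
  ultimately show ?thesis
    using h unfolding recurrent_def by blast
qed

theorem dense_recurrent_covers: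
  assumes H: "subgroup H (sym_group d)" "H \<subseteq> G" and trans: "acts_transitively d G"
  shows "\<exists>\<C> \<subseteq> topspace Cov. Cov closure_of \<C> = topspace Cov \<and>
    (\<forall>h\<in>HomG. cover_class h \<in> \<C> \<longrightarrow>
      (\<forall>i\<in>{1..d}. \<forall>j\<in>{1..d}. \<exists>n. h (\<gamma> n) i = j) \<and>
      (\<forall>c. accumulation_point Cov (\<lambda>n. cover_class (orbit h n)) c \<longrightarrow>
        c \<in> cover_class ` Hom d \<Gamma> H \<and>
        (\<forall>H'. subgroup H' (sym_group d) \<and> H' \<subset> H \<longrightarrow> c \<notin> cover_class ` Hom d \<Gamma> H')))"
proof -
  define \<C> where "\<C> = cover_class ` {h. recurrent H h}"
  have "\<C> \<subseteq> topspace Cov"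
    by (auto simp: \<C>_def topspace_Cov recurrent_def)
  moreover have "(Cov closure_of \<C>) = topspace Cov"
  proof (rule equalityI[OF closure_of_subset_topspace], rule subsetI)
    fix c assume c: "c \<in> topspace Cov"
    show "c \<in> Cov closure_of \<C>"
      unfolding in_closure_of
    proof (intro conjI allI impI c)
      fix V assume V: "c \<in> V \<and> openin Cov V"
      obtain h0 where h0: "h0 \<in> HomG" "c = cover_class h0"
        using c unfolding topspace_Cov by blast
      have "openin (Hom_topology d \<Gamma> G) {h \<in> HomG. cover_class h \<in> V}"
        using V openin_Cov_iff by blast
      moreover have "h0 \<in> {h \<in> HomG. cover_class h \<in> V}"
        using h0 V by simp
      ultimately obtain F where F: "finite F" "F \<subseteq> carrier \<Gamma>"
        "\<forall>h'\<in>HomG. (\<forall>A\<in>F. h' A = h0 A) \<longrightarrow> h' \<in> {h \<in> HomG. cover_class h \<in> V}"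
        unfolding openin_Hom_topology_iff by meson
      obtain M where M: "\<And>h h'. agree M h h' \<Longrightarrow> \<forall>A\<in>F. h A = h' A"
        using Hom_agree_finite[OF F(1,2)] by blast
      obtain h where h: "recurrent H h" "agree M h0 h"
        using recurrent_exists[OF h0(1) H] by blast
      have "cover_class h \<in> V"
        using F(3) M[OF h(2)] agree_Hom(2)[OF h(2)] by simp
      then show "\<exists>y. y \<in> \<C> \<and> y \<in> V"
        using h(1) by (auto simp: \<C>_def)
    qed
  qed
  moreover have "(\<forall>i\<in>{1..d}. \<forall>j\<in>{1..d}. \<exists>n. h (\<gamma> n) i = j) \<and>
      (\<forall>c. accumulation_point Cov (\<lambda>n. cover_class (orbit h n)) c \<longrightarrow>
        c \<in> cover_class ` Hom d \<Gamma> H \<and>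
        (\<forall>H'. subgroup H' (sym_group d) \<and> H' \<subset> H \<longrightarrow> c \<notin> cover_class ` Hom d \<Gamma> H'))"
    if h: "h \<in> HomG" "cover_class h \<in> \<C>" for h
  proof -
    \<comment> \<open>A class in the collection is only known to contain some recurrent
      homomorphism. Its properties are carried to the given \<open>h\<close> by a conjugator, which
      need not lie in \<open>G\<close> but permutes the sheets.\<close>
    obtain h' where h': "recurrent H h'" "cover_class h' = cover_class h"
      using h(2) by (auto simp: \<C>_def)
    obtain \<sigma> where \<sigma>: "conjugates \<sigma> (carrier \<Gamma>) h' h"
      using cover_class_eqD[OF h(1) h'(2)] by blast
    then have perm: "\<sigma> permutes {1..d}" by (simp add: conjugates_def)
    have "\<exists>n. h (\<gamma> n) i = j" if ij: "i \<in> {1..d}" "j \<in> {1..d}" for i j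
    proof -
      have "inv' \<sigma> i \<in> {1..d}" "inv' \<sigma> j \<in> {1..d}"
        using ij permutes_in_image[OF permutes_inv[OF perm]] by blast+
      then obtain x where x: "x \<in> G" "x (inv' \<sigma> i) = inv' \<sigma> j"
        using trans unfolding acts_transitively_def by blast
      then obtain n where n: "h' (\<gamma> n) = x"
        using h'(1) by (auto simp: recurrent_def)
      have "h (\<gamma> n) i = \<sigma> (h' (\<gamma> n) (inv' \<sigma> i))"
        using \<sigma> by (simp add: conjugates_def)
      also have "\<dots> = j"
        using n x(2) perm by (simp add: permutes_inverses)
      finally show ?thesis by blast
    qed
    moreover have "cover_class (orbit h n) = cover_class (orbit h' n)" for n
      using cover_class_eqI[OF conjugates_orbit[OF \<sigma>]] by simp
    ultimately show ?thesis
      using recurrent_accumulation[OF h'(1) H] recurrent_accumulation_minimal[OF h'(1) H] by simp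
  qed
  ultimately show ?thesis
    by (intro exI[of _ \<C>]) blast
qed

end

section \<open>The covers\<close>

lemma connected_square: "connected square"
  using connected_intermediate_closure[OF convex_connected[OF convex_square_interior]
      interior_edge_subset_square(1) square_subset_closure] .

lemma cover_point_eq_iff:
  "cover_point s d h p = cover_point s d h q \<longleftrightarrow> (p, q) \<in> (sheet_gluing s d h \<union> (sheet_gluing s d h)\<inverse>)\<^sup>*"
proof -
  let ?R = "(sheet_gluing s d h \<union> (sheet_gluing s d h)\<inverse>)\<^sup>*"
  have sym: "sym ?R"
    by (simp add: sym_Un_converse sym_rtrancl)
  show ?thesis
  proof
    assume "cover_point s d h p = cover_point s d h q"
    moreover have "q \<in> cover_point s d h q" by (simp add: cover_point_def)
    ultimately have "q \<in> cover_point s d h p" by simp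
    then show "(p, q) \<in> ?R" by (simp add: cover_point_def)
  next
    assume pq: "(p, q) \<in> ?R"
    then have qp: "(q, p) \<in> ?R" using symD[OF sym] by blast
    show "cover_point s d h p = cover_point s d h q"
      unfolding cover_point_def using rtrancl_trans[OF pq] rtrancl_trans[OF qp] by blast
  qed
qed

lemma cover_point_glue:
  assumes "z \<in> exit_edge n" "j \<in> {1..d}"
  shows "cover_point s d h (z, h (gamma s n) j) = cover_point s d h (z + edge_shift n, j)"
  unfolding cover_point_eq_iff sheet_gluing_def using assms by (intro r_into_rtrancl) blast

text \<open>Each sheet has connected image. A generator taking \<open>j\<close> to \<open>i\<close>
  glues an edge of sheet \<open>i\<close> to sheet \<open>j\<close>, so the images of any two sheets
  share a point.\<close>

lemma connected_cover:
  assumes d: "d \<ge> 1" and trans: "\<And>i j. i \<in> {1..d} \<Longrightarrow> j \<in> {1..d} \<Longrightarrow> \<exists>n. h (gamma s n) i = j"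
  shows "connected_space (cover_topology s d h)"
proof -
  let ?X = "prod_topology (top_of_set square) (discrete_topology {1..d})"
  let ?Q = "cover_topology s d h" and ?f = "cover_point s d h"
  have q: "quotient_map ?X ?Q ?f"
    unfolding cover_topology_def by (rule quotient_map_quotient_topology)
  have top: "topspace ?Q = ?f ` (square \<times> {1..d})"
    using quotient_imp_surjective_map[OF q] by simp
  define S where "S j = ?f ` (square \<times> {j})" for j
  have conn: "connectedin ?Q (S j)" if "j \<in> {1..d}" for j
    unfolding S_def
  proof (rule connectedin_continuous_map_image[OF quotient_imp_continuous_map[OF q]])
    show "connectedin ?X (square \<times> {j})"
      using that connected_square by (simp add: connectedin_Times connectedin_subtopology connectedin_sing)
  qed
  have meet: "S i \<inter> S j \<noteq> {}" if i: "i \<in> {1..d}" and j: "j \<in> {1..d}" for i j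
  proof -
    obtain n where n: "h (gamma s n) j = i"
      using trans[OF j i] by blast
    have "?f (exit_midpoint n, i) = ?f (exit_midpoint n + edge_shift n, j)"
      using cover_point_glue[OF exit_midpoint_in_exit_edge j, of s h n] n by simp
    then have "?f (exit_midpoint n, i) \<in> S i \<inter> S j"
      using exit_midpoint_square[of n] by (auto simp: S_def)
    then show ?thesis by blast
  qed
  have "connectedin ?Q (\<Union>j\<in>{1..d}. S 1 \<union> S j)"
  proof (rule connectedin_Union)
    show "connectedin ?Q T" if "T \<in> (\<lambda>j. S 1 \<union> S j) ` {1..d}" for T
      using that d conn meet by (auto intro!: connectedin_Un)
    show "\<Inter>((\<lambda>j. S 1 \<union> S j) ` {1..d}) \<noteq> {}"
      using meet[of 1 1] d by auto
  qed
  moreover have "(\<Union>j\<in>{1..d}. S 1 \<union> S j) = topspace ?Q"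
    unfolding top S_def using d by auto
  ultimately show ?thesis
    by (simp add: connectedin_topspace)
qed

section \<open>Lebesgue measure on the cover\<close>

lemma square_borel: "square \<in> sets borel"
proof -
  have "{a} \<times> {b<..<c} \<in> sets (borel :: (real \<times> real) measure)" "{b<..<c} \<times> {a} \<in> sets (borel :: (real \<times> real) measure)"
    for a b c :: real
    unfolding borel_prod[symmetric] by (intro pair_measureI; simp)+
  then have "exit_edge n \<in> sets borel" "entry_edge n \<in> sets borel" for n
    by (simp_all add: exit_edge_def entry_edge_def)
  moreover have "square_interior \<in> sets borel"
    using open_square_interior by (rule borel_open)
  ultimately show ?thesis
    unfolding square_def by (intro sets.Un sets.countable_UN'') auto
qed

lemma borel_in_lebesgue: "A \<in> sets borel \<Longrightarrow> A \<in> sets lebesgue"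
  by (simp add: sets_completionI_sets)

definition sheet_trace :: "real \<times> real \<Rightarrow> nat \<Rightarrow> ((real \<Rightarrow> chamanara) set \<Rightarrow> nat \<Rightarrow> nat) \<Rightarrow>
    nat \<Rightarrow> sheet_point set set \<Rightarrow> (real \<times> real) set" where
  "sheet_trace s d h i A = {z \<in> square. cover_point s d h (z, i) \<in> A}"

definition cover_sets :: "real \<times> real \<Rightarrow> nat \<Rightarrow> ((real \<Rightarrow> chamanara) set \<Rightarrow> nat \<Rightarrow> nat) \<Rightarrow> sheet_point set set set" where
  "cover_sets s d h = {A. A \<subseteq> cover_point s d h ` sheets d \<and> (\<forall>i\<in>{1..d}. sheet_trace s d h i A \<in> sets lebesgue)}"

lemma cover_measure_eq:
  "cover_measure s d h = measure_of (cover_point s d h ` sheets d) (cover_sets s d h)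
     (\<lambda>A. \<Sum>i=1..d. emeasure lebesgue (sheet_trace s d h i A))"
  unfolding cover_measure_def cover_sets_def sheet_trace_def ..

lemma sheet_trace_space: "i \<in> {1..d} \<Longrightarrow> sheet_trace s d h i (cover_point s d h ` sheets d) = square"
  by (auto simp: sheet_trace_def sheets_def)

text \<open>\<open>measure_of\<close> has the intended sets and values only after the family is
  known to be a sigma-algebra and the set function to be countably additive. Both are inherited
  sheet by sheet from planar Lebesgue measure.\<close>

lemma sigma_algebra_cover_sets: "sigma_algebra (cover_point s d h ` sheets d) (cover_sets s d h)"
proof (rule sigma_algebra_iff2[THEN iffD2], intro conjI ballI allI impI)
  let ?\<Omega> = "cover_point s d h ` sheets d"
  show "cover_sets s d h \<subseteq> Pow ?\<Omega>" by (auto simp: cover_sets_def)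
  show "{} \<in> cover_sets s d h" by (auto simp: cover_sets_def sheet_trace_def)
  fix A assume A: "A \<in> cover_sets s d h"
  have "sheet_trace s d h i (?\<Omega> - A) = square - sheet_trace s d h i A" if "i \<in> {1..d}" for i
    using sheet_trace_space[OF that, of s h] by (auto simp: sheet_trace_def)
  then show "?\<Omega> - A \<in> cover_sets s d h"
    using A borel_in_lebesgue[OF square_borel] by (auto simp: cover_sets_def)
next
  fix A :: "nat \<Rightarrow> _" assume A: "range A \<subseteq> cover_sets s d h"
  have "sheet_trace s d h i (\<Union>n. A n) = (\<Union>n. sheet_trace s d h i (A n))" for i
    by (auto simp: sheet_trace_def)
  moreover have "sheet_trace s d h i (A n) \<in> sets lebesgue" if "i \<in> {1..d}" for i n
  proof -
    have "A n \<in> cover_sets s d h" using A by blast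
    then show ?thesis using that by (simp add: cover_sets_def)
  qed
  ultimately show "(\<Union>n. A n) \<in> cover_sets s d h"
    using A by (auto simp: cover_sets_def)
qed

lemma sets_cover_measure: "sets (cover_measure s d h) = cover_sets s d h"
  unfolding cover_measure_eq by (rule sigma_algebra.sets_measure_of_eq[OF sigma_algebra_cover_sets])

lemma space_cover_measure: "space (cover_measure s d h) = cover_point s d h ` sheets d"
  unfolding cover_measure_eq by (rule space_measure_of) (auto simp: cover_sets_def)

lemma emeasure_cover_measure:
  assumes "A \<in> cover_sets s d h"
  shows "emeasure (cover_measure s d h) A = (\<Sum>i=1..d. emeasure lebesgue (sheet_trace s d h i A))"
  unfolding cover_measure_eq
proof (rule emeasure_measure_of_sigma[OF sigma_algebra_cover_sets _ _ assms])
  let ?\<mu> = "\<lambda>A. \<Sum>i=1..d. emeasure lebesgue (sheet_trace s d h i A)"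
  show "positive (cover_sets s d h) ?\<mu>"
    by (simp add: positive_def sheet_trace_def)
  show "countably_additive (cover_sets s d h) ?\<mu>"
  proof (rule countably_additiveI)
    fix A :: "nat \<Rightarrow> _" assume A: "range A \<subseteq> cover_sets s d h" "disjoint_family A"
    have "(\<Sum>n. ?\<mu> (A n)) = (\<Sum>i=1..d. \<Sum>n. emeasure lebesgue (sheet_trace s d h i (A n)))"
      by (rule suminf_sum) (rule summableI)
    also have "\<dots> = ?\<mu> (\<Union>n. A n)"
    proof (rule sum.cong[OF refl])
      fix i assume i: "i \<in> {1..d}"
      have "(\<Sum>n. emeasure lebesgue (sheet_trace s d h i (A n))) = emeasure lebesgue (\<Union>n. sheet_trace s d h i (A n))"
      proof (rule suminf_emeasure)
        show "range (\<lambda>n. sheet_trace s d h i (A n)) \<subseteq> sets lebesgue"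
        proof
          fix X assume "X \<in> range (\<lambda>n. sheet_trace s d h i (A n))"
          then obtain n where X: "X = sheet_trace s d h i (A n)" by blast
          have "A n \<in> cover_sets s d h" using A(1) by blast
          then show "X \<in> sets lebesgue" using i X by (simp add: cover_sets_def)
        qed
        show "disjoint_family (\<lambda>n. sheet_trace s d h i (A n))"
          using A(2) by (auto simp: disjoint_family_on_def sheet_trace_def)
      qed
      also have "(\<Union>n. sheet_trace s d h i (A n)) = sheet_trace s d h i (\<Union>n. A n)"
        by (auto simp: sheet_trace_def)
      finally show "(\<Sum>n. emeasure lebesgue (sheet_trace s d h i (A n))) = emeasure lebesgue (sheet_trace s d h i (\<Union>n. A n))" .
    qed
    finally show "(\<Sum>n. ?\<mu> (A n)) = ?\<mu> (\<Union>n. A n)" .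
  qed
qed

text \<open>A nonempty open set in one sheet already has positive planar measure.\<close>

lemma not_null_cover:
  assumes "A \<in> cover_sets s d h" "i \<in> {1..d}" "open S" "S \<noteq> {}" "S \<subseteq> sheet_trace s d h i A"
  shows "A \<notin> null_sets (cover_measure s d h)"
proof
  assume "A \<in> null_sets (cover_measure s d h)"
  then have "(\<Sum>i=1..d. emeasure lebesgue (sheet_trace s d h i A)) = 0"
    using emeasure_cover_measure[OF assms(1)] by (simp add: null_setsD1)
  then have "emeasure lebesgue (sheet_trace s d h i A) = 0"
    using assms(2) by (simp add: sum_eq_0_iff)
  moreover have "sheet_trace s d h i A \<in> sets lebesgue"
    using assms(1,2) by (simp add: cover_sets_def)
  ultimately have "negligible (sheet_trace s d h i A)"
    by (simp add: negligible_iff_null_sets null_setsI)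
  then have "negligible S"
    using assms(5) negligible_subset by blast
  then show False
    using open_not_negligible assms(3,4) by blast
qed

section \<open>Binary digits and the odometer\<close>

text \<open>Counting starts at 0 with the first binary place after the point, the most significant
  one; the odometer below carries towards later places.\<close>

definition digit :: "nat \<Rightarrow> real \<Rightarrow> bool" where
  "digit n y \<longleftrightarrow> odd \<lfloor>2 ^ Suc n * y\<rfloor>"

text \<open>Later digits act on the left. Passing to more digits therefore applies further
  permutations to a sheet already transported by the earlier ones.\<close>

fun digit_product :: "(nat \<Rightarrow> nat \<Rightarrow> nat) \<Rightarrow> nat \<Rightarrow> real \<Rightarrow> nat \<Rightarrow> nat" where
  "digit_product g 0 y = id"
| "digit_product g (Suc n) y = (if digit n y then g n else id) \<circ> digit_product g n y"

lemma digit_small: "0 \<le> y \<Longrightarrow> 2 ^ Suc n * y < 1 \<Longrightarrow> \<not> digit n y"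
proof -
  assume "0 \<le> y" "2 ^ Suc n * y < 1"
  then have "\<lfloor>2 ^ Suc n * y\<rfloor> = 0"
    by (intro floor_unique) auto
  then show ?thesis by (simp add: digit_def)
qed

lemma digit_product_small:
  assumes "0 \<le> y" "2 ^ n * y < 1"
  shows "digit_product g n y = id"
  using assms(2)
proof (induction n)
  case (Suc n)
  have "2 ^ n * y \<le> 2 ^ Suc n * y"
    using assms(1) by simp
  then show ?case
    using Suc digit_small[OF assms(1), of n] by simp
qed simp

text \<open>Heights on the exit side of edge \<open>k + 1\<close> begin with \<open>k\<close> ones
  followed by a zero: the digits about to be carried.\<close>

lemma exit_digits:
  assumes "1 - 1 / 2 ^ k < y" "y < 1 - 1 / 2 ^ Suc k"
  shows "j < k \<Longrightarrow> digit j y" "\<not> digit k y"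
proof -
  assume j: "j < k"
  have "(2::real) ^ Suc j \<le> 2 ^ k" using j by (intro power_increasing) auto
  then have "2 ^ Suc j * (1 / 2 ^ k) \<le> (1::real)" by (simp add: field_simps)
  moreover have "2 ^ Suc j * (1 - 1 / 2 ^ k) < 2 ^ Suc j * y"
    using assms(1) by (intro mult_strict_left_mono) auto
  moreover have "1 - 1 / 2 ^ Suc k \<le> (1::real)" by simp
  then have "2 ^ Suc j * y < 2 ^ Suc j * 1"
    using assms(2) by (intro mult_strict_left_mono) (linarith, simp)
  moreover have "2 ^ Suc j * (1 - 1 / 2 ^ k) = 2 ^ Suc j - 2 ^ Suc j * (1 / 2 ^ k :: real)"
    by (simp only: right_diff_distrib mult_1_right)
  ultimately have "2 ^ Suc j - 1 \<le> 2 ^ Suc j * y" "2 ^ Suc j * y < 2 ^ Suc j"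
    by linarith+
  then have "\<lfloor>2 ^ Suc j * y\<rfloor> = 2 ^ Suc j - 1"
    by (intro floor_unique) simp_all
  then show "digit j y" by (simp add: digit_def)
next
  have "2 ^ Suc k * (1 - 1 / 2 ^ k) < 2 ^ Suc k * y" "2 ^ Suc k * y < 2 ^ Suc k * (1 - 1 / 2 ^ Suc k)"
    using assms by (intro mult_strict_left_mono; simp)+
  then have "2 ^ Suc k - 2 < 2 ^ Suc k * y" "2 ^ Suc k * y < 2 ^ Suc k - 1"
    by (simp_all add: right_diff_distrib)
  then have "\<lfloor>2 ^ Suc k * y\<rfloor> = 2 ^ Suc k - 2"
    by (intro floor_unique) simp_all
  then show "\<not> digit k y" by (simp add: digit_def)
qed

text \<open>Heights on the entry side of edge \<open>k + 1\<close> begin with \<open>k\<close> zeros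
  followed by a one: the digits after the carry.\<close>

lemma entry_digits:
  assumes "1 / 2 ^ Suc k < y" "y < 1 / 2 ^ k"
  shows "j < k \<Longrightarrow> \<not> digit j y" "digit k y"
proof -
  have "0 < y" using assms(1) by (rule le_less_trans[rotated]) simp
  assume j: "j < k"
  have "(2::real) ^ Suc j \<le> 2 ^ k" using j by (intro power_increasing) auto
  then have "2 ^ Suc j * y \<le> 2 ^ k * y" using \<open>0 < y\<close> by (intro mult_right_mono) auto
  also have "\<dots> < 2 ^ k * (1 / 2 ^ k)" using assms(2) by (intro mult_strict_left_mono) auto
  finally show "\<not> digit j y"
    using \<open>0 < y\<close> by (intro digit_small) auto
next
  have "2 ^ Suc k * (1 / 2 ^ Suc k) < 2 ^ Suc k * y" "2 ^ Suc k * y < 2 ^ Suc k * (1 / 2 ^ k)"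
    using assms by (intro mult_strict_left_mono; simp)+
  then have "\<lfloor>2 ^ Suc k * y\<rfloor> = 1"
    by (intro floor_unique) simp_all
  then show "digit k y" by (simp add: digit_def)
qed

text \<open>The translation across edge \<open>k + 1\<close>, scaled by \<open>2 ^ Suc j\<close>
  with \<open>j > k\<close>, is an even integer and leaves the parity of the floor
  unchanged.\<close>

lemma odometer_digits:
  assumes "k < j"
  shows "digit j (y + 3 / 2 ^ Suc k - 1) = digit j y"
proof -
  obtain m where m: "j = Suc (k + m)" using assms less_iff_Suc_add by blast
  have "2 ^ Suc j * (y + 3 / 2 ^ Suc k - 1) = 2 ^ Suc j * y + real_of_int (2 * (3 * 2 ^ m - 2 ^ j))"
    by (simp add: m algebra_simps power_add)
  then have "\<lfloor>2 ^ Suc j * (y + 3 / 2 ^ Suc k - 1)\<rfloor> = \<lfloor>2 ^ Suc j * y\<rfloor> + 2 * (3 * 2 ^ m - 2 ^ j)"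
    by (simp only: floor_add_int)
  then show ?thesis
    by (simp add: digit_def)
qed

lemma digit_product_measurable: "(\<lambda>y. digit_product g n y i) \<in> borel \<rightarrow>\<^sub>M count_space UNIV"
proof (induction n)
  case (Suc n)
  have [measurable]: "Measurable.pred borel (digit n)"
  proof -
    have "(\<lambda>y::real. \<lfloor>2 ^ Suc n * y\<rfloor>) \<in> borel \<rightarrow>\<^sub>M count_space UNIV"
      by measurable
    then show ?thesis
      unfolding digit_def by (rule measurable_compose) simp
  qed
  have "(\<lambda>y. g n (digit_product g n y i)) \<in> borel \<rightarrow>\<^sub>M count_space UNIV"
    using Suc by (rule measurable_compose) simp
  then have "(\<lambda>y. if digit n y then g n (digit_product g n y i) else digit_product g n y i) \<in> borel \<rightarrow>\<^sub>M count_space UNIV"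
    using Suc by measurable
  moreover have "digit_product g (Suc n) y i = (if digit n y then g n (digit_product g n y i) else digit_product g n y i)" for y
    by simp
  ultimately show ?case
    by presburger
qed simp

context monodromy
begin

section \<open>Non-ergodicity\<close>

lemma digit_product_exit:
  assumes "1 - 1 / 2 ^ k < y" "y < 1 - 1 / 2 ^ Suc k"
  shows "digit_product g (Suc k) y = tower g k"
proof -
  have "digit_product g j y = tower g j" if "j \<le> k" for j
    using that exit_digits(1)[OF assms] by (induction j) auto
  then show ?thesis
    using exit_digits(2)[OF assms] by simp
qed

lemma digit_product_entry:
  assumes "1 / 2 ^ Suc k < y" "y < 1 / 2 ^ k"
  shows "digit_product g (Suc k) y = g k"
proof -
  have "digit_product g j y = id" if "j \<le> k" for j
    using that entry_digits(1)[OF assms] by (induction j) auto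
  then show ?thesis
    using entry_digits(2)[OF assms] by simp
qed

text \<open>The cocycle equation. With \<open>k + 1\<close> digits the two sides are
  \<open>g k\<close> and the tower of height \<open>k\<close> followed by a generator, so the
  equation is \<open>orbit_gamma_tower\<close>; further digits agree on both sides and act by a
  common left factor.\<close>

lemma digit_product_odometer:
  assumes h: "h \<in> HomG" and y: "1 - 1 / 2 ^ k < y" "y < 1 - 1 / 2 ^ Suc k" and n: "Suc k \<le> n"
  shows "digit_product (\<lambda>i. orbit h i (\<gamma> 1)) n (y + 3 / 2 ^ Suc k - 1)
    = digit_product (\<lambda>i. orbit h i (\<gamma> 1)) n y \<circ> h (\<gamma> (int k + 1))"
  using n
proof (induction n rule: dec_induct)
  case base
  have e: "1 / 2 ^ Suc k < y + 3 / 2 ^ Suc k - 1" "y + 3 / 2 ^ Suc k - 1 < 1 / 2 ^ k"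
  proof -
    have "1 / 2 ^ k = 2 * (1 / 2 ^ Suc k :: real)" "3 / 2 ^ Suc k = 3 * (1 / 2 ^ Suc k :: real)"
      by simp_all
    then show "1 / 2 ^ Suc k < y + 3 / 2 ^ Suc k - 1" "y + 3 / 2 ^ Suc k - 1 < 1 / 2 ^ k"
      using y by linarith+
  qed
  show ?case
    unfolding digit_product_entry[OF e] digit_product_exit[OF y]
    by (rule orbit_gamma_tower[OF h zero_less_one])
next
  case (step n)
  then show ?case
    using odometer_digits[of k n y] by (simp add: comp_assoc)
qed

theorem not_ergodic:
  assumes h: "h \<in> HomG" and H: "subgroup H (sym_group d)" "\<not> acts_transitively d H"
    and acc: "\<And>k. accumulation_point (Hom_topology d \<Gamma> G) (orbit h) k \<Longrightarrow> k \<in> Hom d \<Gamma> H"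
  shows "\<not> flow_ergodic s d h"
proof -
  define g where "g i = orbit h i (\<gamma> 1)" for i
  have "\<exists>N. \<forall>n\<ge>N. g n \<in> H"
  proof (rule ccontr)
    assume "\<not> ?thesis"
    then have freq: "\<exists>\<^sub>F n in sequentially. orbit h n \<in> {k \<in> HomG. k (\<gamma> 1) \<notin> H}"
      using orbit_Hom[OF h] by (simp add: frequently_sequentially g_def)
    \<comment> \<open>The condition reads off a single value, so both it and its negation are open.
      Compactness then turns infinitely many visits outside \<open>H\<close> into an accumulation
      point outside \<open>Hom d \<Gamma> H\<close>.\<close>
    have "openin (Hom_topology d \<Gamma> G) (HomG - {k \<in> HomG. k (\<gamma> 1) \<notin> H})"
      unfolding openin_Hom_topology_iff
    proof (intro conjI ballI)
      fix k assume "k \<in> HomG - {k \<in> HomG. k (\<gamma> 1) \<notin> H}"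
      then show "\<exists>F. finite F \<and> F \<subseteq> carrier \<Gamma> \<and>
          (\<forall>h'\<in>HomG. (\<forall>g\<in>F. h' g = k g) \<longrightarrow> h' \<in> HomG - {k \<in> HomG. k (\<gamma> 1) \<notin> H})"
        by (intro exI[of _ "{\<gamma> 1}"]) simp
    qed auto
    then have "closedin (Hom_topology d \<Gamma> G) {k \<in> HomG. k (\<gamma> 1) \<notin> H}"
      by (simp add: closedin_def)
    from compact_space_accumulation_point[OF
        compact_space_Hom_topology[OF finite_subgroup_sym_group[OF G] group_fundamental_group] this freq]
    obtain k where k: "k (\<gamma> 1) \<notin> H" "accumulation_point (Hom_topology d \<Gamma> G) (orbit h) k"
      by blast
    then show False
      using HomD(1)[OF acc, of k "\<gamma> 1"] by simp
  qed
  then obtain N where N: "\<And>n. n \<ge> N \<Longrightarrow> g n \<in> H" by blast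
  \<comment> \<open>Intransitivity of \<open>H\<close> separates two sheets: the
    \<open>H\<close>-orbit \<open>Ob\<close> of \<open>i0\<close> does not contain
    \<open>j0\<close>.\<close>
  obtain i0 j0 where ij: "i0 \<in> {1..d}" "j0 \<in> {1..d}" "\<And>x. x \<in> H \<Longrightarrow> x i0 \<noteq> j0"
    using H(2) unfolding acts_transitively_def by blast
  define Ob where "Ob = (\<lambda>x. x i0) ` H"
  have ObI: "x i0 \<in> Ob" if "x \<in> H" for x
    using that by (simp add: Ob_def)
  have i0: "i0 \<in> Ob"
    using ObI[OF subgroup_sym_group_id[OF H(1)]] by simp
  have j0: "j0 \<notin> Ob"
    using ij(3) by (auto simp: Ob_def)
  have Ob_stable: "x v \<in> Ob \<longleftrightarrow> v \<in> Ob" if x: "x \<in> H" for x v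
  proof
    assume "v \<in> Ob"
    then obtain y where y: "y \<in> H" "v = y i0" by (auto simp: Ob_def)
    show "x v \<in> Ob"
      using ObI[OF subgroup_sym_group_comp[OF H(1) x y(1)]] y(2) by simp
  next
    assume "x v \<in> Ob"
    then obtain y where y: "y \<in> H" "x v = y i0" by (auto simp: Ob_def)
    have "v = inv' x (x v)"
      using permutes_inverses(2)[OF subgroup_sym_group_permutes[OF H(1) x]] by simp
    then have "v = (inv' x \<circ> y) i0" using y(2) by simp
    then show "v \<in> Ob"
      using ObI[OF subgroup_sym_group_comp[OF H(1) subgroup_sym_group_inv[OF H(1) x] y(1)]] by simp
  qed
  define P where "P = digit_product g N"
  \<comment> \<open>Digits from \<open>N\<close> on contribute elements of \<open>H\<close>, which
    preserve \<open>Ob\<close>; the truncation at \<open>N\<close> may be replaced by any longer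
    one.\<close>
  have P_stable: "digit_product g n y v \<in> Ob \<longleftrightarrow> P y v \<in> Ob" if "n \<ge> N" for n y v
    using that
  proof (induction n rule: dec_induct)
    case (step n)
    then show ?case
      using Ob_stable[OF N[of n]] by simp
  qed (simp add: P_def)
  \<comment> \<open>Excluding heights 0 and 1 makes \<open>W\<close> false on both copies of every
    horizontal edge, so it respects those gluings trivially and only vertical edges require the
    cocycle.\<close>
  define W :: "sheet_point \<Rightarrow> bool" where "W = (\<lambda>(z, i). 0 < snd z \<and> snd z < 1 \<and> P (snd z) i \<in> Ob)"
  have W_glue: "W (z, h (\<gamma> n) j) \<longleftrightarrow> W (z + edge_shift n, j)" if z: "z \<in> exit_edge n" for z n j
  proof (cases "n > 0")
    case False
    then show ?thesis
      using z by (auto simp: W_def exit_edge_eq edge_shift_eq)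
  next
    case True
    define k where "k = nat (n - 1)"
    have n: "n = int k + 1" using True by (simp add: k_def)
    have len: "edge_len n = 1 / 2 ^ Suc k"
    proof -
      have "(2::real) powi (- int (Suc k)) = 1 / 2 ^ Suc k"
        by (simp only: power_int_minus power_int_of_nat inverse_eq_divide)
      then show ?thesis by (simp add: edge_len_def n add.commute)
    qed
    obtain y where y: "z = (1, y)" "1 - 2 * edge_len n < y" "y < 1 - edge_len n"
      using z True by (auto simp: exit_edge_eq)
    have y': "1 - 1 / 2 ^ k < y" "y < 1 - 1 / 2 ^ Suc k"
      using y(2,3) by (simp_all add: len)
    have shift: "z + edge_shift n = (0, y + 3 / 2 ^ Suc k - 1)"
      using True y(1) by (simp add: edge_shift_eq len)
    have bounds: "0 < y" "y < 1" "0 < y + 3 / 2 ^ Suc k - 1" "y + 3 / 2 ^ Suc k - 1 < 1"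
    proof -
      have "3 / 2 ^ Suc k = 3 * edge_len n" by (simp add: len)
      then show "0 < y" "y < 1" "0 < y + 3 / 2 ^ Suc k - 1" "y + 3 / 2 ^ Suc k - 1 < 1"
        using y(2,3) edge_len_pos[of n] edge_len_le_half[of n] by linarith+
    qed
    \<comment> \<open>Enough digits for both purposes: at least \<open>N\<close> for stability of
      the orbit and at least \<open>k + 1\<close> for the cocycle equation at this edge.\<close>
    let ?m = "max N (Suc k)"
    have "P (y + 3 / 2 ^ Suc k - 1) j \<in> Ob \<longleftrightarrow> digit_product g ?m (y + 3 / 2 ^ Suc k - 1) j \<in> Ob"
      by (rule P_stable[symmetric]) simp
    also have "\<dots> \<longleftrightarrow> digit_product g ?m y (h (\<gamma> n) j) \<in> Ob"
      using digit_product_odometer[OF h y', of ?m] unfolding g_def n by simp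
    also have "\<dots> \<longleftrightarrow> P y (h (\<gamma> n) j) \<in> Ob"
      by (rule P_stable) simp
    finally show ?thesis
      unfolding shift using bounds y(1) by (simp add: W_def)
  qed
  have W_invariant: "W p \<longleftrightarrow> W q" if "cover_point s d h p = cover_point s d h q" for p q
    using that unfolding cover_point_eq_iff
  proof induction
    case (step u v)
    have "W a \<longleftrightarrow> W b" if "(a, b) \<in> sheet_gluing s d h" for a b
      using that W_glue by (auto simp: sheet_gluing_def)
    then show ?case
      using step by (metis UnE converseD)
  qed simp
  define A where "A = cover_point s d h ` {p \<in> sheets d. W p}"
  have mem_A: "cover_point s d h p \<in> A \<longleftrightarrow> W p" if "p \<in> sheets d" for p
  proof
    assume "cover_point s d h p \<in> A"
    then obtain q where "W q" "cover_point s d h p = cover_point s d h q"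
      by (auto simp: A_def)
    then show "W p" using W_invariant[of p q] by blast
  next
    assume "W p"
    with that show "cover_point s d h p \<in> A" by (simp add: A_def)
  qed
  have trace: "sheet_trace s d h i A = square \<inter> {z. W (z, i)}" if "i \<in> {1..d}" for i
    using that mem_A by (auto simp: sheet_trace_def sheets_def)
  have W_borel: "{z. W (z, i)} \<in> sets borel" for i
  proof -
    have "(\<lambda>z::real \<times> real. P (snd z) i) \<in> borel \<rightarrow>\<^sub>M count_space UNIV"
      unfolding P_def borel_prod[symmetric] by (rule measurable_compose[OF measurable_snd digit_product_measurable])
    then have "(\<lambda>z::real \<times> real. P (snd z) i) -` Ob \<inter> space borel \<in> sets borel"
      by (rule measurable_sets) simp
    moreover have "open {z::real \<times> real. 0 < snd z}" "open {z::real \<times> real. snd z < 1}"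
      by (auto intro!: open_Collect_less continuous_intros)
    moreover have "{z. W (z, i)} = ((\<lambda>z::real \<times> real. P (snd z) i) -` Ob \<inter> space borel) \<inter> ({z. 0 < snd z} \<inter> {z. snd z < 1})"
      by (auto simp: W_def)
    ultimately show ?thesis
      by (simp only: sets.Int borel_open)
  qed
  have A_sets: "A \<in> cover_sets s d h"
    unfolding cover_sets_def using trace W_borel square_borel
    by (auto simp: A_def intro!: borel_in_lebesgue)
  \<comment> \<open>In this strip the first \<open>N\<close> digits vanish, so nothing is
    transported and \<open>W\<close> just asks whether the sheet is in \<open>Ob\<close>. It lies
    entirely in the trace of the invariant set on sheet \<open>i0\<close>, and entirely in that of
    the complement on sheet \<open>j0\<close>.\<close>
  define S where "S = {0<..<1::real} \<times> {0<..<1 / 2 ^ N :: real}"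
  have S: "open S" "S \<noteq> {}" "S \<subseteq> square"
  proof -
    show "open S" unfolding S_def by (intro open_Times) auto
    have "(1/2, 1 / 2 ^ Suc N) \<in> S" by (simp add: S_def field_simps)
    then show "S \<noteq> {}" by blast
    have "b < 1" if "b < 1 / 2 ^ N" for b :: real
      using that by (rule less_le_trans) simp
    then have "S \<subseteq> square_interior" unfolding S_def square_interior_def by auto
    then show "S \<subseteq> square" using interior_edge_subset_square(1) by blast
  qed
  have W_S: "W (z, i) \<longleftrightarrow> i \<in> Ob" if "z \<in> S" for z i
  proof -
    have "0 < snd z" "snd z < 1 / 2 ^ N" using that by (auto simp: S_def)
    moreover have "1 / 2 ^ N \<le> (1::real)" by simp
    ultimately have "0 < snd z" "snd z < 1" "2 ^ N * snd z < 1"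
      by (linarith, linarith, simp add: field_simps)
    then show ?thesis
      using digit_product_small[of "snd z" N g] by (simp add: W_def P_def)
  qed
  have "A \<notin> null_sets (cover_measure s d h)"
    using S W_S i0 trace[OF ij(1)] by (intro not_null_cover[OF A_sets ij(1)]) auto
  moreover have "space (cover_measure s d h) - A \<notin> null_sets (cover_measure s d h)"
  proof (rule not_null_cover[OF _ ij(2) S(1,2)])
    show "space (cover_measure s d h) - A \<in> cover_sets s d h"
      using A_sets unfolding sets_cover_measure[symmetric] by (rule sets.compl_sets)
    have "cover_point s d h (z, j0) \<notin> A" if "z \<in> S" for z
      using W_S[OF that] j0 mem_A[of "(z, j0)"] that S(3) ij(2) by (auto simp: sheets_def)
    then show "S \<subseteq> sheet_trace s d h j0 (space (cover_measure s d h) - A)"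
      using S(3) ij(2) by (auto simp: sheet_trace_def space_cover_measure sheets_def)
  qed
  moreover have "flow_invariant s d h A"
    unfolding flow_invariant_def
  proof (intro allI impI)
    fix t p q assume "flows_to s d h t p q"
    then show "p \<in> A \<longleftrightarrow> q \<in> A"
    proof induction
      \<comment> \<open>Along a segment neither the height nor the sheet changes, and
        \<open>W\<close> depends on nothing else. Crossings of edges need no case, since the
        invariant set consists of glued points.\<close>
      case (segment i t x y)
      have "(x, y) \<in> square" "(x + t, y) \<in> square"
        using segment(3)[of 0] segment(3)[of t] segment(2) by auto
      then have "((x, y), i) \<in> sheets d" "((x + t, y), i) \<in> sheets d"
        using segment(1) by (auto simp: sheets_def)
      then show ?case
        by (simp add: mem_A W_def)
    qed simp
  qed
  moreover have "A \<in> sets (cover_measure s d h)"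
    using A_sets by (simp add: sets_cover_measure)
  ultimately show ?thesis
    unfolding flow_ergodic_def by blast
qed

end

theorem theorem22:
  fixes d :: nat
    and G :: "(nat \<Rightarrow> nat) set"
    and s0 :: "real \<times> real"
    and \<beta> :: "real \<Rightarrow> real \<times> real"
  defines "\<Gamma> \<equiv> Pi1 s0"
    and "\<H> \<equiv> {H. subgroup H (sym_group d) \<and> H \<subseteq> G \<and> \<not> acts_transitively d H}"
  assumes "d \<ge> 2"
    and "subgroup G (sym_group d)"
    and "acts_transitively d G"
    and "s0 \<in> {0<..<1/2} \<times> {0<..<1/2}"
    and "path \<beta>" and "path_image \<beta> \<subseteq> square_interior"
    and "surface_point (pathstart \<beta>) = inv' phi (surface_point s0)"
    and "pathfinish \<beta> = s0"
  shows
    "(\<forall>h \<in> Hom d \<Gamma> G.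
        (\<exists>H \<in> \<H>. \<forall>k. accumulation_point (Hom_topology d \<Gamma> G) (phi_orbit s0 \<beta> h) k
                      \<longrightarrow> k \<in> Hom d \<Gamma> H)
        \<longrightarrow> \<not> flow_ergodic s0 d h)
     \<and>
     (\<forall>H \<in> \<H>. \<exists>\<C> \<subseteq> topspace (Cov_topology d \<Gamma> G).
        Cov_topology d \<Gamma> G closure_of \<C> = topspace (Cov_topology d \<Gamma> G) \<and>
        (\<forall>h \<in> Hom d \<Gamma> G. conj_class d \<Gamma> G h \<in> \<C> \<longrightarrow>
           connected_space (cover_topology s0 d h) \<and>
           (\<forall>c. accumulation_point (Cov_topology d \<Gamma> G)
                  (\<lambda>n. conj_class d \<Gamma> G (phi_orbit s0 \<beta> h n)) c \<longrightarrow>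
              c \<in> conj_class d \<Gamma> G ` Hom d \<Gamma> H \<and>
              (\<forall>H'. subgroup H' (sym_group d) \<and> H' \<subset> H \<longrightarrow>
                 c \<notin> conj_class d \<Gamma> G ` Hom d \<Gamma> H'))))"
proof -
  interpret monodromy s0 \<beta> d G
    by (intro monodromy.intro base_change.intro monodromy_axioms.intro) fact+
  have connected: "connected_space (cover_topology s0 d h)"
    if trans: "\<forall>i\<in>{1..d}. \<forall>j\<in>{1..d}. \<exists>n. h (gamma s0 n) i = j" for h
  proof (rule connected_cover)
    show "d \<ge> 1" using \<open>d \<ge> 2\<close> by simp
    show "\<exists>n. h (gamma s0 n) i = j" if "i \<in> {1..d}" "j \<in> {1..d}" for i j
      using trans[THEN bspec, OF that(1), THEN bspec, OF that(2)] .
  qed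
  show ?thesis
    unfolding \<Gamma>_def \<H>_def
  proof (intro conjI ballI impI)
    fix h assume h: "h \<in> Hom d (Pi1 s0) G"
      and ex: "\<exists>H\<in>{H. subgroup H (sym_group d) \<and> H \<subseteq> G \<and> \<not> acts_transitively d H}.
        \<forall>k. accumulation_point (Hom_topology d (Pi1 s0) G) (phi_orbit s0 \<beta> h) k \<longrightarrow> k \<in> Hom d (Pi1 s0) H"
    from ex show "\<not> flow_ergodic s0 d h"
    proof (rule bexE)
      fix H assume "H \<in> {H. subgroup H (sym_group d) \<and> H \<subseteq> G \<and> \<not> acts_transitively d H}"
        and acc: "\<forall>k. accumulation_point (Hom_topology d (Pi1 s0) G) (phi_orbit s0 \<beta> h) k \<longrightarrow> k \<in> Hom d (Pi1 s0) H"
      then have H: "subgroup H (sym_group d)" "\<not> acts_transitively d H" by simp_all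
      show "\<not> flow_ergodic s0 d h"
        by (rule not_ergodic[OF h H]) (rule acc[rule_format])
    qed
  next
    fix H assume H: "H \<in> {H. subgroup H (sym_group d) \<and> H \<subseteq> G \<and> \<not> acts_transitively d H}"
    then have "subgroup H (sym_group d)" "H \<subseteq> G" by simp_all
    from dense_recurrent_covers[OF this \<open>acts_transitively d G\<close>] obtain \<C> where C: "\<C> \<subseteq> topspace (Cov_topology d (Pi1 s0) G)"
      "(Cov_topology d (Pi1 s0) G closure_of \<C>) = topspace (Cov_topology d (Pi1 s0) G)"
      "\<forall>h\<in>Hom d (Pi1 s0) G. conj_class d (Pi1 s0) G h \<in> \<C> \<longrightarrow>
        (\<forall>i\<in>{1..d}. \<forall>j\<in>{1..d}. \<exists>n. h (gamma s0 n) i = j) \<and>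
        (\<forall>c. accumulation_point (Cov_topology d (Pi1 s0) G)
               (\<lambda>n. conj_class d (Pi1 s0) G (phi_orbit s0 \<beta> h n)) c \<longrightarrow>
          c \<in> conj_class d (Pi1 s0) G ` Hom d (Pi1 s0) H \<and>
          (\<forall>H'. subgroup H' (sym_group d) \<and> H' \<subset> H \<longrightarrow>
             c \<notin> conj_class d (Pi1 s0) G ` Hom d (Pi1 s0) H'))"
      by (elim exE conjE) (rule that)
    show "\<exists>\<C>\<subseteq>topspace (Cov_topology d (Pi1 s0) G).
        Cov_topology d (Pi1 s0) G closure_of \<C> = topspace (Cov_topology d (Pi1 s0) G) \<and>
        (\<forall>h \<in> Hom d (Pi1 s0) G. conj_class d (Pi1 s0) G h \<in> \<C> \<longrightarrow>
           connected_space (cover_topology s0 d h) \<and>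
           (\<forall>c. accumulation_point (Cov_topology d (Pi1 s0) G)
                  (\<lambda>n. conj_class d (Pi1 s0) G (phi_orbit s0 \<beta> h n)) c \<longrightarrow>
              c \<in> conj_class d (Pi1 s0) G ` Hom d (Pi1 s0) H \<and>
              (\<forall>H'. subgroup H' (sym_group d) \<and> H' \<subset> H \<longrightarrow>
                 c \<notin> conj_class d (Pi1 s0) G ` Hom d (Pi1 s0) H')))"
    proof (intro exI[of _ \<C>] conjI[OF C(1)] conjI[OF C(2)] ballI impI)
      fix h assume "h \<in> Hom d (Pi1 s0) G" "conj_class d (Pi1 s0) G h \<in> \<C>"
      from C(3)[THEN bspec, OF this(1), THEN mp, OF this(2)]
      show "connected_space (cover_topology s0 d h) \<and>
           (\<forall>c. accumulation_point (Cov_topology d (Pi1 s0) G)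
                  (\<lambda>n. conj_class d (Pi1 s0) G (phi_orbit s0 \<beta> h n)) c \<longrightarrow>
              c \<in> conj_class d (Pi1 s0) G ` Hom d (Pi1 s0) H \<and>
              (\<forall>H'. subgroup H' (sym_group d) \<and> H' \<subset> H \<longrightarrow>
                 c \<notin> conj_class d (Pi1 s0) G ` Hom d (Pi1 s0) H'))"
        by (elim conjE) (intro conjI connected)
    qed
  qed
qed

end
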